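(* For every link $L$ in $S^3$ with $n$ components there exist constants $C>0$ and $N$ such that for every integer $r\geqslant 3$ and every $n$-tuple of integers $\mathbf i=(i_1,\dots,i_n)$ with $1\leqslant i_k\leqslant r-1$ for all $k$, the value of the $\mathbf i$-th colored Jones polynomial of $L$ at $t=e^{\frac{2\pi \sqrt{-1}}{r}}$ satisfies $$|J_{L,\mathbf i}(e^{\frac{2\pi \sqrt{-1}}{r}})|\leqslant C r^N .$$ Hence $J_{L,\mathbf i}(e^{\frac{2\pi\sqrt{-1}}{r}})$ grows at most polynomially in $r$.
   Context: Here $t=A^4$ with $A=e^{\frac{\pi\sqrt{-1}}{2r}}$. Let $\langle\cdot\rangle$ be the Kauffman bracket of framed links in $S^3$ with $\langle\emptyset\rangle=1$, defined by $\langle\text{crossing}\rangle=A\langle A\text{-smoothing}\rangle+A^{-1}\langle B\text{-smoothing}\rangle$ and $\langle L\sqcup \text{unknot}\rangle=(-A^2-A^{-2})\langle L\rangle$. For a diagram $D$ of an $n$-component link with blackboard framing, $\langle z^{a_1},\dots,z^{a_n}\rangle_D$ is the bracket of the framed link obtained by replacing the $k$-th component by $a_k$ parallel copies, extended multilinearly to polynomials in $z$. Let $e_0=1$, $e_1=z$, $ze_j=e_{j+1}+e_{j-1}$. The $\mathbf i$-th colored Jones polynomial $J_{L,\mathbf i}(t)$ equals, up to sign and a power of $A$ depending on framing and orientation, $\langle e_{i_1-1},\dots,e_{i_n-1}\rangle_D$ for any diagram $D$ of $L$; it is normalized so that the unknot $U$ has $J_{U,i}(t)=[i]=\frac{A^{2i}-A^{-2i}}{A^2-A^{-2}}$,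 and $J_{L,(1,\dots,1)}(t)=1$. Hence for $|A|=1$ the modulus $|J_{L,\mathbf i}(t)|=|\langle e_{i_1-1},\dots,e_{i_n-1}\rangle_D|$ is well defined for unoriented $L$. *)

theory Defs
  imports "HOL-Analysis.Analysis" "HOL-Computational_Algebra.Polynomial"
begin

section \<open>Link diagrams\<close>

text \<open>
  A link diagram in general position with respect to the height function of the plane is cut by
  horizontal lines into slices, each containing one elementary piece and otherwise only strands
  running upwards.  A diagram is the list of its slices, from bottom to top.  Strands are counted
  from the left, starting with 0.

  \<^item> \<open>Cup p\<close> is a local minimum, creating the strands \<open>p\<close> and \<open>p + 1\<close>;
  \<^item> \<open>Cap p\<close> is a local maximum, joining the strands \<open>p\<close> and \<open>p + 1\<close>;
  \<^item> \<open>Crossing b p\<close> is a crossing of the strands \<open>p\<close> and \<open>p + 1\<close>; the strand going from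
    lower left to upper right is the overstrand if and only if \<open>b\<close> holds.
\<close>

datatype slice = Cup nat | Cap nat | Crossing bool nat

fun admissible :: "nat \<Rightarrow> slice \<Rightarrow> bool" where
  "admissible w (Cup p) \<longleftrightarrow> p \<le> w"
| "admissible w (Cap p) \<longleftrightarrow> p + 2 \<le> w"
| "admissible w (Crossing b p) \<longleftrightarrow> p + 2 \<le> w"

fun width_above :: "nat \<Rightarrow> slice \<Rightarrow> nat" where
  "width_above w (Cup p) = w + 2"
| "width_above w (Cap p) = w - 2"
| "width_above w (Crossing b p) = w"

fun closes_from :: "nat \<Rightarrow> slice list \<Rightarrow> bool" where
  "closes_from w [] \<longleftrightarrow> w = 0"
| "closes_from w (s # D) \<longleftrightarrow> admissible w s \<and> closes_from (width_above w s) D"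

definition link_diagram :: "slice list \<Rightarrow> bool" where
  "link_diagram D \<longleftrightarrow> closes_from 0 D"

text \<open>
  A node \<open>(j, q)\<close> is the point where strand \<open>q\<close> meets the horizontal line at height \<open>j\<close>.  It is
  drawn at \<open>(q, j, 0)\<close> in 3-space, whose points are \<open>(x, height, depth)\<close>; the depth axis points
  towards the viewer.  An arc \<open>(u, m, v)\<close> is the broken line from node \<open>u\<close> to node \<open>v\<close>
  via the point \<open>m\<close>.
\<close>

type_synonym node = "nat \<times> nat"
type_synonym space = "real \<times> real \<times> real"

definition node_point :: "node \<Rightarrow> space" where
  "node_point u = (real (snd u), real (fst u), 0)"

definition through_arc :: "nat \<Rightarrow> nat \<Rightarrow> nat \<Rightarrow> real \<Rightarrow> node \<times> space \<times> node" where
  "through_arc j p q d = ((j, p), ((real p + real q) / 2, real j + 1 / 2, d), (Suc j, q))"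

fun slice_arcs :: "nat \<Rightarrow> nat \<Rightarrow> slice \<Rightarrow> (node \<times> space \<times> node) set" where
  "slice_arcs j w (Cup p) =
     {((Suc j, p), (real p + 1 / 2, real j + 1 / 2, 0), (Suc j, Suc p))}
     \<union> {through_arc j q q 0 | q. q < p}
     \<union> {through_arc j q (q + 2) 0 | q. p \<le> q \<and> q < w}"
| "slice_arcs j w (Cap p) =
     {((j, p), (real p + 1 / 2, real j + 1 / 2, 0), (j, Suc p))}
     \<union> {through_arc j q q 0 | q. q < p}
     \<union> {through_arc j (q + 2) q 0 | q. p \<le> q \<and> q + 2 < w}"
| "slice_arcs j w (Crossing b p) =
     {through_arc j p (Suc p) (if b then 1 else 0), through_arc j (Suc p) p (if b then 0 else 1)}
     \<union> {through_arc j q q 0 | q. q < w \<and> q \<noteq> p \<and> q \<noteq> Suc p}"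

fun arcs_from :: "nat \<Rightarrow> nat \<Rightarrow> slice list \<Rightarrow> (node \<times> space \<times> node) set" where
  "arcs_from j w [] = {}"
| "arcs_from j w (s # D) = slice_arcs j w s \<union> arcs_from (Suc j) (width_above w s) D"

definition arcs :: "slice list \<Rightarrow> (node \<times> space \<times> node) set" where
  "arcs D = arcs_from 0 0 D"

definition adjacent :: "slice list \<Rightarrow> node rel" where
  "adjacent D = {(u, v). \<exists>m. (u, m, v) \<in> arcs D \<or> (v, m, u) \<in> arcs D}"

definition nodes :: "slice list \<Rightarrow> node set" where
  "nodes D = Field (adjacent D)"

text \<open>Components, and hence closed curves if there are no crossings.\<close>

definition num_components :: "slice list \<Rightarrow> nat" where
  "num_components D = card (nodes D // (adjacent D)\<^sup>*)"

text \<open>A numbering of the components by \<open>0, \<dots>, n - 1\<close>, given on the nodes.\<close>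

definition labelled_diagram :: "nat \<Rightarrow> slice list \<Rightarrow> (node \<Rightarrow> nat) \<Rightarrow> bool" where
  "labelled_diagram n D c \<longleftrightarrow>
     link_diagram D \<and> c ` nodes D = {..<n} \<and>
     (\<forall>u\<in>nodes D. \<forall>v\<in>nodes D. c u = c v \<longleftrightarrow> (u, v) \<in> (adjacent D)\<^sup>*)"


section \<open>Links in the 3-sphere\<close>

type_synonym space4 = "space \<times> real"

definition S3 :: "space4 set" where
  "S3 = sphere 0 1"

definition inverse_stereographic :: "space \<Rightarrow> space4" where
  "inverse_stereographic x = ((2 / (1 + x \<bullet> x)) *\<^sub>R x, (x \<bullet> x - 1) / (1 + x \<bullet> x))"

definition realization :: "slice list \<Rightarrow> (node \<Rightarrow> nat) \<Rightarrow> nat \<Rightarrow> space4 set" where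
  "realization D c k = inverse_stereographic `
     (\<Union>(u, m, v) \<in> {(u, m, v) \<in> arcs D. c u = k}.
        closed_segment (node_point u) m \<union> closed_segment m (node_point v))"

definition ambient_isotopic :: "nat \<Rightarrow> (nat \<Rightarrow> space4 set) \<Rightarrow> (nat \<Rightarrow> space4 set) \<Rightarrow> bool" where
  "ambient_isotopic n K L \<longleftrightarrow>
     (\<exists>h. homotopic_with_canon (\<lambda>f. \<exists>g. homeomorphism S3 S3 f g) S3 S3 id h \<and>
          (\<forall>k<n. h ` K k = L k))"

definition diagram_of :: "nat \<Rightarrow> (nat \<Rightarrow> space4 set) \<Rightarrow> slice list \<Rightarrow> (node \<Rightarrow> nat) \<Rightarrow> bool" where
  "diagram_of n L D c \<longleftrightarrow> labelled_diagram n D c \<and> ambient_isotopic n (realization D c) L"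

text \<open>
  An \<open>n\<close>-component link with components \<open>L 0, \<dots>, L (n - 1)\<close>.  The last conjunct is
  tameness; it holds for all smooth and all polygonal links, and excludes wild ones.
\<close>

definition is_link :: "nat \<Rightarrow> (nat \<Rightarrow> space4 set) \<Rightarrow> bool" where
  "is_link n L \<longleftrightarrow>
     (\<forall>k<n. L k \<subseteq> S3 \<and> L k homeomorphic (sphere 0 1 :: complex set)) \<and>
     (\<forall>k<n. \<forall>l<n. k \<noteq> l \<longrightarrow> L k \<inter> L l = {}) \<and>
     (\<exists>D c. diagram_of n L D c)"


section \<open>The Kauffman bracket\<close>

text \<open>
  All crossingless diagrams obtained by smoothing the crossings, each with the number of
  A-smoothings minus the number of B-smoothings.  The A-smoothing joins the two regions swept out
  when the overstrand is turned counterclockwise: if the overstrand rises to the right, these are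
  the regions above and below the crossing, and two upward strands remain.
\<close>

fun smoothings :: "slice list \<Rightarrow> (int \<times> slice list) list" where
  "smoothings [] = [(0, [])]"
| "smoothings (Cup p # D) = map (\<lambda>(m, S). (m, Cup p # S)) (smoothings D)"
| "smoothings (Cap p # D) = map (\<lambda>(m, S). (m, Cap p # S)) (smoothings D)"
| "smoothings (Crossing b p # D) =
     map (\<lambda>(m, S). (m + (if b then 1 else -1), S)) (smoothings D) @
     map (\<lambda>(m, S). (m + (if b then -1 else 1), Cap p # Cup p # S)) (smoothings D)"

definition kauffman_bracket :: "complex \<Rightarrow> slice list \<Rightarrow> complex" where
  "kauffman_bracket A D =
     (\<Sum>(m, S) \<leftarrow> smoothings D. A powi m * (- (A powi 2) - A powi (-2)) ^ num_components S)"

text \<open>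
  The blackboard cabling in which the strand through the node \<open>u\<close> is replaced by \<open>\<mu> u\<close>
  parallel strands.  The first argument is the height of the bottom of the diagram.
\<close>

fun cable_from :: "nat \<Rightarrow> (node \<Rightarrow> nat) \<Rightarrow> slice list \<Rightarrow> slice list" where
  "cable_from j \<mu> [] = []"
| "cable_from j \<mu> (Cup p # D) =
     (let P = (\<Sum>q<p. \<mu> (j, q)); m = \<mu> (Suc j, p)
      in map (\<lambda>s. Cup (P + s)) [0..<m]) @ cable_from (Suc j) \<mu> D"
| "cable_from j \<mu> (Cap p # D) =
     (let P = (\<Sum>q<p. \<mu> (j, q)); m = \<mu> (j, p)
      in map (\<lambda>s. Cap (P + s)) (rev [0..<m])) @ cable_from (Suc j) \<mu> D"
| "cable_from j \<mu> (Crossing b p # D) =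
     (let P = (\<Sum>q<p. \<mu> (j, q)); m = \<mu> (j, p); l = \<mu> (j, Suc p)
      in concat (map (\<lambda>s. map (\<lambda>t. Crossing b (P + s + t)) [0..<l]) (rev [0..<m])))
     @ cable_from (Suc j) \<mu> D"

text \<open>
  The bracket of \<open>z ^ a 0, \<dots>, z ^ a (n - 1)\<close> on a labelled diagram, and its multilinear
  extension to polynomials \<open>f 0, \<dots>, f (n - 1)\<close> in \<open>z\<close>.
\<close>

definition cabled_bracket ::
    "complex \<Rightarrow> slice list \<Rightarrow> (node \<Rightarrow> nat) \<Rightarrow> (nat \<Rightarrow> nat) \<Rightarrow> complex" where
  "cabled_bracket A D c a = kauffman_bracket A (cable_from 0 (a \<circ> c) D)"

definition poly_bracket ::
    "complex \<Rightarrow> nat \<Rightarrow> slice list \<Rightarrow> (node \<Rightarrow> nat) \<Rightarrow> (nat \<Rightarrow> int poly) \<Rightarrow> complex" where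
  "poly_bracket A n D c f =
     (\<Sum>a \<in> PiE {..<n} (\<lambda>k. {..degree (f k)}).
        (\<Prod>k<n. of_int (coeff (f k) (a k))) * cabled_bracket A D c a)"

fun e_poly :: "nat \<Rightarrow> int poly" where
  "e_poly 0 = 1"
| "e_poly (Suc 0) = [:0, 1:]"
| "e_poly (Suc (Suc j)) = [:0, 1:] * e_poly (Suc j) - e_poly j"


section \<open>The modulus of the colored Jones polynomial\<close>

text \<open>
  The modulus of the \<open>i\<close>-th colored Jones polynomial of \<open>L\<close> at \<open>t = A ^ 4\<close>, for \<open>A\<close> on the
  unit circle.  The colored Jones polynomial is the bracket below up to a sign and a power of
  \<open>A\<close>, so its modulus is that of the bracket, which does not depend on the diagram chosen.
\<close>

definition colored_jones_modulus ::
    "nat \<Rightarrow> (nat \<Rightarrow> space4 set) \<Rightarrow> (nat \<Rightarrow> nat) \<Rightarrow> complex \<Rightarrow> real" where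
  "colored_jones_modulus n L i A =
     (let (D, c) = (SOME (D, c). diagram_of n L D c)
      in cmod (poly_bracket A n D c (\<lambda>k. e_poly (i k - 1))))"

end

theory Submission
  imports Defs
begin

text \<open>
  The theorem only concerns one chosen diagram, so it suffices to bound the bracket of a fixed
  labelled diagram \<open>D\<close>.  The Temperley-Lieb category at \<open>A\<close> acts on functions of walks on the path
  \<open>1, \<dots>, r - 1\<close>: a cup or cap inserts or removes a detour, with a square root of a ratio of quantum
  integers as weight, and a crossing acts by its two smoothings.  A closed diagram acts as its bracket.

  The Jones-Wenzl idempotent on \<open>j\<close> strands exists for \<open>j < r\<close>, and placing it on every strand
  realizes \<open>e_poly j\<close>: on \<open>j + 1\<close> strands, the idempotent of \<open>j\<close> strands next to a further strand is
  the sum of the idempotent of \<open>j + 1\<close> strands and of one factoring through the idempotent of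
  \<open>j - 1\<close> strands.  This sum is inserted at one point of a component only; each summand, being
  idempotent, then spreads along the whole component, and the second one can be replaced by the
  object it factors through.  Components are oriented since a strand running down carries the
  rotated idempotent.

  As the quantum integers of \<open>1, \<dots>, r - 1\<close> are positive, caps are minus the adjoints of cups for
  the standard Hermitian form.  So Jones-Wenzl idempotents are orthogonal projections, crossings
  are unitary, and a cup or cap of colour \<open>j\<close> multiplies the
  squared norm by at most the quantum integer of \<open>j + 1\<close>, hence by at most \<open>r\<close>.  Therefore
  the squared modulus of the bracket is at most \<open>r ^ length D\<close>.
\<close>

section \<open>The path model\<close>

text \<open>A termwise bound fails: the coefficients of \<open>e_poly j\<close> and the brackets of
  the cablings can both grow exponentially with the colour, so the cancellation between them has to
  be kept. The idempotents keep it, but they yield a bound only in a positive definite form. At a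
  root of unity the Temperley-Lieb algebra is not semisimple and its trace form degenerates; walks
  confined to the heights \<open>1, ..., r - 1\<close> give a representation that does carry such a
  form. The confinement is consistent because the quantum integers of the two missing heights
  \<open>0\<close> and \<open>r\<close> vanish, so the loop relation survives at both ends of the
  path. A closed diagram has no strands at its top and bottom, where a single walk starting at
  height 1 is left; a bound on norms is therefore a bound on the bracket. The factor
  \<open>r\<close> is paid once per slice of the original diagram, not of its cabling. This makes
  the exponent independent of the colours.\<close>

text \<open>Walks are infinite and a strand at position \<open>p\<close> is the step from \<open>h p\<close> to \<open>h (p + 1)\<close>,
  so that strands may be added to the right without changing the model.\<close>

type_synonym vec = "(nat \<Rightarrow> nat) \<Rightarrow> complex"

definition remove_pair :: "nat \<Rightarrow> (nat \<Rightarrow> nat) \<Rightarrow> nat \<Rightarrow> nat" where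
  "remove_pair p h i = (if i \<le> p then h i else h (i + 2))"

text \<open>The value at \<open>p + 2\<close> is again \<open>h p\<close>: the two inserted steps
  leave the height at \<open>p\<close> and return to it.\<close>

definition insert_pair :: "nat \<Rightarrow> nat \<Rightarrow> (nat \<Rightarrow> nat) \<Rightarrow> nat \<Rightarrow> nat" where
  "insert_pair p x h i =
     (if i \<le> p then h i else if i = p + 1 then x else h (i - 2))"

lemma index_cases:
  fixes i q :: nat
  obtains "i \<le> q" | "i = Suc q" | k where "i = k + 2" "q \<le> k"
proof -
  have "i \<le> q \<or> i = Suc q \<or> i = (i - 2) + 2 \<and> q \<le> i - 2" by linarith
  then show ?thesis using that by blast
qed

definition lin_op :: "(vec \<Rightarrow> vec) \<Rightarrow> bool" where
  "lin_op T \<longleftrightarrow> (\<forall>s t \<psi> \<phi>. T (\<lambda>h. s * \<psi> h + t * \<phi> h) = (\<lambda>h. s * T \<psi> h + t * T \<phi> h))"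

locale path_model =
  fixes r :: nat
  assumes r_ge_3: "r \<ge> 3"
begin

definition A :: complex where
  "A = exp (of_real pi * \<i> / (2 * of_nat r))"

text \<open>The quantum integer \<open>(A^(2k) - A^(-2k)) / (A^2 - A^(-2))\<close> in trigonometric
  form, as \<open>A^2\<close> has argument \<open>pi / r\<close>.\<close>

definition qint :: "nat \<Rightarrow> real" where
  "qint k = sin (real k * pi / real r) / sin (pi / real r)"

definition nb :: "nat \<Rightarrow> nat set" where
  "nb y = {x. 1 \<le> x \<and> x < r \<and> (x = Suc y \<or> y = Suc x)}"

text \<open>The sign is chosen such that a zigzag, a cup \<open>kap y x\<close> followed by a cap \<open>- kap x y\<close>, acts as 1.\<close>

definition kap :: "nat \<Rightarrow> nat \<Rightarrow> real" where
  "kap y x = (if y < x then 1 else -1) * sqrt (qint x / qint y)"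

definition paths :: "(nat \<Rightarrow> nat) set" where
  "paths = {h. \<forall>i. 1 \<le> h i \<and> h i < r \<and> h (Suc i) \<in> nb (h i)}"

definition space :: "vec set" where
  "space = {\<psi>. \<forall>h. h \<notin> paths \<longrightarrow> \<psi> h = 0}"

text \<open>The value 0 off \<open>paths\<close> puts the image in \<open>space\<close> for every
  argument, so membership of such an image never has to be carried along.\<close>

definition cup :: "nat \<Rightarrow> vec \<Rightarrow> vec" where
  "cup p \<psi> h = (if h \<in> paths \<and> h p = h (p + 2)
     then of_real (kap (h p) (h (Suc p))) * \<psi> (remove_pair p h) else 0)"

definition cap :: "nat \<Rightarrow> vec \<Rightarrow> vec" where
  "cap p \<psi> h = (if h \<in> paths
     then \<Sum>x\<in>nb (h p). - of_real (kap (h p) x) * \<psi> (insert_pair p x h) else 0)"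

lemma finite_nb [simp]: "finite (nb y)"
  by (rule finite_subset[of _ "{..<r}"]) (auto simp: nb_def)

lemma sin_pos: "0 < sin (pi / real r)"
  using r_ge_3 by (intro sin_gt_zero) (auto simp: field_simps)

lemma qint_0 [simp]: "qint 0 = 0" and qint_1 [simp]: "qint (Suc 0) = 1" and qint_r: "qint r = 0"
  using sin_pos r_ge_3 by (auto simp: qint_def)

lemma qint_2: "qint 2 = 2 * cos (pi / real r)"
  using sin_pos sin_double[of "pi / real r"] by (simp add: qint_def)

lemma qint_rec: "qint (Suc (Suc k)) = qint 2 * qint (Suc k) - qint k"
proof -
  have "sin (real (Suc (Suc k)) * pi / r) + sin (real k * pi / r)
      = 2 * sin (real (Suc k) * pi / r) * cos (pi / r)"
    unfolding sin_plus_sin by (simp add: field_simps add_divide_distrib)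
  then show ?thesis
    unfolding qint_2 unfolding qint_def using sin_pos by (simp add: field_simps)
qed

text \<open>The angle \<open>k pi / r\<close> stays strictly between 0 and pi. Here the particular
  root of unity matters: positivity makes the square roots in \<open>kap\<close> genuine.\<close>

lemma qint_pos: "0 < qint k" if "1 \<le> k" "k < r"
proof -
  have "0 < sin (real k * pi / real r)"
    using that by (intro sin_gt_zero) (auto simp: field_simps)
  then show ?thesis using sin_pos by (simp add: qint_def)
qed

text \<open>The addition formula gives \<open>|sin (k x)| <= k |sin x|\<close> by induction. For
  \<open>k <= r\<close> this is the factor \<open>r\<close> that a slice costs in the final
  bound.\<close>

lemma qint_le: "\<bar>qint k\<bar> \<le> real k"
proof -
  have "\<bar>sin (real k * x)\<bar> \<le> real k * \<bar>sin x\<bar>" for x :: real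
  proof (induction k)
    case (Suc k)
    have "\<bar>sin (real (Suc k) * x)\<bar> = \<bar>sin (real k * x) * cos x + cos (real k * x) * sin x\<bar>"
      by (simp add: distrib_right sin_add algebra_simps)
    also have "\<dots> \<le> \<bar>sin (real k * x)\<bar> * \<bar>cos x\<bar> + \<bar>cos (real k * x)\<bar> * \<bar>sin x\<bar>"
      by (metis abs_mult abs_triangle_ineq)
    also have "\<dots> \<le> \<bar>sin (real k * x)\<bar> * 1 + 1 * \<bar>sin x\<bar>"
      by (intro add_mono mult_mono) auto
    finally show ?case using Suc by (simp add: distrib_right)
  qed simp
  from this[of "pi / r"] show ?thesis
    using sin_pos by (simp add: qint_def abs_divide field_simps)
qed

lemma nb_range: "x \<in> nb y \<Longrightarrow> 1 \<le> x \<and> x < r"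
  by (auto simp: nb_def)

lemma nb_sym: "x \<in> nb y \<Longrightarrow> 1 \<le> y \<Longrightarrow> y < r \<Longrightarrow> y \<in> nb x"
  by (auto simp: nb_def)

lemma kap_kap: "kap y x * kap x y = -1" if "x \<in> nb y" "1 \<le> y" "y < r"
proof -
  have "qint x > 0" "qint y > 0" using that nb_range qint_pos by auto
  moreover have "x \<noteq> y" using that by (auto simp: nb_def)
  ultimately show ?thesis
    by (simp add: kap_def real_sqrt_mult[symmetric])
qed

text \<open>The quantum integers form the Perron-Frobenius eigenvector of the path
  \<open>1, ..., r - 1\<close>, with eigenvalue \<open>qint 2\<close>. Dividing the eigenvalue
  equation at \<open>y\<close> by \<open>qint y\<close> gives the sum.\<close>

lemma sum_kap_square: "(\<Sum>x\<in>nb y. kap y x * kap y x) = qint 2" if "1 \<le> y" "y < r"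
proof -
  have qy: "qint y > 0" using that qint_pos by auto
  have *: "kap y x * kap y x = qint x / qint y" if "x \<in> nb y" for x
    using that nb_range[of x y] qint_pos[of x] qy by (simp add: kap_def)
  have "(\<Sum>x\<in>nb y. kap y x * kap y x) = (\<Sum>x\<in>nb y. qint x / qint y)"
    using * by (rule sum.cong[OF refl])
  \<comment> \<open>At an end of the path one neighbour is missing; it is 0 or \<open>r\<close>,
    where \<open>qint\<close> vanishes, so it may be added back.\<close>
  also have "\<dots> = (\<Sum>x\<in>{Suc y, y - 1}. qint x / qint y)"
  proof (rule sum.mono_neutral_left)
    show "nb y \<subseteq> {Suc y, y - 1}" by (auto simp: nb_def)
    show "\<forall>x\<in>{Suc y, y - 1} - nb y. qint x / qint y = 0"
    proof
      fix x assume "x \<in> {Suc y, y - 1} - nb y"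
      then have "x = 0 \<or> x = r" using that by (auto simp: nb_def)
      then show "qint x / qint y = 0" using qint_r by auto
    qed
  qed simp
  also have "\<dots> = (qint (Suc y) + qint (y - 1)) / qint y"
    using that by (simp add: add_divide_distrib)
  also have "\<dots> = qint 2"
    using qint_rec[of "y - 1"] that qy by simp
  finally show ?thesis .
qed

lemma A_norm [simp]: "cmod A = 1"
proof -
  have "A = exp (\<i> * of_real (pi / (2 * real r)))" by (simp add: A_def mult.commute)
  then show ?thesis by (simp add: norm_exp_i_times)
qed

lemma A_nz [simp]: "A \<noteq> 0"
  using A_norm by force

lemma A_loop: "A powi 2 + A powi (-2) = of_real (qint 2)"
proof -
  have "A powi 2 = exp (\<i> * of_real (pi / real r))"
    by (simp add: A_def power2_eq_square flip: exp_add)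
  moreover have "A powi (-2) = exp (- (\<i> * of_real (pi / real r)))"
    by (metis calculation exp_minus power_int_minus)
  ultimately show ?thesis
    by (simp add: qint_2 cos_of_real[symmetric] cos_exp_eq)
qed

lemma paths_nb: "h \<in> paths \<Longrightarrow> h (Suc i) \<in> nb (h i)"
  and paths_range: "h \<in> paths \<Longrightarrow> 1 \<le> h i \<and> h i < r"
  by (auto simp: paths_def)

lemma remove_paths:
  assumes "h \<in> paths" "h p = h (p + 2)"
  shows "remove_pair p h \<in> paths"
proof -
  have "remove_pair p h (Suc i) \<in> nb (remove_pair p h i)" for i
  proof -
    consider "i < p" | "i = p" | "i > p" by linarith
    then show ?thesis
      using paths_nb[OF assms(1), of i] paths_nb[OF assms(1), of "i + 2"] assms(2)
      by cases (auto simp: remove_pair_def)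
  qed
  moreover have "1 \<le> remove_pair p h i \<and> remove_pair p h i < r" for i
    using paths_range[OF assms(1)] by (simp add: remove_pair_def)
  ultimately show ?thesis by (auto simp: paths_def)
qed

lemma insert_paths: "insert_pair p x h \<in> paths" if "h \<in> paths" "x \<in> nb (h p)"
proof -
  have *: "insert_pair p x h (Suc i) \<in> nb (insert_pair p x h i)" for i
  proof -
    consider "i < p" | "i = p" | "i = Suc p" | k where "i = k + 2" "p \<le> k"
    proof -
      have "i < p \<or> i = p \<or> i = Suc p \<or> i = (i - 2) + 2 \<and> p \<le> i - 2" by linarith
      then show ?thesis using that by blast
    qed
    then show ?thesis
    proof cases
      case 3
      then show ?thesis using that paths_range[OF that(1)] nb_sym
        by (simp add: insert_pair_def)
    next
      case 4
      then show ?thesis using paths_nb[OF that(1)]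
        by (simp add: insert_pair_def Suc_diff_le)
    qed (use that paths_nb[OF that(1)] in \<open>auto simp: insert_pair_def\<close>)
  qed
  moreover have "1 \<le> insert_pair p x h i \<and> insert_pair p x h i < r" for i
    using paths_range[OF that(1)] nb_range[OF that(2)] by (auto simp: insert_pair_def)
  ultimately show ?thesis by (auto simp: paths_def)
qed

section \<open>Elementary relations between cups and caps\<close>

lemma cup_space [simp]: "cup p \<psi> \<in> space" and cap_space [simp]: "cap p \<psi> \<in> space"
  by (auto simp: space_def cup_def cap_def)

lemma lin_space [simp]: "\<psi> \<in> space \<Longrightarrow> \<phi> \<in> space \<Longrightarrow> (\<lambda>h. s * \<psi> h + t * \<phi> h) \<in> space"
  by (auto simp: space_def)

lemma lin_op_cup: "lin_op (cup p)"
  by (auto simp: lin_op_def cup_def fun_eq_iff algebra_simps)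

lemma lin_op_cap: "lin_op (cap p)"
  unfolding lin_op_def
proof (intro allI ext)
  fix s t :: complex and \<psi> \<phi> :: vec and h
  show "cap p (\<lambda>h. s * \<psi> h + t * \<phi> h) h = s * cap p \<psi> h + t * cap p \<phi> h"
    by (cases "h \<in> paths")
       (simp_all add: cap_def sum_distrib_left sum.distrib[symmetric] sum_subtractf[symmetric] sum_negf[symmetric] algebra_simps)
qed

text \<open>For \<open>p <= q\<close> the two detours occupy different stretches of the walk and
  their weights do not interact. The shift by 2 is that of the strands to the right of
  \<open>p\<close>. The next three lemmas follow the same pattern.\<close>

lemma cup_cup:
  assumes "p \<le> q"
  shows "cup p (cup q \<psi>) = cup (q + 2) (cup p \<psi>)"
proof
  fix h
  have rr: "remove_pair q (remove_pair p h) = remove_pair p (remove_pair (q + 2) h)"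
    using assms by (auto simp: remove_pair_def fun_eq_iff)
  have e1: "remove_pair p h q = h (q + 2)" "remove_pair p h (Suc q) = h (q + 3)" 
     "remove_pair p h (q + 2) = h (q + 4)" if "h p = h (p + 2)"
    using assms that by (auto simp: remove_pair_def numeral_eq_Suc le_Suc_eq)
  have e2: "remove_pair (q + 2) h p = h p" "remove_pair (q + 2) h (Suc p) = h (Suc p)"
     "remove_pair (q + 2) h (p + 2) = h (p + 2)" 
    using assms by (auto simp: remove_pair_def)
  show "cup p (cup q \<psi>) h = cup (q + 2) (cup p \<psi>) h"
    using remove_paths[of h p] remove_paths[of h "q + 2"] rr e1 e2
    by (auto simp: cup_def numeral_eq_Suc)
qed

lemma cup_cap:
  assumes "p \<le> q"
  shows "cup p (cap q \<psi>) = cap (q + 2) (cup p \<psi>)"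
proof
  fix h
  have rr: "insert_pair q x (remove_pair p h) = remove_pair p (insert_pair (q + 2) x h)"
    if "h p = h (p + 2)" for x
  proof
    fix i show "insert_pair q x (remove_pair p h) i = remove_pair p (insert_pair (q + 2) x h) i"
    proof (cases i q rule: index_cases)
      case (3 k)
      then show ?thesis
        using assms that by (cases "k = p") (auto simp: remove_pair_def insert_pair_def)
    qed (use assms that in \<open>auto simp: remove_pair_def insert_pair_def\<close>)
  qed
  have e1: "remove_pair p h q = h (q + 2)" if "h p = h (p + 2)"
    using assms that by (auto simp: remove_pair_def)
  have e2: "insert_pair (q + 2) x h p = h p" "insert_pair (q + 2) x h (Suc p) = h (Suc p)"
     "insert_pair (q + 2) x h (p + 2) = h (p + 2)" for x
    using assms by (auto simp: insert_pair_def)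
  show "cup p (cap q \<psi>) h = cap (q + 2) (cup p \<psi>) h"
    using remove_paths[of h p] insert_paths[of h _ "q + 2"]
    unfolding cup_def cap_def e2
    by (cases "h p = h (p + 2)") (auto simp: rr e1 sum_distrib_left mult_ac intro!: sum.cong)
qed

lemma cap_cup:
  assumes "p \<le> q"
  shows "cap p (cup (q + 2) \<psi>) = cup q (cap p \<psi>)"
proof
  fix h
  have rr: "remove_pair (q + 2) (insert_pair p x h) = insert_pair p x (remove_pair q h)" for x
  proof
    fix i show "remove_pair (q + 2) (insert_pair p x h) i = insert_pair p x (remove_pair q h) i"
      using assms by (cases i p rule: index_cases) (auto simp: remove_pair_def insert_pair_def)
  qed
  have e1: "insert_pair p x h (q + 2) = h q" "insert_pair p x h (Suc (q + 2)) = h (Suc q)"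
     "insert_pair p x h (q + 2 + 2) = h (q + 2)" for x
    using assms by (auto simp: insert_pair_def numeral_eq_Suc Suc_diff_le le_Suc_eq)
  have e2: "remove_pair q h p = h p"
    using assms by (auto simp: remove_pair_def)
  show "cap p (cup (q + 2) \<psi>) h = cup q (cap p \<psi>) h"
    using remove_paths[of h q] insert_paths[of h _ p]
    unfolding cup_def cap_def e1 e2 rr
    by (auto simp: sum_distrib_left mult_ac intro!: sum.cong)
qed

lemma cap_cap:
  assumes "p \<le> q"
  shows "cap p (cap (q + 2) \<psi>) = cap q (cap p \<psi>)"
proof
  fix h
  have rr: "insert_pair (q + 2) y (insert_pair p x h) = insert_pair p x (insert_pair q y h)" for x y
  proof
    fix i show "insert_pair (q + 2) y (insert_pair p x h) i = insert_pair p x (insert_pair q y h) i"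
      using assms by (cases i p rule: index_cases) (auto simp: insert_pair_def)
  qed
  have e1: "insert_pair p x h (q + 2) = h q" for x
    using assms by (auto simp: insert_pair_def numeral_eq_Suc Suc_diff_le le_Suc_eq)
  have e2: "insert_pair q x h p = h p" for x
    using assms by (auto simp: insert_pair_def)
  show "cap p (cap (q + 2) \<psi>) h = cap q (cap p \<psi>) h"
  proof (cases "h \<in> paths")
    case True
    let ?f = "\<lambda>x y. of_real (kap (h p) x) * (of_real (kap (h q) y) * \<psi> (insert_pair p x (insert_pair q y h)))"
    have "cap p (cap (q + 2) \<psi>) h = (\<Sum>x\<in>nb (h p). \<Sum>y\<in>nb (h q). ?f x y)"
      using insert_paths[OF True, of _ p] True unfolding cap_def e1 rr
      by (auto simp: sum_distrib_left sum_negf intro!: sum.cong)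
    also have "\<dots> = (\<Sum>y\<in>nb (h q). \<Sum>x\<in>nb (h p). ?f x y)"
      by (rule sum.swap)
    also have "\<dots> = cap q (cap p \<psi>) h"
      using insert_paths[OF True, of _ q] True unfolding cap_def e2
      by (auto simp: sum_distrib_left sum_negf mult_ac intro!: sum.cong)
    finally show ?thesis .
  qed (simp add: cap_def)
qed

lemma cap_cup_loop:
  assumes "\<psi> \<in> space"
  shows "cap p (cup p \<psi>) = (\<lambda>h. - of_real (qint 2) * \<psi> h)"
proof
  fix h
  show "cap p (cup p \<psi>) h = - of_real (qint 2) * \<psi> h"
  proof (cases "h \<in> paths")
    case True
    have "remove_pair p (insert_pair p x h) = h" for x
      by (auto simp: remove_pair_def insert_pair_def fun_eq_iff)
    moreover have "insert_pair p x h p = h p" "insert_pair p x h (Suc p) = x" "insert_pair p x h (p + 2) = h p" for x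
      by (auto simp: insert_pair_def)
    ultimately have "cap p (cup p \<psi>) h = (\<Sum>x\<in>nb (h p). - of_real (kap (h p) x * kap (h p) x) * \<psi> h)"
      using True insert_paths[OF True] by (auto simp: cap_def cup_def intro!: sum.cong)
    also have "\<dots> = - of_real (\<Sum>x\<in>nb (h p). kap (h p) x * kap (h p) x) * \<psi> h"
      by (simp add: sum_negf sum_distrib_right)
    finally show ?thesis using sum_kap_square paths_range[OF True] by metis
  qed (use assms in \<open>auto simp: space_def cap_def\<close>)
qed

text \<open>The cup demands \<open>x = h (Suc p)\<close>, so a single term of the sum in the cap
  survives, and \<open>kap_kap\<close> makes its weight 1.\<close>

lemma cap_cup_Suc:
  assumes "\<psi> \<in> space"
  shows "cap p (cup (Suc p) \<psi>) = \<psi>"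
proof
  fix h
  show "cap p (cup (Suc p) \<psi>) h = \<psi> h"
  proof (cases "h \<in> paths")
    case True
    have e: "insert_pair p x h (Suc p) = x" "insert_pair p x h (Suc p + 2) = h (Suc p)"
       "insert_pair p x h (Suc (Suc p)) = h p" for x
      by (auto simp: insert_pair_def)
    have r: "remove_pair (Suc p) (insert_pair p (h (Suc p)) h) = h"
      by (auto simp: remove_pair_def insert_pair_def fun_eq_iff le_Suc_eq)
    have "cap p (cup (Suc p) \<psi>) h = (\<Sum>x\<in>nb (h p). if x = h (Suc p) then 
        - of_real (kap (h p) (h (Suc p)) * kap (h (Suc p)) (h p)) * \<psi> h else 0)"
      using True insert_paths[OF True] unfolding cap_def cup_def e
      by (simp only: True if_True) (rule sum.cong, auto simp: r)
    also have "\<dots> = \<psi> h"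
      using paths_nb[OF True] kap_kap[of "h (Suc p)" "h p"] paths_range[OF True] by simp
    finally show ?thesis .
  qed (use assms in \<open>auto simp: space_def cap_def\<close>)
qed

lemma cap_Suc_cup:
  assumes "\<psi> \<in> space"
  shows "cap (Suc p) (cup p \<psi>) = \<psi>"
proof
  fix h
  show "cap (Suc p) (cup p \<psi>) h = \<psi> h"
  proof (cases "h \<in> paths")
    case True
    have e: "insert_pair (Suc p) x h p = h p" "insert_pair (Suc p) x h (p + 2) = x"
       "insert_pair (Suc p) x h (Suc p) = h (Suc p)" for x
      by (auto simp: insert_pair_def)
    have r: "remove_pair p (insert_pair (Suc p) (h p) h) = h"
      by (auto simp: remove_pair_def insert_pair_def fun_eq_iff le_Suc_eq)
    have nb: "h p \<in> nb (h (Suc p))" using True paths_nb paths_range nb_sym by blast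
    have "cap (Suc p) (cup p \<psi>) h = (\<Sum>x\<in>nb (h (Suc p)). if x = h p then 
        - of_real (kap (h (Suc p)) (h p) * kap (h p) (h (Suc p))) * \<psi> h else 0)"
      using True insert_paths[OF True] unfolding cap_def cup_def e
      by (simp only: True if_True) (rule sum.cong, auto simp: r)
    also have "\<dots> = \<psi> h"
      using nb kap_kap[of "h p" "h (Suc p)"] paths_range[OF True] by simp
    finally show ?thesis .
  qed (use assms in \<open>auto simp: space_def cap_def\<close>)
qed


section \<open>Planar diagrams as operators placed at any strand\<close>

type_synonym family = "nat \<Rightarrow> vec \<Rightarrow> vec"

definition fam_id :: family where "fam_id p \<psi> = \<psi>"

text \<open>A family gives the operator at every offset \<open>p\<close>, the number of strands to
  its left. Tensoring with \<open>t\<close> strands on the left is thus a shift, and strands on the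
  right need no change because walks are infinite.\<close>

definition fam_at :: "(nat \<Rightarrow> vec \<Rightarrow> vec) \<Rightarrow> nat \<Rightarrow> family" where "fam_at f t p = f (p + t)"

definition fam_comp :: "family \<Rightarrow> family \<Rightarrow> family" where "fam_comp g f p \<psi> = g p (f p \<psi>)"

definition fam_lin :: "complex \<Rightarrow> family \<Rightarrow> complex \<Rightarrow> family \<Rightarrow> family" where
  "fam_lin s f t g p \<psi> h = s * f p \<psi> h + t * g p \<psi> h"

text \<open>Equality is asked on \<open>space\<close> only, because the loop and zigzag relations
  fail off it.\<close>

definition fam_eq :: "family \<Rightarrow> family \<Rightarrow> bool" where
  "fam_eq f g \<longleftrightarrow> (\<forall>p. \<forall>\<psi>\<in>space. f p \<psi> = g p \<psi>)"

text \<open>\<open>mor a b f f'\<close>: the family \<open>f\<close> is a combination of crossingless diagrams from \<open>a\<close> to \<open>b\<close>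
  strands, and \<open>f'\<close> is its rotation by half a turn, from \<open>b\<close> to \<open>a\<close> strands.\<close>

inductive mor :: "nat \<Rightarrow> nat \<Rightarrow> family \<Rightarrow> family \<Rightarrow> bool" where
  fam_id: "mor a a fam_id fam_id"
| fam_cup: "t \<le> a \<Longrightarrow> mor a (a + 2) (fam_at cup t) (fam_at cap (a - t))"
| fam_cap: "t \<le> a \<Longrightarrow> mor (a + 2) a (fam_at cap t) (fam_at cup (a - t))"
| fam_comp: "mor a b f f' \<Longrightarrow> mor b c g g' \<Longrightarrow> mor a c (fam_comp g f) (fam_comp f' g')"
| fam_lin: "mor a b f f' \<Longrightarrow> mor a b g g' \<Longrightarrow> mor a b (fam_lin s f t g) (fam_lin s f' t g')"
| fam_cong: "mor a b f f' \<Longrightarrow> fam_eq g f \<Longrightarrow> fam_eq g' f' \<Longrightarrow> mor a b g g'"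

lemma fam_unfold:
  "fam_id = (\<lambda>p \<psi>. \<psi>)"
  "fam_at k t = (\<lambda>p. k (p + t))"
  "fam_comp g f = (\<lambda>p \<psi>. g p (f p \<psi>))"
  "fam_lin x f y g = (\<lambda>p \<psi> h. x * f p \<psi> h + y * g p \<psi> h)"
  by (simp_all add: fam_id_def fam_at_def fam_comp_def fam_lin_def fun_eq_iff)

lemma fam_simps:
  "fam_id p \<psi> = \<psi>" "fam_at k t p = k (p + t)" "fam_comp g f p \<psi> = g p (f p \<psi>)"
  "fam_lin x f y g p \<psi> = (\<lambda>h. x * f p \<psi> h + y * g p \<psi> h)"
  by (simp_all add: fam_unfold)

lemma fam_at_simps:
  "fam_at fam_id k = fam_id" "fam_at f 0 = f" "fam_at (fam_at f s) t = fam_at f (t + s)"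
  "fam_at (fam_comp g f) k = fam_comp (fam_at g k) (fam_at f k)"
  "fam_at (fam_lin x f y g) k = fam_lin x (fam_at f k) y (fam_at g k)"
  by (simp_all add: fam_unfold add.assoc)

lemma fam_eqI: "(\<And>p \<psi>. \<psi> \<in> space \<Longrightarrow> f p \<psi> = g p \<psi>) \<Longrightarrow> fam_eq f g"
  by (simp add: fam_eq_def)

lemma fam_eqD: "fam_eq f g \<Longrightarrow> \<psi> \<in> space \<Longrightarrow> f p \<psi> = g p \<psi>"
  by (simp add: fam_eq_def)

text \<open>Weaker than \<open>lin_op\<close>: the rule \<open>fam_cong\<close> determines a family
  only on \<open>space\<close>, so linearity of a diagram can be asserted only there.\<close>

definition lin_on :: "(vec \<Rightarrow> vec) \<Rightarrow> bool" where
  "lin_on T \<longleftrightarrow> (\<forall>s t. \<forall>\<psi>\<in>space. \<forall>\<phi>\<in>space.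
     T (\<lambda>h. s * \<psi> h + t * \<phi> h) = (\<lambda>h. s * T \<psi> h + t * T \<phi> h))"

lemma lin_onD: "lin_on T \<Longrightarrow> \<psi> \<in> space \<Longrightarrow> \<phi> \<in> space \<Longrightarrow>
    T (\<lambda>h. s * \<psi> h + t * \<phi> h) = (\<lambda>h. s * T \<psi> h + t * T \<phi> h)"
  by (auto simp: lin_on_def)

lemma lin_op_on: "lin_op T \<Longrightarrow> lin_on T"
  by (auto simp: lin_op_def lin_on_def)

text \<open>Rotation by half a turn is an involution: it exchanges the rules for \<open>cup\<close>
  and \<open>cap\<close>, sends \<open>t\<close> to \<open>a - t\<close> and reverses
  composites.\<close>

lemma mor_sym: "mor a b f f' \<Longrightarrow> mor b a f' f"
proof (induction rule: mor.induct)
  case (fam_cup t a)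
  then show ?case using mor.fam_cap[of "a - t" a] by simp
next
  case (fam_cap t a)
  then show ?case using mor.fam_cup[of "a - t" a] by simp
next
  case (fam_cong a b f f' g g')
  show ?case by (rule mor.fam_cong[OF fam_cong.IH fam_cong.hyps(3,2)])
next
  case (fam_comp a b f f' c g g')
  show ?case by (rule mor.fam_comp[OF fam_comp.IH(2,1)])
next
  case (fam_lin a b f f' g g' s t)
  show ?case by (rule mor.fam_lin[OF fam_lin.IH])
qed (rule mor.fam_id)

lemma mor_space: "mor a b f f' \<Longrightarrow> \<psi> \<in> space \<Longrightarrow> f p \<psi> \<in> space"
  by (induction arbitrary: \<psi> rule: mor.induct) (simp_all add: fam_simps fam_eqD)

lemma lin_onI: "(\<And>s t \<psi> \<phi>. \<psi> \<in> space \<Longrightarrow> \<phi> \<in> space \<Longrightarrow>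
    T (\<lambda>h. s * \<psi> h + t * \<phi> h) = (\<lambda>h. s * T \<psi> h + t * T \<phi> h)) \<Longrightarrow> lin_on T"
  unfolding lin_on_def by blast

lemma lin_on_comp:
  assumes "lin_on (f p)" "lin_on (g p)" "\<And>\<psi>. \<psi> \<in> space \<Longrightarrow> f p \<psi> \<in> space"
  shows "lin_on (fam_comp g f p)"
proof (rule lin_onI)
  fix s t \<psi> \<phi> assume *: "\<psi> \<in> space" "\<phi> \<in> space"
  show "fam_comp g f p (\<lambda>h. s * \<psi> h + t * \<phi> h) = (\<lambda>h. s * fam_comp g f p \<psi> h + t * fam_comp g f p \<phi> h)"
    unfolding fam_simps lin_onD[OF assms(1) *] lin_onD[OF assms(2) assms(3)[OF *(1)] assms(3)[OF *(2)]] ..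
qed

lemma lin_on_lin:
  assumes "lin_on (f p)" "lin_on (g p)"
  shows "lin_on (fam_lin u f v g p)"
proof (rule lin_onI)
  fix s t \<psi> \<phi> assume *: "\<psi> \<in> space" "\<phi> \<in> space"
  show "fam_lin u f v g p (\<lambda>h. s * \<psi> h + t * \<phi> h) = (\<lambda>h. s * fam_lin u f v g p \<psi> h + t * fam_lin u f v g p \<phi> h)"
    unfolding fam_simps lin_onD[OF assms(1) *] lin_onD[OF assms(2) *] by (rule ext) (simp add: algebra_simps)
qed

lemma lin_on_cong:
  assumes "lin_on (f p)" "fam_eq g f"
  shows "lin_on (g p)"
proof (rule lin_onI)
  fix s t \<psi> \<phi> assume *: "\<psi> \<in> space" "\<phi> \<in> space"
  have e: "\<phi> \<in> space \<Longrightarrow> g p \<phi> = f p \<phi>" for \<phi>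
    using assms(2) by (simp add: fam_eq_def)
  show "g p (\<lambda>h. s * \<psi> h + t * \<phi> h) = (\<lambda>h. s * g p \<psi> h + t * g p \<phi> h)"
    unfolding e[OF *(1)] e[OF *(2)] e[OF lin_space[OF *]]
    by (rule lin_onD[OF assms(1) *])
qed

lemma mor_lin_on: "mor a b f f' \<Longrightarrow> lin_on (f p)"
proof (induction rule: mor.induct)
  case (fam_comp a b f f' c g g')
  show ?case
  proof (rule lin_on_comp[of f p g, OF fam_comp.IH])
    fix \<psi> assume "\<psi> \<in> space"
    then show "f p \<psi> \<in> space" by (rule mor_space[OF fam_comp.hyps(1)])
  qed
next
  case (fam_lin a b f f' g g' u v)
  show ?case by (rule lin_on_lin[of f p g, OF fam_lin.IH])
next
  case (fam_cong a b f f' g g')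
  show ?case by (rule lin_on_cong[of f p g, OF fam_cong.IH fam_cong.hyps(2)])
next
  case (fam_id a)
  show ?case by (rule lin_onI) (simp add: fam_simps)
qed (simp_all add: fam_simps lin_op_on lin_op_cup lin_op_cap)

lemma mor_lin_apply: "mor a b f f' \<Longrightarrow> \<psi> \<in> space \<Longrightarrow> \<phi> \<in> space \<Longrightarrow>
    f p (\<lambda>h. s * \<psi> h + t * \<phi> h) = (\<lambda>h. s * f p \<psi> h + t * f p \<phi> h)"
  by (rule lin_onD[OF mor_lin_on])

text \<open>Induction over \<open>g\<close> reduces the claim to single cups and caps.
  \<open>n\<close> and \<open>m\<close> are the position of the same strand before and after
  \<open>T\<close> acts.\<close>

lemma mor_commute_right:
  assumes "mor c d g g'" "lin_on T" "\<And>\<psi>. \<psi> \<in> space \<Longrightarrow> T \<psi> \<in> space"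
    and "\<And>q \<psi>. \<psi> \<in> space \<Longrightarrow> T (cup (n + q) \<psi>) = cup (m + q) (T \<psi>)"
    and "\<And>q \<psi>. \<psi> \<in> space \<Longrightarrow> T (cap (n + q) \<psi>) = cap (m + q) (T \<psi>)"
    and "\<psi> \<in> space"
  shows "T (g (n + q) \<psi>) = g (m + q) (T \<psi>)"
  using assms(1,6)
proof (induction arbitrary: \<psi> rule: mor.induct)
  case (fam_cup t a)
  then show ?case using assms(4)[of \<psi> "q + t"] by (simp add: fam_simps add.assoc)
next
  case (fam_cap t a)
  then show ?case using assms(5)[of \<psi> "q + t"] by (simp add: fam_simps add.assoc)
next
  case (fam_comp a b f f' c g g')
  then show ?case using mor_space[OF fam_comp.hyps(1)] by (simp add: fam_simps)
next
  case (fam_lin a b f f' g g' s t)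
  then show ?case
    by (simp only: fam_simps lin_onD[OF assms(2) mor_space[OF fam_lin.hyps(1) fam_lin.prems] mor_space[OF fam_lin.hyps(2) fam_lin.prems]])
next
  case (fam_cong a b f f' g g')
  then show ?case using assms(3) by (simp add: fam_eqD)
qed (simp add: fam_simps)

text \<open>The interchange law of a monoidal category; \<open>q\<close> counts the strands between
  the two diagrams. Induction over \<open>f\<close> leaves a single cup or cap, and
  \<open>mor_commute_right\<close> then deals with \<open>g\<close>.\<close>

theorem interchange:
  assumes "mor a b f f'" "mor c d g g'" "\<psi> \<in> space"
  shows "f p (g (p + a + q) \<psi>) = g (p + b + q) (f p \<psi>)"
  using assms(1,3)
proof (induction arbitrary: \<psi> rule: mor.induct)
  case (fam_cup t a)
  show ?case unfolding fam_simps
  proof (rule mor_commute_right[OF assms(2), where T = "cup (p + t)" and n = "p + a" and m = "p + (a + 2)"])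
    fix q \<psi>
    show "cup (p + t) (cup (p + a + q) \<psi>) = cup (p + (a + 2) + q) (cup (p + t) \<psi>)"
      using cup_cup[of "p + t" "p + a + q"] fam_cup.hyps by (simp add: add.commute add.left_commute)
    show "cup (p + t) (cap (p + a + q) \<psi>) = cap (p + (a + 2) + q) (cup (p + t) \<psi>)"
      using cup_cap[of "p + t" "p + a + q"] fam_cup.hyps by (simp add: add.commute add.left_commute)
  qed (use fam_cup in \<open>simp_all add: lin_op_on lin_op_cup\<close>)
next
  case (fam_cap t a)
  show ?case unfolding fam_simps
  proof (rule mor_commute_right[OF assms(2), where T = "cap (p + t)" and n = "p + (a + 2)" and m = "p + a"])
    fix q \<psi>
    show "cap (p + t) (cup (p + (a + 2) + q) \<psi>) = cup (p + a + q) (cap (p + t) \<psi>)"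
      using cap_cup[of "p + t" "p + a + q"] fam_cap.hyps by (simp add: add.commute add.left_commute)
    show "cap (p + t) (cap (p + (a + 2) + q) \<psi>) = cap (p + a + q) (cap (p + t) \<psi>)"
      using cap_cap[of "p + t" "p + a + q"] fam_cap.hyps by (simp add: add.commute add.left_commute)
  qed (use fam_cap in \<open>simp_all add: lin_op_on lin_op_cap\<close>)
next
  case (fam_comp a b f f' c g1 g1')
  then show ?case using mor_space[OF fam_comp.hyps(1)] by (simp add: fam_simps)
next
  case (fam_lin a b f f' g1 g1' s t)
  then show ?case
    by (simp only: fam_simps mor_lin_apply[OF assms(2) mor_space[OF fam_lin.hyps(1) fam_lin.prems] mor_space[OF fam_lin.hyps(2) fam_lin.prems]])
next
  case (fam_cong a b f f' g1 g1')
  then show ?case using mor_space[OF assms(2)] by (simp add: fam_eqD)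
qed (simp add: fam_simps)

text \<open>Half a turn exchanges left and right, so the \<open>l\<close> strands added on the right
  of \<open>f\<close> stand on the left of \<open>f'\<close>.\<close>

lemma mor_embed: "mor a b f f' \<Longrightarrow> mor (k + a + l) (k + b + l) (fam_at f k) (fam_at f' l)"
proof (induction rule: mor.induct)
  case (fam_cup t a)
  then have "k + a + l - (k + t) = l + (a - t)" by simp
  then show ?case using fam_cup mor.fam_cup[of "k + t" "k + a + l"] by (simp add: fam_at_simps)
next
  case (fam_cap t a)
  then have "k + a + l - (k + t) = l + (a - t)" by simp
  then show ?case using fam_cap mor.fam_cap[of "k + t" "k + a + l"] by (simp add: fam_at_simps)
next
  case (fam_comp a b f f' c g g')
  show ?case unfolding fam_at_simps by (rule mor.fam_comp[OF fam_comp.IH])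
next
  case (fam_lin a b f f' g g' s t)
  show ?case unfolding fam_at_simps by (rule mor.fam_lin[OF fam_lin.IH])
next
  case (fam_cong a b f f' g g')
  show ?case by (rule mor.fam_cong[OF fam_cong.IH])
    (use fam_cong.hyps in \<open>simp_all add: fam_simps fam_eq_def\<close>)
qed (simp add: fam_at_simps mor.fam_id)

lemma mor_tensor:
  assumes "mor a b f f'" "mor c d g g'"
  shows "mor (a + c) (b + d) (fam_comp f (fam_at g a)) (fam_comp g' (fam_at f' d))"
proof -
  have "mor (a + c) (a + d) (fam_at g a) g'"
    using mor_embed[OF assms(2), of a 0] by (simp add: fam_at_simps)
  moreover have "mor (a + d) (b + d) f (fam_at f' d)"
    using mor_embed[OF assms(1), of 0 d] by (simp add: fam_at_simps)
  ultimately show ?thesis by (rule mor.fam_comp)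
qed

section \<open>Crossings and the pieces of a cabled diagram\<close>

definition crs_coeff :: "bool \<Rightarrow> complex" where
  "crs_coeff b = (if b then A else inverse A)"

lemma crs_coeff_mult [simp]: "crs_coeff b * crs_coeff (\<not> b) = 1"
  by (simp add: crs_coeff_def)

lemma crs_coeff_loop: "crs_coeff b * crs_coeff b + crs_coeff (\<not> b) * crs_coeff (\<not> b) = of_real (qint 2)"
proof -
  have "A * A + inverse A * inverse A = of_real (qint 2)"
    using A_loop by (simp add: power_int_minus power2_eq_square)
  then show ?thesis by (cases b) (simp_all add: crs_coeff_def add.commute)
qed

fun slice_act :: "slice \<Rightarrow> vec \<Rightarrow> vec" where
  "slice_act (Cup p) = cup p"
| "slice_act (Cap p) = cap p"
| "slice_act (Crossing b p) = (\<lambda>\<psi> h. crs_coeff b * \<psi> h + crs_coeff (\<not> b) * cup p (cap p \<psi>) h)"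

abbreviation crs :: "bool \<Rightarrow> nat \<Rightarrow> vec \<Rightarrow> vec" where
  "crs b p \<equiv> slice_act (Crossing b p)"

definition word_act :: "slice list \<Rightarrow> vec \<Rightarrow> vec" where
  "word_act D = fold slice_act D"

text \<open>Nested parallel cups, outermost first. \<open>cups\<close>, \<open>caps\<close> and
  \<open>cross\<close> are built on the slice lists of \<open>cable_from\<close>, so each cabled
  slice acts by one of them.\<close>

definition cups :: "nat \<Rightarrow> family" where
  "cups m P = word_act (map (\<lambda>s. Cup (P + s)) [0..<m])"

definition caps :: "nat \<Rightarrow> family" where
  "caps m P = word_act (map (\<lambda>s. Cap (P + s)) (rev [0..<m]))"

text \<open>One strand at \<open>p\<close> travels to the right across \<open>l\<close> strands;
  \<open>cross\<close> lets a bundle of \<open>m\<close> strands do so, its rightmost strand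
  first.\<close>

definition row :: "bool \<Rightarrow> nat \<Rightarrow> family" where
  "row b l p = word_act (map (\<lambda>t. Crossing b (p + t)) [0..<l])"

definition cross :: "bool \<Rightarrow> nat \<Rightarrow> nat \<Rightarrow> family" where
  "cross b m l P = word_act (concat (map (\<lambda>s. map (\<lambda>t. Crossing b (P + s + t)) [0..<l]) (rev [0..<m])))"

lemma cups_simps [simp]: "cups 0 P \<psi> = \<psi>" "cups (Suc m) P \<psi> = cup (P + m) (cups m P \<psi>)"
  by (simp_all add: cups_def word_act_def)

lemma caps_simps [simp]: "caps 0 P \<psi> = \<psi>" "caps (Suc m) P \<psi> = caps m P (cap (P + m) \<psi>)"
  by (simp_all add: caps_def word_act_def)

lemma row_simps [simp]: "row b 0 p \<psi> = \<psi>" "row b (Suc l) p \<psi> = crs b (p + l) (row b l p \<psi>)"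
  by (simp_all add: row_def word_act_def del: slice_act.simps)

lemma cross_simps [simp]: "cross b 0 l P \<psi> = \<psi>"
  "cross b (Suc m) l P \<psi> = cross b m l P (row b l (P + m) \<psi>)"
  by (simp_all add: cross_def row_def word_act_def)

declare slice_act.simps(3) [simp del]

text \<open>Forgets which family the rotation is; that matters only when a diagram slides around a
  turn.\<close>

definition mor1 :: "nat \<Rightarrow> nat \<Rightarrow> family \<Rightarrow> bool" where
  "mor1 a b f \<longleftrightarrow> (\<exists>f'. mor a b f f')"

lemma mor1I: "mor a b f f' \<Longrightarrow> mor1 a b f"
  by (auto simp: mor1_def)

lemma mor1_comp: "mor1 a b f \<Longrightarrow> mor1 b c g \<Longrightarrow> mor1 a c (fam_comp g f)"
  unfolding mor1_def by (auto intro: mor.fam_comp)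

lemma mor1_embed: "mor1 a b f \<Longrightarrow> mor1 (k + a + l) (k + b + l) (fam_at f k)"
  unfolding mor1_def by (auto intro: mor_embed)

lemma mor1_id: "mor1 a a fam_id"
  by (rule mor1I[OF mor.fam_id])

lemma mor1_space: "mor1 a b f \<Longrightarrow> \<psi> \<in> space \<Longrightarrow> f p \<psi> \<in> space"
  by (auto simp: mor1_def mor_space)

lemma interchange1:
  assumes "mor1 a b f" "mor1 c d g" "\<psi> \<in> space" "p + a \<le> q"
  shows "f p (g q \<psi>) = g (q - a + b) (f p \<psi>)"
proof -
  obtain f' g' where "mor a b f f'" "mor c d g g'" using assms by (auto simp: mor1_def)
  from interchange[OF this assms(3), of p "q - (p + a)"] show ?thesis
    using assms(4) by (simp add: add.commute)
qed

lemma mor1_cup: "mor1 0 2 cup" and mor1_cap: "mor1 2 0 cap"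
  using mor.fam_cup[of 0 0, THEN mor1I] mor.fam_cap[of 0 0, THEN mor1I] by (simp_all add: fam_at_simps numeral_2_eq_2)

text \<open>Half a turn maps a crossing to itself, because both of its smoothings are
  invariant.\<close>

lemma mor_crs: "mor 2 2 (crs b) (crs b)"
proof -
  have *: "mor 2 2 (fam_comp cup cap) (fam_comp cup cap)"
    using mor.fam_comp[OF mor.fam_cap[of 0 0] mor.fam_cup[of 0 0]] by (simp add: fam_at_simps numeral_2_eq_2)
  show ?thesis
    by (rule mor.fam_cong[OF mor.fam_lin[OF mor.fam_id *, of "crs_coeff b" "crs_coeff (\<not> b)"]])
      (simp_all add: fam_simps fam_eq_def slice_act.simps(3))
qed

lemma mor1_crs: "mor1 2 2 (crs b)"
  by (rule mor1I[OF mor_crs])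

lemma crs_space [simp]: "\<psi> \<in> space \<Longrightarrow> crs b p \<psi> \<in> space"
  by (rule mor1_space[OF mor1_crs])

lemma cups_fam: "cups 0 = fam_id" "cups (Suc m) = fam_comp (fam_at cup m) (cups m)"
  and caps_fam: "caps 0 = fam_id" "caps (Suc m) = fam_comp (caps m) (fam_at cap m)"
  and row_fam: "row b 0 = fam_id" "row b (Suc l) = fam_comp (fam_at (crs b) l) (row b l)"
  and cross_fam: "cross b 0 l = fam_id" "cross b (Suc m) l = fam_comp (cross b m l) (fam_at (row b l) m)"
  by (intro ext, simp add: fam_simps)+

lemma mor1_cups: "mor1 0 (2 * m) (cups m)"
proof (induction m)
  case (Suc m)
  have "mor1 (2 * m) (2 * Suc m) (fam_at cup m)"
    using mor.fam_cup[of m "2 * m", THEN mor1I] by simp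
  from mor1_comp[OF Suc this] show ?case by (simp add: cups_fam)
qed (simp add: cups_fam mor1_id)

lemma mor1_caps: "mor1 (2 * m) 0 (caps m)"
proof (induction m)
  case (Suc m)
  have "mor1 (2 * Suc m) (2 * m) (fam_at cap m)"
    using mor.fam_cap[of m "2 * m", THEN mor1I] by simp
  from mor1_comp[OF this Suc] show ?case by (simp add: caps_fam)
qed (simp add: caps_fam mor1_id)

lemma mor1_row: "mor1 (Suc l) (Suc l) (row b l)"
proof (induction l)
  case (Suc l)
  have "mor1 (Suc (Suc l)) (Suc (Suc l)) (row b l)"
    using mor1_embed[OF Suc, of 0 1] by (simp add: fam_at_simps)
  moreover have "mor1 (Suc (Suc l)) (Suc (Suc l)) (fam_at (crs b) l)"
    using mor1_embed[OF mor1_crs, of l 0] by simp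
  ultimately show ?case unfolding row_fam by (rule mor1_comp)
qed (simp add: row_fam mor1_id)

lemma mor1_cross: "mor1 (m + l) (m + l) (cross b m l)"
proof (induction m)
  case (Suc m)
  have "mor1 (Suc m + l) (Suc m + l) (cross b m l)"
    using mor1_embed[OF Suc, of 0 1] by (simp add: fam_at_simps)
  moreover have "mor1 (Suc m + l) (Suc m + l) (fam_at (row b l) m)"
    using mor1_embed[OF mor1_row, where k = m and l = 0] by (simp add: ac_simps)
  ultimately show ?case unfolding cross_fam by (rule mor1_comp[rotated])
qed (simp add: cross_fam mor1_id)

lemma cups_space [simp]: "\<psi> \<in> space \<Longrightarrow> cups m P \<psi> \<in> space"
  and caps_space [simp]: "\<psi> \<in> space \<Longrightarrow> caps m P \<psi> \<in> space"
  and row_space [simp]: "\<psi> \<in> space \<Longrightarrow> row b l P \<psi> \<in> space"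
  and cross_space [simp]: "\<psi> \<in> space \<Longrightarrow> cross b m l P \<psi> \<in> space"
  by (simp_all add: mor1_space[OF mor1_cups] mor1_space[OF mor1_caps] mor1_space[OF mor1_row] mor1_space[OF mor1_cross])

section \<open>Sliding diagrams around bundles of cups and caps\<close>

lemma cup_cups_slide: "t \<le> a \<Longrightarrow> \<psi> \<in> space \<Longrightarrow>
  cup (P + t) (cups a P \<psi>) = cap (P + (a + 2) + (a - t)) (cups (a + 2) P \<psi>)"
proof (induction a rule: dec_induct)
  \<comment> \<open>For \<open>t = a\<close> the new cup lies inside the innermost one and a zigzag
    creates it; for larger \<open>a\<close> the innermost cup commutes with the pieces on both
    sides.\<close>
  case base
  then show ?case by (simp add: cap_Suc_cup)
next
  case (step n)
  have "cap (P + (Suc n + 2) + (Suc n - t)) (cup (P + n + 2) (cups (n + 2) P \<psi>))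
      = cup (P + n + 2) (cap (P + (n + 2) + (n - t)) (cups (n + 2) P \<psi>))"
    using cup_cap[of "P + n + 2" "P + (n + 2) + (n - t)"] step.hyps
    by (simp add: Suc_diff_le)
  also have "\<dots> = cup (P + n + 2) (cup (P + t) (cups n P \<psi>))"
    using step by simp
  also have "\<dots> = cup (P + t) (cup (P + n) (cups n P \<psi>))"
    using cup_cup[of "P + t" "P + n"] step by simp
  finally show ?case by simp
qed

lemma cap_cups_slide: "t \<le> a \<Longrightarrow> \<psi> \<in> space \<Longrightarrow>
  cap (P + t) (cups (a + 2) P \<psi>) = cup (P + a + (a - t)) (cups a P \<psi>)"
proof (induction a rule: dec_induct)
  case base
  then show ?case by (simp add: cap_cup_Suc)
next
  case (step n)
  have "cap (P + t) (cup (P + n + 2) (cups (n + 2) P \<psi>))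
      = cup (P + n) (cap (P + t) (cups (n + 2) P \<psi>))"
    using cap_cup[of "P + t" "P + n"] step.hyps by simp
  also have "\<dots> = cup (P + n) (cup (P + n + (n - t)) (cups n P \<psi>))"
    using step by simp
  also have "\<dots> = cup (P + n + (n - t) + 2) (cup (P + n) (cups n P \<psi>))"
    using cup_cup[of "P + n" "P + n + (n - t)"] step by simp
  finally show ?case using step.hyps by (simp add: Suc_diff_le)
qed

text \<open>Pushed along the bundle from the left legs to the right legs, a diagram arrives turned
  by half a turn. This is the geometric meaning of the second family in \<open>mor\<close>.\<close>

theorem cups_slide:
  assumes "mor a b f f'" "\<psi> \<in> space"
  shows "f P (cups a P \<psi>) = f' (P + b) (cups b P \<psi>)"
  using assms
proof (induction arbitrary: \<psi> rule: mor.induct)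
  case (fam_cup t a)
  then show ?case unfolding fam_simps by (rule cup_cups_slide)
next
  case (fam_cap t a)
  then show ?case unfolding fam_simps by (rule cap_cups_slide)
next
  case (fam_comp a b f f' c g g')
  \<comment> \<open>Once \<open>f\<close> has become \<open>f'\<close> on the right legs, it
    commutes with \<open>g\<close> on the left legs, and \<open>g\<close> can be slid in
    turn.\<close>
  then show ?case
    using interchange[OF fam_comp.hyps(2) mor_sym[OF fam_comp.hyps(1)], of "cups b P \<psi>" P 0] by (simp add: fam_simps)
next
  case (fam_cong a b f f' g g')
  then show ?case by (simp add: fam_eqD)
qed (auto simp: fam_simps)

lemma caps_cup_slide: "t \<le> a \<Longrightarrow> \<psi> \<in> space \<Longrightarrow>
  caps (a + 2) P (cup (P + t) \<psi>) = caps a P (cap (P + a + (a - t)) \<psi>)"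
proof (induction a arbitrary: \<psi> rule: dec_induct)
  case base
  then show ?case by (simp add: cap_Suc_cup)
next
  case (step n)
  have "cap (P + n + 2) (cup (P + t) \<psi>) = cup (P + t) (cap (P + n) \<psi>)"
    using cup_cap[of "P + t" "P + n"] step by simp
  then have "caps (Suc n + 2) P (cup (P + t) \<psi>) = caps n P (cap (P + n + (n - t)) (cap (P + n) \<psi>))"
    using step.IH[of "cap (P + n) \<psi>"] by simp
  also have "cap (P + n + (n - t)) (cap (P + n) \<psi>) = cap (P + n) (cap (P + n + (n - t) + 2) \<psi>)"
    using cap_cap[of "P + n" "P + n + (n - t)"] by simp
  finally show ?case using step.hyps by (simp add: Suc_diff_le)
qed

lemma caps_cap_slide: "t \<le> a \<Longrightarrow> \<psi> \<in> space \<Longrightarrow>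
  caps a P (cap (P + t) \<psi>) = caps (a + 2) P (cup (P + (a + 2) + (a - t)) \<psi>)"
proof (induction a arbitrary: \<psi> rule: dec_induct)
  case base
  then show ?case using cap_cup_Suc[of \<psi> "P + Suc t"] by simp
next
  case (step n)
  have "cap (P + n + 2) (cup (P + (n + 2) + (n - t) + 2) \<psi>) = cup (P + (n + 2) + (n - t)) (cap (P + n + 2) \<psi>)"
    using cap_cup[of "P + n + 2" "P + (n + 2) + (n - t)"] step by simp
  moreover have "P + (Suc n + 2) + (Suc n - t) = P + (n + 2) + (n - t) + 2"
    using step.hyps by simp
  ultimately have "caps (Suc n + 2) P (cup (P + (Suc n + 2) + (Suc n - t)) \<psi>)
     = caps (n + 2) P (cup (P + (n + 2) + (n - t)) (cap (P + n + 2) \<psi>))"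
    by (simp only: add_Suc caps_simps(2)) simp
  also have "\<dots> = caps n P (cap (P + t) (cap (P + n + 2) \<psi>))"
    using step.IH[of "cap (P + n + 2) \<psi>"] by simp
  also have "cap (P + t) (cap (P + n + 2) \<psi>) = cap (P + n) (cap (P + t) \<psi>)"
    using cap_cap[of "P + t" "P + n"] step.hyps by simp
  finally show ?case by simp
qed

definition caps_slides :: "nat \<Rightarrow> nat \<Rightarrow> family \<Rightarrow> family \<Rightarrow> bool" where
  "caps_slides a b f f' \<longleftrightarrow> (\<forall>P. \<forall>\<psi>\<in>space. caps b P (f P \<psi>) = caps a P (f' (P + a) \<psi>))"

lemma mor1_lin_on: "mor1 a b f \<Longrightarrow> lin_on (f p)"
  by (auto simp: mor1_def intro: mor_lin_on)

lemma lin_on_caps: "lin_on (caps m P)"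
  by (rule mor1_lin_on[OF mor1_caps])

lemma mor_caps_slides: "mor a b f f' \<Longrightarrow> caps_slides a b f f'"
proof (induction rule: mor.induct)
  case (fam_cup t a)
  then show ?case unfolding caps_slides_def fam_simps using caps_cup_slide by blast
next
  case (fam_cap t a)
  then show ?case unfolding caps_slides_def fam_simps using caps_cap_slide by blast
next
  case (fam_comp a b f f' c g g')
  show ?case unfolding caps_slides_def fam_simps
  proof (intro allI ballI)
    fix P \<psi> assume \<psi>: "\<psi> \<in> space"
    have "caps c P (g P (f P \<psi>)) = caps b P (g' (P + b) (f P \<psi>))"
      using fam_comp.IH(2) mor_space[OF fam_comp.hyps(1) \<psi>] by (simp add: caps_slides_def)
    also have "g' (P + b) (f P \<psi>) = f P (g' (P + a) \<psi>)"
      using interchange[OF fam_comp.hyps(1) mor_sym[OF fam_comp.hyps(2)] \<psi>, of P 0] by simp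
    also have "caps b P \<dots> = caps a P (f' (P + a) (g' (P + a) \<psi>))"
      using fam_comp.IH(1) mor_space[OF mor_sym[OF fam_comp.hyps(2)] \<psi>] by (simp add: caps_slides_def)
    finally show "caps c P (g P (f P \<psi>)) = caps a P (f' (P + a) (g' (P + a) \<psi>))" .
  qed
next
  case (fam_lin a b f f' g g' s t)
  show ?case unfolding caps_slides_def fam_simps
  proof (intro allI ballI)
    fix P \<psi> assume \<psi>: "\<psi> \<in> space"
    note m = mor_space[OF fam_lin.hyps(1) \<psi>, of P] mor_space[OF fam_lin.hyps(2) \<psi>, of P]
      mor_space[OF mor_sym[OF fam_lin.hyps(1)] \<psi>, of "P + a"] mor_space[OF mor_sym[OF fam_lin.hyps(2)] \<psi>, of "P + a"]
    show "caps b P (\<lambda>h. s * f P \<psi> h + t * g P \<psi> h) = caps a P (\<lambda>h. s * f' (P + a) \<psi> h + t * g' (P + a) \<psi> h)"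
      unfolding lin_onD[OF lin_on_caps m(1,2)] lin_onD[OF lin_on_caps m(3,4)]
      using fam_lin.IH \<psi> by (simp add: caps_slides_def)
  qed
next
  case (fam_cong a b f f' g g')
  then show ?case by (simp add: caps_slides_def fam_eqD)
next
  case (fam_id a)
  show ?case by (simp add: caps_slides_def fam_simps)
qed

theorem caps_slide:
  assumes "mor a b f f'" "\<psi> \<in> space"
  shows "caps b P (f P \<psi>) = caps a P (f' (P + a) \<psi>)"
  using mor_caps_slides[OF assms(1)] assms(2) by (simp add: caps_slides_def)

lemma cups_outer: "cups (Suc m) P \<psi> = cups m (Suc P) (cup P \<psi>)"
  by (induction m) auto

text \<open>The innermost cap slides down past the inner cups and straightens the outermost cup,
  which leaves a zigzag of \<open>m\<close> strands.\<close>

lemma caps_cups_zigzag: "\<psi> \<in> space \<Longrightarrow> caps m (P + m) (cups m P \<psi>) = \<psi>"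
proof (induction m arbitrary: P)
  case (Suc m)
  have "cap (P + Suc m + m) (cups m (Suc P) (cup P \<psi>)) = cups m (Suc P) (cap (Suc P) (cup P \<psi>))"
    using interchange1[OF mor1_cups mor1_cap, of "cup P \<psi>" "Suc P" "Suc P" m] by (simp add: mult_2 mult_2_right ac_simps)
  then show ?case using Suc.IH[of "Suc P"] Suc.prems
    by (simp add: cups_outer cap_Suc_cup del: cups_simps(2))
qed simp

text \<open>Bending both ends recovers the rotation from the operator alone, so it does not depend
  on how the diagram was built. Identities between families can therefore be rotated.\<close>

lemma mor_dual_unique:
  assumes "mor a b f f'" "mor a b g g'" "\<And>p \<psi>. \<psi> \<in> space \<Longrightarrow> f p \<psi> = g p \<psi>" "\<psi> \<in> space"
  shows "f' p \<psi> = g' p \<psi>"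
proof -
  have *: "f' p \<psi> = caps b (p + a) (f (p + a) (cups a p \<psi>))" if f: "mor a b f f'" for f f'
  proof -
    obtain k where k: "mor (2 * b) 0 (caps b) k" using mor1_caps by (auto simp: mor1_def)
    have "f' p \<psi> = f' p (caps b (p + b) (cups b p \<psi>))" using assms by (simp add: caps_cups_zigzag)
    also have "\<dots> = caps b (p + a) (f' p (cups b p \<psi>))"
      using interchange[OF mor_sym[OF f] k, of "cups b p \<psi>" p 0] assms by simp
    finally show ?thesis using cups_slide[OF mor_sym[OF f] assms(4)] by simp
  qed
  show ?thesis using *[OF assms(1)] *[OF assms(2)] assms(3,4) by simp
qed

section \<open>Passing cups, caps and diagrams through crossings\<close>

lemma cup_scale: "cup p (\<lambda>h. s * \<psi> h) = (\<lambda>h. s * cup p \<psi> h)"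
  using lin_op_cup[of p] unfolding lin_op_def
  by (metis (no_types, lifting) ext add_cancel_left_right mult_zero_left)

lemma cup_lin: "cup p (\<lambda>h. s * \<psi> h + t * \<phi> h) = (\<lambda>h. s * cup p \<psi> h + t * cup p \<phi> h)"
  and cap_lin: "cap p (\<lambda>h. s * \<psi> h + t * \<phi> h) = (\<lambda>h. s * cap p \<psi> h + t * cap p \<phi> h)"
  using lin_op_cup[of p] lin_op_cap[of p] unfolding lin_op_def by blast+

lemma cap_crs: "cap q (crs b p \<psi>) =
    (\<lambda>h. crs_coeff b * cap q \<psi> h + crs_coeff (\<not> b) * cap q (cup p (cap p \<psi>)) h)"
  unfolding slice_act.simps(3) by (rule cap_lin)

text \<open>The four smoothings of two neighbouring crossings; the two mixed ones have coefficient
  \<open>A * A^(-1) = 1\<close>.\<close>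

lemma crs_crs_up: assumes "\<psi> \<in> space"
  shows "crs b (Suc p) (crs b p \<psi>) h =
    crs_coeff b * crs_coeff b * \<psi> h + cup p (cap p \<psi>) h + cup (Suc p) (cap (Suc p) \<psi>) h +
    crs_coeff (\<not> b) * crs_coeff (\<not> b) * cup (Suc p) (cap p \<psi>) h"
proof -
  have 1: "cap (Suc p) (crs b p \<psi>) = (\<lambda>h. crs_coeff b * cap (Suc p) \<psi> h + crs_coeff (\<not> b) * cap p \<psi> h)"
    by (simp only: cap_crs cap_Suc_cup cap_space)
  have "crs b (Suc p) (crs b p \<psi>) h = crs_coeff b * (crs_coeff b * \<psi> h + crs_coeff (\<not> b) * cup p (cap p \<psi>) h)
      + crs_coeff (\<not> b) * (crs_coeff b * cup (Suc p) (cap (Suc p) \<psi>) h + crs_coeff (\<not> b) * cup (Suc p) (cap p \<psi>) h)"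
    unfolding slice_act.simps(3)[of b "Suc p"] 1 cup_lin[of "Suc p" "crs_coeff b" "cap (Suc p) \<psi>"]
    unfolding slice_act.simps(3) ..
  also have "\<dots> = crs_coeff b * crs_coeff b * \<psi> h + (crs_coeff b * crs_coeff (\<not> b)) * cup p (cap p \<psi>) h
      + (crs_coeff b * crs_coeff (\<not> b)) * cup (Suc p) (cap (Suc p) \<psi>) h +
    crs_coeff (\<not> b) * crs_coeff (\<not> b) * cup (Suc p) (cap p \<psi>) h"
    by (simp only: distrib_left mult.assoc add.assoc mult.commute mult.left_commute add.commute add.left_commute)
  finally show ?thesis unfolding crs_coeff_mult mult_1 .
qed

lemma crs_crs_down: assumes "\<psi> \<in> space"
  shows "crs b p (crs b (Suc p) \<psi>) h =
    crs_coeff b * crs_coeff b * \<psi> h + cup (Suc p) (cap (Suc p) \<psi>) h + cup p (cap p \<psi>) h +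
    crs_coeff (\<not> b) * crs_coeff (\<not> b) * cup p (cap (Suc p) \<psi>) h"
proof -
  have 1: "cap p (crs b (Suc p) \<psi>) = (\<lambda>h. crs_coeff b * cap p \<psi> h + crs_coeff (\<not> b) * cap (Suc p) \<psi> h)"
    by (simp only: cap_crs cap_cup_Suc cap_space)
  have "crs b p (crs b (Suc p) \<psi>) h = crs_coeff b * (crs_coeff b * \<psi> h + crs_coeff (\<not> b) * cup (Suc p) (cap (Suc p) \<psi>) h)
      + crs_coeff (\<not> b) * (crs_coeff b * cup p (cap p \<psi>) h + crs_coeff (\<not> b) * cup p (cap (Suc p) \<psi>) h)"
    unfolding slice_act.simps(3)[of b p] 1 cup_lin[of p "crs_coeff b" "cap p \<psi>"]
    unfolding slice_act.simps(3) ..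
  also have "\<dots> = crs_coeff b * crs_coeff b * \<psi> h + (crs_coeff b * crs_coeff (\<not> b)) * cup (Suc p) (cap (Suc p) \<psi>) h
      + (crs_coeff b * crs_coeff (\<not> b)) * cup p (cap p \<psi>) h +
    crs_coeff (\<not> b) * crs_coeff (\<not> b) * cup p (cap (Suc p) \<psi>) h"
    by (simp only: distrib_left mult.assoc add.assoc mult.commute mult.left_commute add.commute add.left_commute)
  finally show ?thesis unfolding crs_coeff_mult mult_1 .
qed

text \<open>The coefficients \<open>A^2\<close>, \<open>A^(-2)\<close> and the loop value
  \<open>- qint 2\<close> of one and the same diagram cancel.\<close>

lemma crs_coeff_cancel: "crs_coeff b * crs_coeff b * x + u + - of_real (qint 2) * x
    + crs_coeff (\<not> b) * crs_coeff (\<not> b) * x = u"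
proof -
  have "crs_coeff b * crs_coeff b * x + u + - of_real (qint 2) * x + crs_coeff (\<not> b) * crs_coeff (\<not> b) * x
     = (crs_coeff b * crs_coeff b + crs_coeff (\<not> b) * crs_coeff (\<not> b)) * x - of_real (qint 2) * x + u"
    by (simp add: algebra_simps)
  then show ?thesis unfolding crs_coeff_loop[of b] by simp
qed

text \<open>Three of the four smoothings are multiples of \<open>cup (Suc p)\<close> and cancel,
  which leaves the cup on the other side of the strand. This is Reidemeister II with one end
  turned.\<close>

lemma crs_cup_right: assumes "\<psi> \<in> space" shows "crs b (Suc p) (crs b p (cup (Suc p) \<psi>)) = cup p \<psi>"
proof
  fix h
  show "crs b (Suc p) (crs b p (cup (Suc p) \<psi>)) h = cup p \<psi> h"
    using crs_coeff_cancel[of b "cup (Suc p) \<psi> h" "cup p \<psi> h"]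
    by (simp only: crs_crs_up[OF cup_space] cap_cup_Suc[OF assms] cap_cup_loop[OF assms]
        cup_scale[of "Suc p" "- of_real (qint 2)" \<psi>])
qed

lemma crs_cup_left: assumes "\<psi> \<in> space" shows "crs b p (crs b (Suc p) (cup p \<psi>)) = cup (Suc p) \<psi>"
proof
  fix h
  show "crs b p (crs b (Suc p) (cup p \<psi>)) h = cup (Suc p) \<psi> h"
    using crs_coeff_cancel[of b "cup p \<psi> h" "cup (Suc p) \<psi> h"]
    by (simp only: crs_crs_down[OF cup_space] cap_Suc_cup[OF assms] cap_cup_loop[OF assms]
        cup_scale[of p "- of_real (qint 2)" \<psi>])
qed

lemma crs_coeff_cancel': "crs_coeff b * (crs_coeff b * x + crs_coeff (\<not> b) * (- of_real (qint 2) * x))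
    + crs_coeff (\<not> b) * (crs_coeff b * u + crs_coeff (\<not> b) * x) = u"
proof -
  have "crs_coeff b * (crs_coeff b * x + crs_coeff (\<not> b) * (- of_real (qint 2) * x))
      + crs_coeff (\<not> b) * (crs_coeff b * u + crs_coeff (\<not> b) * x)
     = (crs_coeff b * crs_coeff b + crs_coeff (\<not> b) * crs_coeff (\<not> b)) * x
       - (crs_coeff b * crs_coeff (\<not> b)) * (of_real (qint 2) * x) + (crs_coeff b * crs_coeff (\<not> b)) * u"
    by (simp add: algebra_simps)
  then show ?thesis unfolding crs_coeff_loop[of b] crs_coeff_mult by simp
qed

lemma cap_crs_right: assumes "\<psi> \<in> space" shows "cap p (crs b (Suc p) (crs b p \<psi>)) = cap (Suc p) \<psi>"
proof
  fix h
  show "cap p (crs b (Suc p) (crs b p \<psi>)) h = cap (Suc p) \<psi> h"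
    using crs_coeff_cancel'[of b "cap p \<psi> h" "cap (Suc p) \<psi> h"]
    by (simp only: cap_crs[of p b "Suc p"] cap_cup_Suc cap_space lin_space cap_crs[of p b p] cap_crs[of "Suc p" b p]
      cap_cup_loop[OF cap_space] cap_Suc_cup cap_space lin_space)
qed

lemma cap_crs_left: assumes "\<psi> \<in> space" shows "cap (Suc p) (crs b p (crs b (Suc p) \<psi>)) = cap p \<psi>"
proof
  fix h
  show "cap (Suc p) (crs b p (crs b (Suc p) \<psi>)) h = cap p \<psi> h"
    using crs_coeff_cancel'[of b "cap (Suc p) \<psi> h" "cap p \<psi> h"]
    by (simp only: cap_crs[of "Suc p" b p] cap_Suc_cup cap_space lin_space cap_crs[of "Suc p" b "Suc p"] cap_crs[of p b "Suc p"]
      cap_cup_loop[OF cap_space] cap_cup_Suc cap_space lin_space)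
qed

text \<open>The two crossings at the legs of the cup disappear by \<open>crs_cup_right\<close>; all
  other crossings commute with it.\<close>

lemma row_cup: "t \<le> l \<Longrightarrow> \<psi> \<in> space \<Longrightarrow> row b (l + 2) p (cup (p + 1 + t) \<psi>) = cup (p + t) (row b l p \<psi>)"
proof (induction l rule: dec_induct)
  case base
  have "row b t p (cup (p + 1 + t) \<psi>) = cup (p + 1 + t) (row b t p \<psi>)"
    using interchange1[OF mor1_row mor1_cup base, of p t "p + 1 + t"] by simp
  then show ?case using crs_cup_right[of "row b t p \<psi>" b "p + t"] base by simp
next
  case (step n)
  have "crs b (p + n + 2) (cup (p + t) (row b n p \<psi>)) = cup (p + t) (crs b (p + n) (row b n p \<psi>))"
    using interchange1[OF mor1_cup mor1_crs, of "row b n p \<psi>" "p + t" "p + n"] step by simp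
  then show ?case using step by simp
qed

lemma row_cap: "t \<le> l \<Longrightarrow> \<psi> \<in> space \<Longrightarrow> row b l p (cap (p + 1 + t) \<psi>) = cap (p + t) (row b (l + 2) p \<psi>)"
proof (induction l rule: dec_induct)
  case base
  have "row b t p (cap (p + 1 + t) \<psi>) = cap (p + 1 + t) (row b t p \<psi>)"
    using interchange1[OF mor1_row mor1_cap base, of p t "p + 1 + t"] by simp
  then show ?case using cap_crs_right[of "row b t p \<psi>" "p + t" b] base by simp
next
  case (step n)
  have "cap (p + t) (crs b (p + n + 2) (row b (n + 2) p \<psi>)) = crs b (p + n) (cap (p + t) (row b (n + 2) p \<psi>))"
    using interchange1[OF mor1_cap mor1_crs, of "row b (n + 2) p \<psi>" "p + t" "p + n + 2"] step by simp
  then show ?case using step by simp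
qed

definition row_slides :: "bool \<Rightarrow> nat \<Rightarrow> nat \<Rightarrow> family \<Rightarrow> bool" where
  "row_slides b a c f \<longleftrightarrow> (\<forall>p. \<forall>\<psi>\<in>space. row b c p (f (p + 1) \<psi>) = f p (row b a p \<psi>))"

lemma mor_row_slides: "mor a c f f' \<Longrightarrow> row_slides b a c f"
proof (induction rule: mor.induct)
  case (fam_cup t a)
  then show ?case unfolding row_slides_def fam_simps using row_cup by blast
next
  case (fam_cap t a)
  then show ?case unfolding row_slides_def fam_simps using row_cap by blast
next
  case (fam_comp a c f f' d g g')
  then show ?case using mor_space[OF fam_comp.hyps(1)] by (simp add: row_slides_def fam_simps)
next
  case (fam_lin a c f f' g g' s t)
  show ?case unfolding row_slides_def fam_simps
  proof (intro allI ballI)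
    fix p \<psi> assume \<psi>: "\<psi> \<in> space"
    show "row b c p (\<lambda>h. s * f (p + 1) \<psi> h + t * g (p + 1) \<psi> h) =
        (\<lambda>h. s * f p (row b a p \<psi>) h + t * g p (row b a p \<psi>) h)"
      unfolding lin_onD[OF mor1_lin_on[OF mor1_row] mor_space[OF fam_lin.hyps(1) \<psi>, of "p + 1"]
        mor_space[OF fam_lin.hyps(2) \<psi>, of "p + 1"]]
      using fam_lin.IH \<psi> by (simp add: row_slides_def)
  qed
next
  case (fam_cong a c f f' g g')
  then show ?case by (simp add: row_slides_def fam_eqD)
next
  case (fam_id a)
  show ?case by (simp add: row_slides_def fam_simps)
qed

lemma row_slide:
  assumes "mor a c f f'" "\<psi> \<in> space"
  shows "row b c p (f (p + 1) \<psi>) = f p (row b a p \<psi>)"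
  using mor_row_slides[OF assms(1)] assms(2) by (simp add: row_slides_def)

text \<open>Naturality of the braiding in the right bundle: each of the \<open>m\<close> strands
  that cross it shifts the diagram by one position.\<close>

theorem cross_right_slide:
  assumes "mor a c f f'" "\<psi> \<in> space"
  shows "cross b m c P (f (P + m) \<psi>) = f P (cross b m a P \<psi>)"
  using assms(2)
proof (induction m arbitrary: \<psi>)
  case (Suc m)
  then show ?case using row_slide[OF assms(1) Suc.prems, of b "P + m"] by simp
qed simp

lemma row_row_cup: "\<psi> \<in> space \<Longrightarrow> row b l p (row b l (Suc p) (cup p \<psi>)) = cup (p + l) \<psi>"
proof (induction l)
  case (Suc l)
  have "row b l p (crs b (Suc p + l) (row b l (Suc p) (cup p \<psi>)))
     = crs b (Suc p + l) (row b l p (row b l (Suc p) (cup p \<psi>)))"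
    using interchange1[OF mor1_row mor1_crs, of "row b l (Suc p) (cup p \<psi>)" p l "Suc p + l"] by simp
  then show ?case using Suc crs_cup_left[of \<psi> b "p + l"] by simp
qed simp

lemma cap_row_row: "\<psi> \<in> space \<Longrightarrow> cap (p + l) (row b l p (row b l (Suc p) \<psi>)) = cap p \<psi>"
proof (induction l)
  case (Suc l)
  have "row b l p (crs b (Suc p + l) (row b l (Suc p) \<psi>))
     = crs b (Suc p + l) (row b l p (row b l (Suc p) \<psi>))"
    using interchange1[OF mor1_row mor1_crs, of "row b l (Suc p) \<psi>" p l "Suc p + l"] Suc by simp
  then show ?case using Suc cap_crs_left[of "row b l p (row b l (Suc p) \<psi>)" "p + l" b] by simp
qed simp

lemma cross_cup: "t \<le> m \<Longrightarrow> \<psi> \<in> space \<Longrightarrow>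
  cross b (m + 2) l P (cup (P + t) \<psi>) = cup (P + l + t) (cross b m l P \<psi>)"
proof (induction m arbitrary: \<psi> rule: dec_induct)
  case base
  have "cross b t l P (cup (P + t + l) \<psi>) = cup (P + t + l) (cross b t l P \<psi>)"
    using interchange1[OF mor1_cross mor1_cup base, of P t l "P + t + l"] by (simp add: add.assoc)
  then show ?case using row_row_cup[of \<psi> b l "P + t"] base by (simp add: ac_simps)
next
  case (step n)
  have "row b l (P + n + 2) (cup (P + t) \<psi>) = cup (P + t) (row b l (P + n) \<psi>)"
    using interchange1[OF mor1_cup mor1_row, of \<psi> "P + t" "P + n"] step by simp
  then show ?case using step.IH[of "row b l (P + n) \<psi>"] step.prems by simp
qed

lemma cross_cap: "t \<le> m \<Longrightarrow> \<psi> \<in> space \<Longrightarrow>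
  cross b m l P (cap (P + t) \<psi>) = cap (P + l + t) (cross b (m + 2) l P \<psi>)"
proof (induction m arbitrary: \<psi> rule: dec_induct)
  case base
  let ?\<phi> = "row b l (P + t) (row b l (Suc (P + t)) \<psi>)"
  have "cross b t l P (cap (P + t + l) ?\<phi>) = cap (P + t + l) (cross b t l P ?\<phi>)"
    using interchange1[OF mor1_cross mor1_cap, of ?\<phi> P t l "P + t + l"] base by (simp add: add.assoc)
  then show ?case using cap_row_row[of \<psi> "P + t" l b] base by (simp add: ac_simps)
next
  case (step n)
  have "row b l (P + n) (cap (P + t) \<psi>) = cap (P + t) (row b l (P + n + 2) \<psi>)"
    using interchange1[OF mor1_cap mor1_row, of \<psi> "P + t" "P + n + 2"] step by simp
  then show ?case using step.IH[of "row b l (P + n + 2) \<psi>"] step.prems by simp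
qed

definition cross_slides :: "bool \<Rightarrow> nat \<Rightarrow> nat \<Rightarrow> nat \<Rightarrow> family \<Rightarrow> bool" where
  "cross_slides b l a c f \<longleftrightarrow>
     (\<forall>P. \<forall>\<psi>\<in>space. cross b c l P (f P \<psi>) = f (P + l) (cross b a l P \<psi>))"

lemma mor_cross_slides: "mor a c f f' \<Longrightarrow> cross_slides b l a c f"
proof (induction rule: mor.induct)
  case (fam_cup t a)
  then show ?case unfolding cross_slides_def fam_simps using cross_cup by blast
next
  case (fam_cap t a)
  then show ?case unfolding cross_slides_def fam_simps using cross_cap by blast
next
  case (fam_comp a c f f' d g g')
  then show ?case using mor_space[OF fam_comp.hyps(1)] by (simp add: cross_slides_def fam_simps)
next
  case (fam_lin a c f f' g g' s t)
  show ?case unfolding cross_slides_def fam_simps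
  proof (intro allI ballI)
    fix P \<psi> assume \<psi>: "\<psi> \<in> space"
    show "cross b c l P (\<lambda>h. s * f P \<psi> h + t * g P \<psi> h) =
        (\<lambda>h. s * f (P + l) (cross b a l P \<psi>) h + t * g (P + l) (cross b a l P \<psi>) h)"
      unfolding lin_onD[OF mor1_lin_on[OF mor1_cross] mor_space[OF fam_lin.hyps(1) \<psi>, of P]
        mor_space[OF fam_lin.hyps(2) \<psi>, of P]]
      using fam_lin.IH \<psi> by (simp add: cross_slides_def)
  qed
next
  case (fam_cong a c f f' g g')
  then show ?case by (simp add: cross_slides_def fam_eqD)
next
  case (fam_id a)
  show ?case by (simp add: cross_slides_def fam_simps)
qed

text \<open>Naturality in the left bundle. Now the turning strands themselves travel, and
  \<open>row_row_cup\<close> and \<open>cap_row_row\<close> pull a turn across all \<open>l\<close>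
  strands.\<close>

theorem cross_left_slide:
  assumes "mor a c f f'" "\<psi> \<in> space"
  shows "cross b c l P (f P \<psi>) = f (P + l) (cross b a l P \<psi>)"
  using mor_cross_slides[OF assms(1)] assms(2) by (simp add: cross_slides_def)


section \<open>Jones-Wenzl idempotents\<close>

lemma lin_on_scale: "lin_on T \<Longrightarrow> \<psi> \<in> space \<Longrightarrow> T (\<lambda>h. s * \<psi> h) = (\<lambda>h. s * T \<psi> h)"
  using lin_onD[of T \<psi> \<psi> s 0] by simp

lemma lin_on_zero: "lin_on T \<Longrightarrow> T (\<lambda>h. 0) = (\<lambda>h. 0)"
  using lin_on_scale[of T "\<lambda>h. 0" 0] by (simp add: space_def)

lemma zero_space [simp]: "(\<lambda>h. 0) \<in> space"
  by (auto simp: space_def)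

definition E :: family where "E = fam_comp cup cap"

lemma mor_E: "mor 2 2 E E"
  using mor.fam_comp[OF mor.fam_cap[of 0 0] mor.fam_cup[of 0 0]] by (simp add: E_def fam_at_simps numeral_2_eq_2)

lemma fam_comp_assoc: "fam_comp (fam_comp f g) k = fam_comp f (fam_comp g k)"
  by (simp add: fam_unfold)

definition qratio :: "nat \<Rightarrow> complex" where
  "qratio n = of_real (qint (Suc n) / qint (Suc (Suc n)))"

text \<open>Wenzl's recursion; the correction has a plus sign because a loop is worth
  \<open>- qint 2\<close>. Only the quantum integers \<open>qint k\<close> with
  \<open>2 <= k <= m\<close> occur as denominators in \<open>jw m\<close>, so it is meaningful for
  \<open>m < r\<close>.\<close>

fun jw :: "nat \<Rightarrow> family" where
  "jw 0 = fam_id"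
| "jw (Suc 0) = fam_id"
| "jw (Suc (Suc n)) =
     fam_lin 1 (jw (Suc n)) (qratio n) (fam_comp (jw (Suc n)) (fam_comp (fam_at E n) (jw (Suc n))))"

text \<open>The mirror image of \<open>jw\<close>, growing to the left; the two agree by \<open>jw_left_eq\<close> below.\<close>

fun jw_left :: "nat \<Rightarrow> family" where
  "jw_left 0 = fam_id"
| "jw_left (Suc 0) = fam_id"
| "jw_left (Suc (Suc n)) =
     fam_lin 1 (fam_at (jw_left (Suc n)) 1) (qratio n)
       (fam_comp (fam_at (jw_left (Suc n)) 1) (fam_comp E (fam_at (jw_left (Suc n)) 1)))"

lemma mor_jw_left: "mor n n (jw n) (jw_left n)"
proof (induction n rule: jw.induct)
  case (3 n)
  let ?f = "jw (Suc n)" and ?g = "fam_at (jw_left (Suc n)) 1"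
  have f: "mor (Suc (Suc n)) (Suc (Suc n)) ?f ?g"
    using mor_embed[OF "3.IH"(1), of 0 1] by (simp add: fam_at_simps)
  have "mor (Suc (Suc n)) (Suc (Suc n)) (fam_at E n) E"
    using mor_embed[OF mor_E, of n 0] by (simp add: fam_at_simps)
  from mor.fam_comp[OF mor.fam_comp[OF f this] f]
  show ?case unfolding jw.simps jw_left.simps fam_comp_assoc by (rule mor.fam_lin[OF f])
qed (simp_all add: mor.fam_id)

lemma jw_space [simp]: "\<psi> \<in> space \<Longrightarrow> jw n p \<psi> \<in> space"
  and jw_left_space [simp]: "\<psi> \<in> space \<Longrightarrow> jw_left n p \<psi> \<in> space"
  using mor_space[OF mor_jw_left] mor_space[OF mor_sym[OF mor_jw_left]] by auto

lemma mor1_jw: "mor1 n n (jw n)"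
  by (rule mor1I[OF mor_jw_left])

lemma jw_SS: "jw (Suc (Suc n)) p \<psi> =
    (\<lambda>h. jw (Suc n) p \<psi> h + qratio n * jw (Suc n) p (cup (p + n) (cap (p + n) (jw (Suc n) p \<psi>))) h)"
  by (simp add: fam_simps E_def)

lemma jw_left_SS: "jw_left (Suc (Suc n)) p \<psi> =
    (\<lambda>h. jw_left (Suc n) (Suc p) \<psi> h +
       qratio n * jw_left (Suc n) (Suc p) (cup p (cap p (jw_left (Suc n) (Suc p) \<psi>))) h)"
  by (simp add: fam_simps E_def)

lemma jw_01 [simp]: "jw 0 p \<psi> = \<psi>" "jw (Suc 0) p \<psi> = \<psi>"
   "jw_left 0 p \<psi> = \<psi>" "jw_left (Suc 0) p \<psi> = \<psi>"
  by (simp_all add: fam_simps)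

declare jw.simps [simp del] jw_left.simps [simp del]

lemma lin_on_cup: "lin_on (cup p)" and lin_on_cap: "lin_on (cap p)"
  and lin_on_jw: "lin_on (jw n p)" and lin_on_jw_left: "lin_on (jw_left n p)"
  by (auto intro: lin_op_on lin_op_cup lin_op_cap mor_lin_on[OF mor_jw_left] mor_lin_on[OF mor_sym[OF mor_jw_left]])

lemmas zeros [simp] = lin_on_zero[OF lin_on_cup] lin_on_zero[OF lin_on_cap] lin_on_zero[OF lin_on_jw]
  lin_on_zero[OF lin_on_jw_left]

text \<open>Each correction term contains a cap applied to a smaller idempotent that already acts
  trivially, so it vanishes.\<close>

lemma jw_fix:
  assumes "\<And>i. i + 2 \<le> m \<Longrightarrow> cap (p + i) \<psi> = (\<lambda>h. 0)"
  shows "jw m p \<psi> = \<psi>"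
  using assms
proof (induction m rule: jw.induct)
  case (3 n)
  then have "jw (Suc n) p \<psi> = \<psi>" by simp
  then show ?case using "3.prems"[of n] by (simp add: jw_SS)
qed simp_all

lemma jw_left_fix:
  assumes "\<And>i. i + 2 \<le> m \<Longrightarrow> cap (p + i) \<psi> = (\<lambda>h. 0)"
  shows "jw_left m p \<psi> = \<psi>"
  using assms
proof (induction m arbitrary: p rule: jw.induct)
  case (3 n)
  have "jw_left (Suc n) (Suc p) \<psi> = \<psi>"
  proof (rule "3.IH"(1))
    fix i assume "i + 2 \<le> Suc n"
    then show "cap (Suc p + i) \<psi> = (\<lambda>h. 0)" using "3.prems"[of "Suc i"] by simp
  qed
  then show ?case using "3.prems"[of 0] by (simp add: jw_left_SS)
qed simp_all

lemma qratio_qint: "qint (Suc (Suc n)) \<noteq> 0 \<Longrightarrow>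
  - of_real (qint 2) + qratio n = - of_real (qint (Suc (Suc (Suc n))) / qint (Suc (Suc n)))"
  unfolding qratio_def by (simp add: qint_rec[of "Suc n"] field_simps flip: of_real_add of_real_mult of_real_minus of_real_diff of_real_divide)

text \<open>The two properties need each other: that caps kill \<open>jw (n + 2)\<close> uses the
  partial trace of \<open>jw (n + 1)\<close>, and the partial trace of \<open>jw (n + 2)\<close>
  uses that \<open>jw (n + 1)\<close> is idempotent, hence that caps kill it.\<close>

lemma jw_aux:
  assumes "Suc n < r"
  shows "(\<forall>i p. \<forall>\<psi>\<in>space. i + 2 \<le> Suc n \<longrightarrow> cap (p + i) (jw (Suc n) p \<psi>) = (\<lambda>h. 0)) \<and>
    (\<forall>p. \<forall>\<psi>\<in>space. cap (p + n) (jw (Suc n) p (cup (p + n) \<psi>)) =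
       (\<lambda>h. - of_real (qint (Suc (Suc n)) / qint (Suc n)) * jw n p \<psi> h))"
  using assms
proof (induction n)
  case 0
  then show ?case by (simp add: cap_cup_loop numeral_2_eq_2)
next
  case (Suc n)
  then have K: "cap (p + i) (jw (Suc n) p \<psi>) = (\<lambda>h. 0)" if "i + 2 \<le> Suc n" "\<psi> \<in> space" for i p \<psi>
    using that by simp
  have T: "cap (p + n) (jw (Suc n) p (cup (p + n) \<psi>)) =
       (\<lambda>h. - of_real (qint (Suc (Suc n)) / qint (Suc n)) * jw n p \<psi> h)" if "\<psi> \<in> space" for p \<psi>
    using that Suc by simp
  have q: "qint (Suc n) > 0" "qint (Suc (Suc n)) > 0" using qint_pos Suc.prems by auto
  \<comment> \<open>The coefficient of the recursion is chosen for this: against the partial trace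
    it gives -1, so the topmost cap kills the sum.\<close>
  have q': "qratio n * - of_real (qint (Suc (Suc n)) / qint (Suc n)) = -1"
    unfolding qratio_def using q by (simp flip: of_real_mult of_real_minus)
  have "cap (p + i) (jw (Suc (Suc n)) p \<psi>) = (\<lambda>h. 0)" if i: "i + 2 \<le> Suc (Suc n)" and \<psi>: "\<psi> \<in> space" for i p \<psi>
  proof -
    let ?X = "jw (Suc n) p \<psi>"
    let ?Y = "cup (p + n) (cap (p + n) ?X)"
    have "cap (p + i) (jw (Suc (Suc n)) p \<psi>) =
       (\<lambda>h. cap (p + i) ?X h + qratio n * cap (p + i) (jw (Suc n) p ?Y) h)"
      unfolding jw_SS using lin_onD[OF lin_on_cap, of ?X "jw (Suc n) p ?Y" "p + i" 1 "qratio n"] \<psi> by simp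
    also have "\<dots> = (\<lambda>h. 0)"
    proof (cases "i + 2 \<le> Suc n")
      case True
      then show ?thesis using K \<psi> by simp
    next
      case False
      with i have [simp]: "i = n" by simp
      \<comment> \<open>The partial trace leaves a factor \<open>jw n\<close>. It commutes with the
        cap on its right and is absorbed by \<open>jw (Suc n)\<close>.\<close>
      have "jw n p (cap (p + n) ?X) = cap (p + n) (jw n p ?X)"
        using interchange1[OF mor1_jw mor1_cap, of ?X p n "p + n"] \<psi> by simp
      also have "jw n p ?X = ?X"
        by (rule jw_fix) (use K \<psi> in simp)
      finally have "jw n p (cap (p + n) ?X) = cap (p + n) ?X" .
      then have "cap (p + i) (jw (Suc n) p ?Y) = (\<lambda>h. - of_real (qint (Suc (Suc n)) / qint (Suc n)) * cap (p + n) ?X h)"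
        using T[of "cap (p + n) ?X" p] by simp
      then show ?thesis using q' by (simp only: mult.assoc[symmetric]) simp
    qed
    finally show ?thesis .
  qed
  moreover have "cap (p + Suc n) (jw (Suc (Suc n)) p (cup (p + Suc n) \<psi>)) =
       (\<lambda>h. - of_real (qint (Suc (Suc (Suc n))) / qint (Suc (Suc n))) * jw (Suc n) p \<psi> h)"
    if \<psi>: "\<psi> \<in> space" for p \<psi>
  proof -
    let ?Y = "jw (Suc n) p \<psi>"
    have "jw (Suc n) p (cup (p + Suc n) \<psi>) = cup (p + Suc n) ?Y"
      using interchange1[OF mor1_jw mor1_cup \<psi>, of p "Suc n" "p + Suc n"] by simp
    then have 1: "jw (Suc (Suc n)) p (cup (p + Suc n) \<psi>) =
        (\<lambda>h. cup (p + Suc n) ?Y h + qratio n * jw (Suc n) p (cup (p + n) ?Y) h)"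
      using cap_cup_Suc[of ?Y "p + n"] \<psi> by (simp add: jw_SS)
    have "cap (p + Suc n) (jw (Suc n) p (cup (p + n) ?Y)) = jw (Suc n) p (cap (p + Suc n) (cup (p + n) ?Y))"
      using interchange1[OF mor1_jw mor1_cap, of "cup (p + n) ?Y" p "Suc n" "p + Suc n"] by simp
    also have "\<dots> = jw (Suc n) p ?Y"
      using cap_Suc_cup[of ?Y "p + n"] \<psi> by simp
    also have "\<dots> = ?Y"
      by (rule jw_fix) (use K \<psi> in simp)
    finally have 2: "cap (p + Suc n) (jw (Suc n) p (cup (p + n) ?Y)) = ?Y" .
    have "cap (p + Suc n) (jw (Suc (Suc n)) p (cup (p + Suc n) \<psi>)) =
        (\<lambda>h. cap (p + Suc n) (cup (p + Suc n) ?Y) h + qratio n * ?Y h)"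
      unfolding 1 using lin_onD[OF lin_on_cap, of "cup (p + Suc n) ?Y" "jw (Suc n) p (cup (p + n) ?Y)" "p + Suc n" 1 "qratio n"] 2 by simp
    also have "\<dots> = (\<lambda>h. (- of_real (qint 2) + qratio n) * ?Y h)"
      using cap_cup_loop[of ?Y "p + Suc n"] \<psi> by (simp add: algebra_simps)
    finally show ?thesis using qratio_qint[of n] q by simp
  qed
  ultimately show ?case by blast
qed

lemma cap_jw: "n < r \<Longrightarrow> i + 2 \<le> n \<Longrightarrow> \<psi> \<in> space \<Longrightarrow> cap (p + i) (jw n p \<psi>) = (\<lambda>h. 0)"
  using jw_aux[of "n - 1"] by (cases n) auto

lemma jw_partial_trace: "Suc n < r \<Longrightarrow> \<psi> \<in> space \<Longrightarrow>
   cap (p + n) (jw (Suc n) p (cup (p + n) \<psi>)) =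
       (\<lambda>h. - of_real (qint (Suc (Suc n)) / qint (Suc n)) * jw n p \<psi> h)"
  using jw_aux by blast

lemma jw_absorb_left: "n < r \<Longrightarrow> m \<le> n \<Longrightarrow> \<psi> \<in> space \<Longrightarrow> jw m p (jw n p \<psi>) = jw n p \<psi>"
  by (rule jw_fix) (use cap_jw in simp)

text \<open>\<open>cap_jw\<close> turned by half a turn: a cap above \<open>jw\<close> becomes a cup
  below \<open>jw_left\<close>.\<close>

lemma jw_left_cup:
  assumes "n < r" "i + 2 \<le> n" "\<psi> \<in> space"
  shows "jw_left n p (cup (p + i) \<psi>) = (\<lambda>h. 0)"
proof -
  \<comment> \<open>A cap at \<open>t\<close> rotates to a cup at \<open>n - 2 - t\<close>, which
    has to be \<open>i\<close>.\<close>
  define t where "t = n - 2 - i"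
  have t: "t \<le> n - 2" "n - 2 - t = i" "n = n - 2 + 2" using assms by (auto simp: t_def)
  have "mor n (n - 2) (fam_at cap t) (fam_at cup i)"
    using mor.fam_cap[OF t(1)] t(2,3) by simp
  from mor.fam_comp[OF mor_jw_left this]
  have m: "mor n (n - 2) (fam_comp (fam_at cap t) (jw n)) (fam_comp (jw_left n) (fam_at cup i))" .
  \<comment> \<open>\<open>mor\<close> has no rule for the zero family; \<open>fam_lin\<close> with
    both coefficients 0 provides it together with its rotation.\<close>
  have "fam_comp (jw_left n) (fam_at cup i) p \<psi> =
      fam_lin 0 (fam_comp (jw_left n) (fam_at cup i)) 0 (fam_comp (jw_left n) (fam_at cup i)) p \<psi>"
  proof (rule mor_dual_unique[OF m mor.fam_lin[OF m m] _ assms(3)])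
    fix p \<psi> assume "\<psi> \<in> space"
    then show "fam_comp (fam_at cap t) (jw n) p \<psi> =
      fam_lin 0 (fam_comp (fam_at cap t) (jw n)) 0 (fam_comp (fam_at cap t) (jw n)) p \<psi>"
      using cap_jw[of n t \<psi> p] assms t by (simp add: fam_simps)
  qed
  then show ?thesis by (simp add: fam_simps)
qed

text \<open>In a correction term the outer smaller idempotent is absorbed by induction, and then
  \<open>T\<close> meets a cup.\<close>

lemma jw_absorb_right_aux:
  assumes "lin_on T" "\<And>i \<psi>. i + 2 \<le> n \<Longrightarrow> \<psi> \<in> space \<Longrightarrow> T (cup (p + i) \<psi>) = (\<lambda>h. 0)"
    and "m \<le> n" "\<psi> \<in> space"
  shows "T (jw m p \<psi>) = T \<psi>"
  using assms(3,4)
proof (induction m arbitrary: \<psi> rule: jw.induct)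
  case (3 k)
  let ?X = "cup (p + k) (cap (p + k) (jw (Suc k) p \<psi>))"
  have "T (jw (Suc (Suc k)) p \<psi>) = (\<lambda>h. T (jw (Suc k) p \<psi>) h + qratio k * T (jw (Suc k) p ?X) h)"
    unfolding jw_SS using lin_onD[OF assms(1), of "jw (Suc k) p \<psi>" "jw (Suc k) p ?X" 1 "qratio k"] 3 by simp
  also have "T (jw (Suc k) p ?X) = T ?X" using 3 by simp
  also have "\<dots> = (\<lambda>h. 0)" using 3 by (intro assms(2)) auto
  also have "T (jw (Suc k) p \<psi>) = T \<psi>" using 3 by simp
  finally show ?case by simp
qed simp_all

text \<open>The usual uniqueness argument: the product of the two idempotents equals one of them
  since caps are killed, and the other since cups are killed. Hence \<open>jw n\<close> is invariant
  under half a turn.\<close>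

lemma jw_left_eq:
  assumes "n < r" "\<psi> \<in> space"
  shows "jw_left n p \<psi> = jw n p \<psi>"
proof -
  have "jw_left n p (jw n p \<psi>) = jw n p \<psi>"
    by (rule jw_left_fix) (use cap_jw assms in simp)
  moreover have "jw_left n p (jw n p \<psi>) = jw_left n p \<psi>"
    by (rule jw_absorb_right_aux[OF lin_on_jw_left, of n]) (use jw_left_cup assms in auto)
  ultimately show ?thesis by simp
qed

lemma mor_jw: "n < r \<Longrightarrow> mor n n (jw n) (jw n)"
  by (rule mor.fam_cong[OF mor_jw_left]) (simp_all add: fam_eq_def jw_left_eq)

lemma jw_cup: "n < r \<Longrightarrow> i + 2 \<le> n \<Longrightarrow> \<psi> \<in> space \<Longrightarrow> jw n p (cup (p + i) \<psi>) = (\<lambda>h. 0)"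
  using jw_left_cup jw_left_eq by simp

lemma jw_absorb_right: "n < r \<Longrightarrow> m \<le> n \<Longrightarrow> \<psi> \<in> space \<Longrightarrow> jw n p (jw m p \<psi>) = jw n p \<psi>"
  by (rule jw_absorb_right_aux[OF lin_on_jw, of n]) (use jw_cup in auto)

text \<open>Iterating the partial trace makes the ratios of quantum integers telescope.\<close>

lemma jw_trace:
  assumes "n < r" "\<psi> \<in> space"
  shows "caps n P (jw n P (cups n P \<psi>)) = (\<lambda>h. (-1) ^ n * of_real (qint (Suc n)) * \<psi> h)"
  using assms(1)
proof (induction n)
  case (Suc n)
  have q: "qint (Suc n) > 0" using Suc.prems by (intro qint_pos) auto
  let ?c = "- of_real (qint (Suc (Suc n)) / qint (Suc n)) :: complex"
  have "caps (Suc n) P (jw (Suc n) P (cups (Suc n) P \<psi>)) = caps n P (\<lambda>h. ?c * jw n P (cups n P \<psi>) h)"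
    using jw_partial_trace[OF Suc.prems, of "cups n P \<psi>" P] assms(2) by simp
  also have "\<dots> = (\<lambda>h. ?c * caps n P (jw n P (cups n P \<psi>)) h)"
    by (rule lin_on_scale[OF lin_on_caps]) (use assms(2) in simp)
  also have "\<dots> = (\<lambda>h. (-1) ^ Suc n * of_real (qint (Suc (Suc n))) * \<psi> h)"
    using Suc q by (auto simp: field_simps)
  finally show ?case .
qed simp

text \<open>The trivalent vertex from colour \<open>n\<close> to colour \<open>n + 1\<close> next to
  one more strand; \<open>fuse_down\<close> is the vertex in the other direction.\<close>

definition fuse_up :: "nat \<Rightarrow> family" where
  "fuse_up n = fam_comp (jw (Suc n)) (fam_at cup n)"

text \<open>The factor is the inverse of the coefficient in \<open>jw_partial_trace\<close>, so that
  \<open>fuse_down\<close> after \<open>fuse_up\<close> is \<open>jw n\<close>. Scaling is written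
  as \<open>fam_lin\<close> with a zero summand to stay within \<open>mor\<close>.\<close>

definition fuse_down :: "nat \<Rightarrow> family" where
  "fuse_down n = fam_lin (- qratio n) (fam_comp (fam_at cap n) (jw (Suc n))) 0 (fam_comp (fam_at cap n) (jw (Suc n)))"

lemma fuse_down_apply: "fuse_down n p \<psi> = (\<lambda>h. - qratio n * cap (p + n) (jw (Suc n) p \<psi>) h)"
  by (simp add: fuse_down_def fam_simps)

lemma fuse_up_apply: "fuse_up n p \<psi> = jw (Suc n) p (cup (p + n) \<psi>)"
  by (simp add: fuse_up_def fam_simps)

lemma mor1_fuse_up: "mor1 n (n + 2) (fuse_up n)"
proof -
  have "mor1 (n + 2) (n + 2) (jw (Suc n))" using mor1_embed[OF mor1_jw[of "Suc n"], of 0 1] by (simp add: fam_at_simps)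
  from mor1_comp[OF mor.fam_cup[of n n, THEN mor1I] this] show ?thesis by (simp add: fuse_up_def)
qed

lemma mor1_fuse_down: "mor1 (n + 2) n (fuse_down n)"
proof -
  have "mor1 (n + 2) (n + 2) (jw (Suc n))" using mor1_embed[OF mor1_jw[of "Suc n"], of 0 1] by (simp add: fam_at_simps)
  from mor1_comp[OF this mor.fam_cap[of n n, THEN mor1I]]
  show ?thesis by (auto simp: fuse_down_def mor1_def intro: mor.fam_lin)
qed

lemma fuse_down_up:
  assumes "Suc (Suc n) < r" "\<psi> \<in> space"
  shows "fuse_down n p (fuse_up n p \<psi>) = jw n p \<psi>"
proof -
  have q: "qint (Suc n) > 0" "qint (Suc (Suc n)) > 0" using qint_pos assms by auto
  then have "qratio n * of_real (qint (Suc (Suc n)) / qint (Suc n)) = 1"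
    unfolding qratio_def by (simp flip: of_real_mult)
  then show ?thesis
    unfolding fuse_down_apply fuse_up_apply using assms jw_partial_trace[of n \<psi> p]
    by (simp add: jw_absorb_left mult.assoc[symmetric])
qed

lemma jw_fuse_down:
  assumes "Suc (Suc n) < r" "\<psi> \<in> space"
  shows "jw n p (fuse_down n p \<psi>) = fuse_down n p \<psi>"
proof -
  have "jw n p (cap (p + n) (jw (Suc n) p \<psi>)) = cap (p + n) (jw (Suc n) p \<psi>)"
    using interchange1[OF mor1_jw mor1_cap, of "jw (Suc n) p \<psi>" p n "p + n"] assms
    by (simp add: jw_absorb_left)
  then show ?thesis unfolding fuse_down_apply by (subst lin_on_scale[OF lin_on_jw]) simp_all
qed

text \<open>Wenzl's recursion read backwards: up to sign its correction term is the idempotent that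
  factors through colour \<open>n\<close>.\<close>

lemma fusion:
  assumes "Suc (Suc n) < r" "\<psi> \<in> space"
  shows "jw (Suc n) p \<psi> = (\<lambda>h. jw (Suc (Suc n)) p \<psi> h + fuse_up n p (fuse_down n p \<psi>) h)"
proof -
  have "fuse_up n p (fuse_down n p \<psi>) = (\<lambda>h. - qratio n * fuse_up n p (cap (p + n) (jw (Suc n) p \<psi>)) h)"
    unfolding fuse_down_apply by (subst lin_on_scale[OF mor1_lin_on[OF mor1_fuse_up]]) simp_all
  then show ?thesis by (simp add: jw_SS fuse_up_apply)
qed

end

section \<open>Closed diagrams act as their bracket\<close>

fun crossless :: "slice \<Rightarrow> bool" where
  "crossless (Crossing b p) \<longleftrightarrow> False"
| "crossless _ \<longleftrightarrow> True"

definition final_width :: "nat \<Rightarrow> slice list \<Rightarrow> nat" where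
  "final_width w D = fold (\<lambda>s w. width_above w s) D w"

fun admissible_word :: "nat \<Rightarrow> slice list \<Rightarrow> bool" where
  "admissible_word w [] \<longleftrightarrow> True"
| "admissible_word w (s # D) \<longleftrightarrow> admissible w s \<and> admissible_word (width_above w s) D"

lemma final_width_simps [simp]: "final_width w [] = w" "final_width w (s # D) = final_width (width_above w s) D"
  "final_width w (C @ D) = final_width (final_width w C) D"
  by (simp_all add: final_width_def)

lemma admissible_word_append [simp]:
  "admissible_word w (C @ D) \<longleftrightarrow> admissible_word w C \<and> admissible_word (final_width w C) D"
  by (induction C arbitrary: w) auto

lemma closes_from_iff: "closes_from w D \<longleftrightarrow> admissible_word w D \<and> final_width w D = 0"
  by (induction D arbitrary: w) auto

text \<open>Renumbers the strands when the pair \<open>p\<close>, \<open>p + 1\<close> disappears;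
  \<open>skip_pair\<close> is its inverse away from that pair.\<close>

definition drop_pair :: "nat \<Rightarrow> nat \<Rightarrow> nat" where
  "drop_pair p a = (if a < p then a else a - 2)"

definition skip_pair :: "nat \<Rightarrow> nat \<Rightarrow> nat" where
  "skip_pair p a = (if a < p then a else a + 2)"

text \<open>The state of a partial crossingless diagram: which of its top strands are connected below,
  and its number of components, open ones included.\<close>

fun comp_step :: "slice \<Rightarrow> (nat \<Rightarrow> nat \<Rightarrow> bool) \<times> int \<Rightarrow> (nat \<Rightarrow> nat \<Rightarrow> bool) \<times> int" where
  "comp_step (Cup p) (R, N) =
     (\<lambda>a b. if a = p \<or> a = Suc p then b = p \<or> b = Suc p
        else b \<noteq> p \<and> b \<noteq> Suc p \<and> R (drop_pair p a) (drop_pair p b), N + 1)"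
| "comp_step (Cap p) (R, N) =
     (\<lambda>a b. R (skip_pair p a) (skip_pair p b) \<or> R (skip_pair p a) p \<and> R (Suc p) (skip_pair p b) \<or>
        R (skip_pair p a) (Suc p) \<and> R p (skip_pair p b), if R p (Suc p) then N else N - 1)"
| "comp_step (Crossing b p) x = x"

definition comp_state :: "slice list \<Rightarrow> (nat \<Rightarrow> nat \<Rightarrow> bool) \<times> int \<Rightarrow> (nat \<Rightarrow> nat \<Rightarrow> bool) \<times> int" where
  "comp_state = fold comp_step"

lemma comp_state_simps [simp]: "comp_state [] x = x" "comp_state (s # D) x = comp_state D (comp_step s x)"
  "comp_state (C @ D) x = comp_state D (comp_state C x)"
  by (simp_all add: comp_state_def)

lemma equivp_facts: "equivp R \<Longrightarrow> R a a" "equivp R \<Longrightarrow> R a b \<longleftrightarrow> R b a"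
  "equivp R \<Longrightarrow> R a b \<Longrightarrow> R b c \<Longrightarrow> R a c"
  by (auto elim: equivpE intro: reflpD sympD transpD)

lemma equivp_comp_step: "equivp (fst x) \<Longrightarrow> equivp (fst (comp_step s x))"
proof (induction s x rule: comp_step.induct)
  case (1 p R N)
  then have R: "equivp R" by simp
  note f = equivp_facts[OF R]
  show ?case
    unfolding comp_step.simps fst_conv
  proof (intro equivpI reflpI sympI transpI, goal_cases)
    case (1 x) then show ?case using f(1) by simp
  next
    case (2 x y) then show ?case using f(2) by meson
  next
    case (3 x y z) then show ?case using f(3)[of "drop_pair p x" "drop_pair p y" "drop_pair p z"] by (simp split: if_splits)
  qed
next
  case (2 p R N)
  then have R: "equivp R" by simp
  note f = equivp_facts[OF R]
  show ?case
    unfolding comp_step.simps fst_conv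
  proof (intro equivpI reflpI sympI transpI, goal_cases)
    case (1 x) then show ?case using f(1) by blast
  next
    case (2 x y) then show ?case using f(2) by blast
  next
    case (3 x y z) then show ?case using f(2,3) by meson
  qed
qed simp

lemma equivp_comp_state: "equivp (fst x) \<Longrightarrow> equivp (fst (comp_state D x))"
  by (induction D arbitrary: x) (auto simp: equivp_comp_step)

section \<open>Component counts under the planar moves\<close>

lemma comp_loop: "equivp R \<Longrightarrow> comp_step (Cap p) (comp_step (Cup p) (R, N)) = (R, N + 1)"
proof -
  have "skip_pair p a \<noteq> p" "skip_pair p a \<noteq> Suc p" "drop_pair p (skip_pair p a) = a" for a
    by (auto simp: skip_pair_def drop_pair_def)
  then show ?thesis by (simp add: fun_eq_iff)
qed

lemma comp_zigzag1:
  assumes R: "equivp R"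
  shows "comp_step (Cap p) (comp_step (Cup (Suc p)) (R, N)) = (R, N)"
proof -
  have "skip_pair p a = Suc p \<longleftrightarrow> False" "skip_pair p a = Suc (Suc p) \<longleftrightarrow> a = p" "skip_pair p a = p \<longleftrightarrow> False"
    "drop_pair (Suc p) p = p" "a \<noteq> p \<Longrightarrow> drop_pair (Suc p) (skip_pair p a) = a" for a
    by (auto simp: skip_pair_def drop_pair_def)
  note facts = this equivp_facts[OF R]
  have "fst (comp_step (Cap p) (comp_step (Cup (Suc p)) (R, N))) a b = R a b" for a b
    by (cases "a = p"; cases "b = p") (use facts in auto)
  moreover have "snd (comp_step (Cap p) (comp_step (Cup (Suc p)) (R, N))) = N"
    using facts by auto
  ultimately show ?thesis by (intro prod_eqI ext) auto
qed

lemma comp_zigzag2: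
  assumes R: "equivp R"
  shows "comp_step (Cap (Suc p)) (comp_step (Cup p) (R, N)) = (R, N)"
proof -
  have "skip_pair (Suc p) a = p \<longleftrightarrow> a = p" "skip_pair (Suc p) a = Suc p \<longleftrightarrow> False"
    "skip_pair (Suc p) a = Suc (Suc p) \<longleftrightarrow> False"
    "drop_pair p (Suc (Suc p)) = p" "a \<noteq> p \<Longrightarrow> drop_pair p (skip_pair (Suc p) a) = a" for a
    by (auto simp: skip_pair_def drop_pair_def)
  note facts = this equivp_facts[OF R]
  have "fst (comp_step (Cap (Suc p)) (comp_step (Cup p) (R, N))) a b = R a b" for a b
    by (cases "a = p"; cases "b = p") (use facts in auto)
  moreover have "snd (comp_step (Cap (Suc p)) (comp_step (Cup p) (R, N))) = N"
    using facts by auto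
  ultimately show ?thesis by (intro prod_eqI ext) auto
qed

lemma comp_commute1:
  assumes "q \<le> p"
  shows "comp_step (Cap (p + 2)) (comp_step (Cup q) (R, N)) = comp_step (Cup q) (comp_step (Cap p) (R, N))"
proof -
  define P where "P = p + 2"
  have "skip_pair P a = q \<longleftrightarrow> a = q" "skip_pair P a = Suc q \<longleftrightarrow> a = Suc q"
    "a \<noteq> q \<Longrightarrow> a \<noteq> Suc q \<Longrightarrow> drop_pair q (skip_pair P a) = skip_pair p (drop_pair q a)" for a
    using assms P_def by (auto simp: skip_pair_def drop_pair_def)
  moreover have "drop_pair q P = p" "drop_pair q (Suc P) = Suc p"
    "P \<noteq> q" "P \<noteq> Suc q" "Suc P \<noteq> q" "Suc P \<noteq> Suc q"
    using assms P_def by (auto simp: drop_pair_def)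
  ultimately have facts: "\<And>a. skip_pair P a = q \<longleftrightarrow> a = q" "\<And>a. skip_pair P a = Suc q \<longleftrightarrow> a = Suc q"
    "\<And>a. a \<noteq> q \<Longrightarrow> a \<noteq> Suc q \<Longrightarrow> drop_pair q (skip_pair P a) = skip_pair p (drop_pair q a)"
    "drop_pair q P = p" "drop_pair q (Suc P) = Suc p"
    "P \<noteq> q" "P \<noteq> Suc q" "Suc P \<noteq> q" "Suc P \<noteq> Suc q" by blast+
  have "fst (comp_step (Cap P) (comp_step (Cup q) (R, N))) a b = fst (comp_step (Cup q) (comp_step (Cap p) (R, N))) a b" for a b
    by (cases "a = q \<or> a = Suc q"; cases "b = q \<or> b = Suc q") (auto simp: facts)
  moreover have "snd (comp_step (Cap P) (comp_step (Cup q) (R, N))) = snd (comp_step (Cup q) (comp_step (Cap p) (R, N)))"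
    by (simp only: comp_step.simps snd_conv facts) simp
  ultimately show ?thesis unfolding P_def by (intro prod_eqI ext)
qed

lemma comp_commute2:
  assumes "p \<le> q"
  shows "comp_step (Cap p) (comp_step (Cup (q + 2)) (R, N)) = comp_step (Cup q) (comp_step (Cap p) (R, N))"
proof -
  define Q where "Q = q + 2"
  have "skip_pair p a = Q \<longleftrightarrow> a = q" "skip_pair p a = Suc Q \<longleftrightarrow> a = Suc q"
    "a \<noteq> q \<Longrightarrow> a \<noteq> Suc q \<Longrightarrow> drop_pair Q (skip_pair p a) = skip_pair p (drop_pair q a)" for a
    using assms Q_def by (auto simp: skip_pair_def drop_pair_def)
  moreover have "drop_pair Q p = p" "drop_pair Q (Suc p) = Suc p"
    "p \<noteq> Q" "p \<noteq> Suc Q" "Suc p \<noteq> Q" "Suc p \<noteq> Suc Q"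
    using assms Q_def by (auto simp: drop_pair_def)
  ultimately have facts: "\<And>a. skip_pair p a = Q \<longleftrightarrow> a = q" "\<And>a. skip_pair p a = Suc Q \<longleftrightarrow> a = Suc q"
    "\<And>a. a \<noteq> q \<Longrightarrow> a \<noteq> Suc q \<Longrightarrow> drop_pair Q (skip_pair p a) = skip_pair p (drop_pair q a)"
    "drop_pair Q p = p" "drop_pair Q (Suc p) = Suc p"
    "p \<noteq> Q" "p \<noteq> Suc Q" "Suc p \<noteq> Q" "Suc p \<noteq> Suc Q" by blast+
  have "fst (comp_step (Cap p) (comp_step (Cup Q) (R, N))) a b = fst (comp_step (Cup q) (comp_step (Cap p) (R, N))) a b" for a b
    by (cases "a = q \<or> a = Suc q"; cases "b = q \<or> b = Suc q") (auto simp: facts)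
  moreover have "snd (comp_step (Cap p) (comp_step (Cup Q) (R, N))) = snd (comp_step (Cup q) (comp_step (Cap p) (R, N)))"
    by (simp only: comp_step.simps snd_conv facts) simp
  ultimately show ?thesis unfolding Q_def by (intro prod_eqI ext)
qed

fun is_cup :: "slice \<Rightarrow> bool" where
  "is_cup (Cup p) \<longleftrightarrow> True"
| "is_cup _ \<longleftrightarrow> False"

lemma final_width_cups: "list_all is_cup C \<Longrightarrow> final_width w C = w + 2 * length C"
proof (induction C arbitrary: w)
  case (Cons s C)
  then show ?case by (cases s) auto
qed simp

context path_model begin

lemma word_act_simps [simp]: "word_act [] \<psi> = \<psi>" "word_act (s # D) \<psi> = word_act D (slice_act s \<psi>)"
  "word_act (C @ D) \<psi> = word_act D (word_act C \<psi>)"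
  by (simp_all add: word_act_def)

lemma slice_act_space: "\<psi> \<in> space \<Longrightarrow> slice_act s \<psi> \<in> space"
  by (cases s) auto

lemma word_act_space [simp]: "\<psi> \<in> space \<Longrightarrow> word_act D \<psi> \<in> space"
  by (induction D arbitrary: \<psi>) (auto simp: slice_act_space)

text \<open>One number \<open>k\<close> governs both the count of components and the operator,
  because the same planar moves reduce both. The arbitrary initial count \<open>N\<close> lets loops
  be added at the bottom of the word.\<close>

definition evaluates :: "slice list \<Rightarrow> nat \<Rightarrow> bool" where
  "evaluates S k \<longleftrightarrow> (\<forall>R N. equivp R \<longrightarrow> comp_state S (R, N) = (R, N + int k)) \<and>
     (\<forall>\<psi>\<in>space. word_act S \<psi> = (\<lambda>h. (- of_real (qint 2)) ^ k * \<psi> h))"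

lemma lin_on_slice_act: "lin_on (slice_act s)"
  by (cases s) (auto intro: lin_on_cup lin_on_cap mor1_lin_on[OF mor1_crs])

lemma lin_on_word_act: "lin_on (word_act D)"
proof (induction D)
  case (Cons s D)
  show ?case
  proof (rule lin_onI)
    fix x y \<psi> \<phi> assume *: "\<psi> \<in> space" "\<phi> \<in> space"
    show "word_act (s # D) (\<lambda>h. x * \<psi> h + y * \<phi> h) = (\<lambda>h. x * word_act (s # D) \<psi> h + y * word_act (s # D) \<phi> h)"
      unfolding word_act_simps lin_onD[OF lin_on_slice_act *]
      by (rule lin_onD[OF Cons slice_act_space[OF *(1)] slice_act_space[OF *(2)]])
  qed
qed (simp add: lin_on_def)

text \<open>One planar move: the neighbouring slices \<open>s\<close> and \<open>t\<close> are
  replaced by \<open>M\<close>, and \<open>m\<close> loops split off.\<close>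

lemma evaluates_transfer:
  assumes "evaluates S' k"
    and "\<And>R N. equivp R \<Longrightarrow> comp_step t (comp_step s (R, N)) = comp_state M (R, N + int m)"
    and "\<And>\<psi>. \<psi> \<in> space \<Longrightarrow> slice_act t (slice_act s \<psi>) = (\<lambda>h. (- of_real (qint 2)) ^ m * word_act M \<psi> h)"
    and "S' = C @ M @ T" "S = C @ s # t # T"
  shows "evaluates S (k + m)"
proof -
  have shift1: "comp_step u (R, N + n) = (fst (comp_step u (R, N)), snd (comp_step u (R, N)) + n)" for u R N n
    by (cases u) auto
  have shift: "comp_state D (R, N + n) = (fst (comp_state D (R, N)), snd (comp_state D (R, N)) + n)" for D R N n
  proof (induction D arbitrary: R N)
    case (Cons u D)
    show ?case
      using Cons[of "fst (comp_step u (R, N))" "snd (comp_step u (R, N))"] by (simp add: shift1)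
  qed simp
  have "comp_state S (R, N) = (R, N + int (k + m))" if R: "equivp R" for R N
  proof -
    obtain R' N' where C: "comp_state C (R, N) = (R', N')" by fastforce
    then have R': "equivp R'" using equivp_comp_state[of "(R, N)" C] R by simp
    have "comp_state S (R, N) = comp_state T (comp_state M (R', N' + int m))"
      using C assms(2)[OF R'] by (simp add: assms(5))
    also have "\<dots> = comp_state (C @ M @ T) (R, N + int m)"
      using shift[of C R N "int m"] C by simp
    finally show ?thesis using assms(1,4) R by (simp add: evaluates_def)
  qed
  moreover have "word_act S \<psi> = (\<lambda>h. (- of_real (qint 2)) ^ (k + m) * \<psi> h)" if "\<psi> \<in> space" for \<psi>
  proof -
    have "word_act S \<psi> = word_act T (\<lambda>h. (- of_real (qint 2)) ^ m * word_act M (word_act C \<psi>) h)"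
      using assms(3)[of "word_act C \<psi>"] that by (simp add: assms(5))
    also have "\<dots> = (\<lambda>h. (- of_real (qint 2)) ^ m * word_act T (word_act M (word_act C \<psi>)) h)"
      by (rule lin_on_scale[OF lin_on_word_act]) (use that in simp)
    also have "word_act T (word_act M (word_act C \<psi>)) = word_act S' \<psi>" by (simp add: assms(4))
    finally show ?thesis using assms(1) that by (simp add: evaluates_def power_add mult_ac)
  qed
  ultimately show ?thesis by (simp add: evaluates_def)
qed

text \<open>Below the lowest cap there are only cups. With the last of them it forms a loop or a
  zigzag, which shortens the word, or it moves below it, which shortens the initial run of cups;
  hence the lexicographic measure.\<close>

lemma closed_evaluates:
  assumes "closes_from 0 S" "list_all crossless S"
  shows "\<exists>k. evaluates S k"
  using assms
proof (induction "(length S, length (takeWhile is_cup S))" arbitrary: S rule: wf_induct_rule[OF wf_lex_prod[OF wf_less_than wf_less_than]])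
  case (1 S)
  then have IH: "\<exists>k. evaluates S' k"
    if "length S' < length S \<or> length S' = length S \<and> length (takeWhile is_cup S') < length (takeWhile is_cup S)"
      "closes_from 0 S'" "list_all crossless S'" for S'
    using that by (metis in_lex_prod less_than_iff)
  define C0 where "C0 = takeWhile is_cup S"
  show ?case
  proof (cases "S = []")
    case True
    then show ?thesis by (intro exI[of _ 0]) (simp add: evaluates_def)
  next
    case False
    have cups: "list_all is_cup C0"
      unfolding C0_def list_all_iff by (meson set_takeWhileD)
    \<comment> \<open>Cups alone cannot close up: they leave a positive width.\<close>
    have "C0 \<noteq> S"
      using final_width_cups[OF cups, of 0] 1 False by (auto simp: closes_from_iff)
    then have "dropWhile is_cup S \<noteq> []"
      unfolding C0_def by (metis append_Nil2 takeWhile_dropWhile_id)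
    then obtain s T where sT: "dropWhile is_cup S = s # T" by (cases "dropWhile is_cup S") auto
    have ns: "\<not> is_cup s" using hd_dropWhile[of is_cup S] sT by simp
    have S: "S = C0 @ s # T" unfolding C0_def sT[symmetric] by simp
    then have "crossless s" using 1 by simp
    with ns obtain p where p: "s = Cap p" by (cases s) auto
    have "C0 \<noteq> []" using S p 1 by auto
    then obtain C s' where C: "C0 = C @ [s']" by (metis rev_exhaust)
    with cups obtain q where q: "s' = Cup q" "list_all is_cup C" by (cases s') auto
    have S2: "S = C @ Cup q # Cap p # T" using S C p q by simp
    define w where "w = final_width 0 C"
    have adm: "admissible_word 0 C" "q \<le> w" "p \<le> w" "admissible_word w T" "final_width w T = 0"
      using 1 unfolding S2 closes_from_iff by (auto simp: w_def)
    have cr: "list_all crossless C" "list_all crossless T" using 1 unfolding S2 by auto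
    have tw: "takeWhile is_cup (C @ Cap x # Y) = C" for x Y
      using q(2) by (simp add: takeWhile_append list_all_iff)
    have C0len: "length (takeWhile is_cup S) = Suc (length C)"
      using C by (simp add: C0_def[symmetric])
    have short: "\<exists>k. evaluates (C @ T) k"
      by (rule IH) (use adm cr in \<open>auto simp: S2 closes_from_iff w_def\<close>)
    \<comment> \<open>A loop, the two zigzags, and the cap to the right or to the left of the
      cup.\<close>
    consider "p = q" | "p = Suc q" | "q = Suc p" | p' where "p = p' + 2" "q \<le> p'" | q' where "q = q' + 2" "p \<le> q'"
    proof -
      have "p = q \<or> p = Suc q \<or> q = Suc p \<or> p = (p - 2) + 2 \<and> q \<le> p - 2 \<or> q = (q - 2) + 2 \<and> p \<le> q - 2"
        by linarith
      then show ?thesis using that by blast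
    qed
    then show ?thesis
    proof cases
      case 1
      obtain k where k: "evaluates (C @ T) k" using short by blast
      have "evaluates S (k + 1)"
        by (rule evaluates_transfer[OF k, where s = "Cup q" and t = "Cap p" and M = "[]" and C = C and T = T])
          (simp_all add: S2 1 comp_loop cap_cup_loop del: comp_step.simps)
      then show ?thesis ..
    next
      case 2
      obtain k where k: "evaluates (C @ T) k" using short by blast
      have "evaluates S (k + 0)"
        by (rule evaluates_transfer[OF k, where s = "Cup q" and t = "Cap p" and M = "[]" and C = C and T = T])
          (simp_all add: S2 2 comp_zigzag2 cap_Suc_cup del: comp_step.simps)
      then show ?thesis ..
    next
      case 3
      obtain k where k: "evaluates (C @ T) k" using short by blast
      have "evaluates S (k + 0)"
        by (rule evaluates_transfer[OF k, where s = "Cup q" and t = "Cap p" and M = "[]" and C = C and T = T])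
          (simp_all add: S2 3 comp_zigzag1 cap_cup_Suc del: comp_step.simps)
      then show ?thesis ..
    next
      case (4 p')
      let ?S' = "C @ [Cap p', Cup q] @ T"
      have "length ?S' = length S" by (simp add: S2)
      moreover have "length (takeWhile is_cup ?S') < length (takeWhile is_cup S)"
        unfolding C0len using tw[of "p'" "Cup q # T"] by simp
      moreover have "Suc (Suc (w - 2)) = w" using adm 4 by simp
      then have "closes_from 0 ?S'" using adm 4 by (simp add: closes_from_iff w_def[symmetric])
      moreover have "list_all crossless ?S'" using cr by simp
      ultimately have "\<exists>k. evaluates ?S' k" using IH by blast
      then obtain k where k: "evaluates ?S' k" by blast
      have "evaluates S (k + 0)"
        by (rule evaluates_transfer[OF k, where s = "Cup q" and t = "Cap p" and M = "[Cap p', Cup q]" and C = C and T = T])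
          (simp_all add: S2 4 comp_commute1[unfolded add_2_eq_Suc'] cup_cap[unfolded add_2_eq_Suc', symmetric] del: comp_step.simps)
      then show ?thesis ..
    next
      case (5 q')
      let ?S' = "C @ [Cap p, Cup q'] @ T"
      have "length ?S' = length S" by (simp add: S2)
      moreover have "length (takeWhile is_cup ?S') < length (takeWhile is_cup S)"
        unfolding C0len using tw[of "p" "Cup q' # T"] by simp
      moreover have "Suc (Suc (w - 2)) = w" using adm 5 by simp
      then have "closes_from 0 ?S'" using adm 5 by (simp add: closes_from_iff w_def[symmetric])
      moreover have "list_all crossless ?S'" using cr by simp
      ultimately have "\<exists>k. evaluates ?S' k" using IH by blast
      then obtain k where k: "evaluates ?S' k" by blast
      have "evaluates S (k + 0)"
        by (rule evaluates_transfer[OF k, where s = "Cup q" and t = "Cap p" and M = "[Cap p, Cup q']" and C = C and T = T])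
          (simp_all add: S2 5 comp_commute2[unfolded add_2_eq_Suc'] cap_cup[unfolded add_2_eq_Suc'] del: comp_step.simps)
      then show ?thesis ..
    qed
  qed
qed

end

section \<open>The components of a crossingless diagram as a graph\<close>

lemma arcs_from_append:
  "arcs_from j w (C @ T) = arcs_from j w C \<union> arcs_from (j + length C) (final_width w C) T"
  by (induction C arbitrary: j w) auto

definition slice_edges :: "nat \<Rightarrow> nat \<Rightarrow> slice \<Rightarrow> node rel" where
  "slice_edges j w s = {(u, v). \<exists>m. (u, m, v) \<in> slice_arcs j w s}"

lemma slice_edges_image: "slice_edges j w s = (\<lambda>(u, m, v). (u, v)) ` slice_arcs j w s"
  by (force simp: slice_edges_def)

lemma adjacent_snoc:
  "adjacent (C @ [s]) = adjacent C \<union> slice_edges (length C) (final_width 0 C) s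
     \<union> (slice_edges (length C) (final_width 0 C) s)\<inverse>"
  by (auto simp: adjacent_def arcs_def arcs_from_append slice_edges_def)

lemma slice_edges_Cup:
  assumes "p \<le> w"
  shows "slice_edges j w (Cup p) =
    insert ((Suc j, p), (Suc j, Suc p)) {((j, q), (Suc j, skip_pair p q)) | q. q < w}"
proof -
  have "slice_edges j w (Cup p) = insert ((Suc j, p), (Suc j, Suc p))
      ({((j, q), (Suc j, q)) | q. q < p} \<union> {((j, q), (Suc j, q + 2)) | q. p \<le> q \<and> q < w})"
    by (simp add: slice_edges_image image_Un setcompr_eq_image image_image through_arc_def)
  also have "{((j, q), (Suc j, q)) | q. q < p} \<union> {((j, q), (Suc j, q + 2)) | q. p \<le> q \<and> q < w}
      = {((j, q), (Suc j, skip_pair p q)) | q. q < w}"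
  proof -
    have "{q. q < w} = {q. q < p} \<union> {q. p \<le> q \<and> q < w}" using assms by auto
    then show ?thesis
      unfolding setcompr_eq_image
      by (simp only: image_Un) (intro arg_cong2[where f = "(\<union>)"] image_cong refl; simp add: skip_pair_def)
  qed
  finally show ?thesis .
qed

lemma slice_edges_Cap:
  assumes "p + 2 \<le> w"
  shows "slice_edges j w (Cap p) =
    insert ((j, p), (j, Suc p)) {((j, skip_pair p q), (Suc j, q)) | q. q + 2 < w}"
proof -
  have "slice_edges j w (Cap p) = insert ((j, p), (j, Suc p))
      ({((j, q), (Suc j, q)) | q. q < p} \<union> {((j, q + 2), (Suc j, q)) | q. p \<le> q \<and> q + 2 < w})"
    by (simp add: slice_edges_image image_Un setcompr_eq_image image_image through_arc_def)
  also have "{((j, q), (Suc j, q)) | q. q < p} \<union> {((j, q + 2), (Suc j, q)) | q. p \<le> q \<and> q + 2 < w}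
      = {((j, skip_pair p q), (Suc j, q)) | q. q + 2 < w}"
  proof -
    have "{q. q + 2 < w} = {q. q < p} \<union> {q. p \<le> q \<and> q + 2 < w}" using assms by auto
    then show ?thesis
      unfolding setcompr_eq_image
      by (simp only: image_Un) (intro arg_cong2[where f = "(\<union>)"] image_cong refl; simp add: skip_pair_def)
  qed
  finally show ?thesis .
qed

lemma sym_adjacent: "sym (adjacent D)"
  by (auto simp: sym_def adjacent_def)

text \<open>Every node of \<open>U\<close> can be moved along edges, without changing its label,
  into the core \<open>K\<close>, where equal labels are known to be joined.\<close>

lemma label_kernel_extend:
  assumes sym: "sym E" and inv: "\<And>u v. (u, v) \<in> E \<Longrightarrow> lab u = lab v"
    and rep: "\<And>u. u \<in> U \<Longrightarrow> \<exists>v\<in>K. (u, v) \<in> E\<^sup>*"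
    and conn: "\<And>u v. u \<in> K \<Longrightarrow> v \<in> K \<Longrightarrow> lab u = lab v \<Longrightarrow> (u, v) \<in> E\<^sup>*"
    and "u \<in> U" "v \<in> U"
  shows "lab u = lab v \<longleftrightarrow> (u, v) \<in> E\<^sup>*"
proof -
  have eq: "(u, v) \<in> E\<^sup>* \<Longrightarrow> lab u = lab v" for u v
    by (induction rule: rtrancl_induct) (auto dest: inv)
  have sy: "(u, v) \<in> E\<^sup>* \<Longrightarrow> (v, u) \<in> E\<^sup>*" for u v
    using sym sym_rtrancl symD by metis
  obtain u' v' where *: "u' \<in> K" "v' \<in> K" "(u, u') \<in> E\<^sup>*" "(v, v') \<in> E\<^sup>*"
    using rep assms(5,6) by meson
  then have "lab u = lab v \<Longrightarrow> (u', v') \<in> E\<^sup>*"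
    using conn eq by metis
  then show ?thesis using * eq sy by (meson rtrancl_trans)
qed

text \<open>The induction hypothesis that links \<open>comp_step\<close> with the graph. Labels
  instead of classes make it easy to extend a component by one level.\<close>

definition comp_labelling :: "slice list \<Rightarrow> (node \<Rightarrow> nat) \<Rightarrow> bool" where
  "comp_labelling C lab \<longleftrightarrow>
     (\<forall>u\<in>nodes C. \<forall>v\<in>nodes C. lab u = lab v \<longleftrightarrow> (u, v) \<in> (adjacent C)\<^sup>*) \<and>
     (\<forall>a<final_width 0 C. \<forall>b<final_width 0 C.
        fst (comp_state C ((=), 0)) a b \<longleftrightarrow> lab (length C, a) = lab (length C, b)) \<and>
     snd (comp_state C ((=), 0)) = int (card (lab ` nodes C))"

definition node_bounds :: "slice list \<Rightarrow> bool" where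
  "node_bounds C \<longleftrightarrow> finite (nodes C) \<and> (\<forall>u\<in>nodes C. fst u \<le> length C) \<and>
     (\<forall>q<final_width 0 C. (length C, q) \<in> nodes C)"

lemma edge_nodes: "(u, v) \<in> adjacent C \<Longrightarrow> u \<in> nodes C" "(u, v) \<in> adjacent C \<Longrightarrow> v \<in> nodes C"
  by (auto simp: nodes_def Field_def)

lemma nodes_snoc_Cup:
  assumes "node_bounds C" "p \<le> final_width 0 C"
  shows "nodes (C @ [Cup p]) = nodes C \<union> {Suc (length C)} \<times> {..<final_width 0 C + 2}"
proof -
  let ?w = "final_width 0 C" and ?j = "length C"
  have "{((?j, q), (Suc ?j, skip_pair p q)) | q. q < ?w} = (\<lambda>q. ((?j, q), (Suc ?j, skip_pair p q))) ` {..<?w}" by auto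
  then have F: "nodes (C @ [Cup p]) = nodes C \<union> {(Suc ?j, p), (Suc ?j, Suc p)} \<union> Pair ?j ` {..<?w}
      \<union> (\<lambda>q. (Suc ?j, skip_pair p q)) ` {..<?w}"
    using slice_edges_Cup[OF assms(2)]
    by (auto simp: nodes_def adjacent_snoc Field_def Domain_unfold Range.simps)
  have "a \<in> {p, Suc p} \<union> skip_pair p ` {..<?w}" if "a < ?w + 2" for a
  proof -
    have "a = p \<or> a = Suc p \<or> a = skip_pair p (drop_pair p a) \<and> drop_pair p a < ?w"
      using that assms(2) by (auto simp: skip_pair_def drop_pair_def)
    then show ?thesis by auto
  qed
  moreover have "skip_pair p q < ?w + 2" if "q < ?w" for q using that by (auto simp: skip_pair_def)
  ultimately have "{Suc ?j} \<times> {..<?w + 2} = {(Suc ?j, p), (Suc ?j, Suc p)} \<union> (\<lambda>q. (Suc ?j, skip_pair p q)) ` {..<?w}"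
    using assms(2) by force
  moreover have "Pair ?j ` {..<?w} \<subseteq> nodes C" using assms(1) by (auto simp: node_bounds_def)
  ultimately show ?thesis unfolding F by blast
qed

lemma nodes_snoc_Cap:
  assumes "node_bounds C" "p + 2 \<le> final_width 0 C"
  shows "nodes (C @ [Cap p]) = nodes C \<union> {Suc (length C)} \<times> {..<final_width 0 C - 2}"
proof -
  let ?w = "final_width 0 C" and ?j = "length C"
  have F: "nodes (C @ [Cap p]) = nodes C \<union> {(?j, p), (?j, Suc p)} \<union> (\<lambda>q. (?j, skip_pair p q)) ` {q. q + 2 < ?w}
      \<union> Pair (Suc ?j) ` {q. q + 2 < ?w}"
    using slice_edges_Cap[OF assms(2)]
    by (auto simp: nodes_def adjacent_snoc Field_def Domain_unfold Range.simps)
  have "(?j, skip_pair p q) \<in> nodes C" if "q + 2 < ?w" for q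
    using assms that by (auto simp: node_bounds_def skip_pair_def)
  moreover have "(?j, p) \<in> nodes C" "(?j, Suc p) \<in> nodes C"
    using assms by (auto simp: node_bounds_def)
  moreover have "Pair (Suc ?j) ` {q. q + 2 < ?w} = {Suc ?j} \<times> {..<?w - 2}" by auto
  ultimately show ?thesis unfolding F by blast
qed

lemma comp_labelling_Cup:
  assumes "node_bounds C" "p \<le> final_width 0 C" "comp_labelling C lab"
  shows "\<exists>lab'. comp_labelling (C @ [Cup p]) lab'"
proof -
  let ?w = "final_width 0 C" and ?j = "length C"
  let ?E = "adjacent (C @ [Cup p])"
  \<comment> \<open>A fresh label for the component that the cup opens; the inserted 0 keeps
    \<open>Max\<close> defined for a diagram without nodes.\<close>
  define z where "z = Suc (Max (insert 0 (lab ` nodes C)))"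
  have fin: "finite (nodes C)" and lev: "\<And>u. u \<in> nodes C \<Longrightarrow> fst u \<le> ?j"
    and top: "\<And>q. q < ?w \<Longrightarrow> (?j, q) \<in> nodes C"
    using assms(1) by (auto simp: node_bounds_def)
  have z: "lab u \<noteq> z" if "u \<in> nodes C" for u
  proof -
    have "lab u \<le> Max (insert 0 (lab ` nodes C))"
      by (rule Max_ge) (use fin that in auto)
    then show ?thesis by (simp add: z_def)
  qed
  define lab' where "lab' u = (if fst u \<le> ?j then lab u
     else if snd u = p \<or> snd u = Suc p then z else lab (?j, drop_pair p (snd u)))" for u :: node
  have E: "?E = adjacent C \<union> slice_edges ?j ?w (Cup p) \<union> (slice_edges ?j ?w (Cup p))\<inverse>"
    by (rule adjacent_snoc)
  note se = slice_edges_Cup[OF assms(2), of ?j]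
  have old: "lab' u = lab u" if "u \<in> nodes C" for u using lev[OF that] by (simp add: lab'_def)
  have sk: "skip_pair p q \<noteq> p" "skip_pair p q \<noteq> Suc p" "drop_pair p (skip_pair p q) = q" for q
    by (auto simp: skip_pair_def drop_pair_def)
  have ker: "lab' u = lab' v \<longleftrightarrow> (u, v) \<in> ?E\<^sup>*" if "u \<in> nodes (C @ [Cup p])" "v \<in> nodes (C @ [Cup p])" for u v
  \<comment> \<open>The old nodes and the left foot of the cup form a core: every other new node is
    adjacent to one of these.\<close>
  proof (rule label_kernel_extend[where K = "insert (Suc ?j, p) (nodes C)" and U = "nodes (C @ [Cup p])", OF sym_adjacent])
    have e: "lab' u = lab' v" if "(u, v) \<in> slice_edges ?j ?w (Cup p)" for u v
      using that top unfolding se by (auto simp: lab'_def sk)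
    show "lab' u = lab' v" if "(u, v) \<in> ?E" for u v
    proof (cases "(u, v) \<in> adjacent C")
      case True
      then have "lab u = lab v" using assms(3) edge_nodes by (auto simp: comp_labelling_def)
      then show ?thesis using old edge_nodes True by metis
    next
      case False
      then show ?thesis using that e unfolding E by (auto dest: e)
    qed
    show "\<exists>v\<in>insert (Suc ?j, p) (nodes C). (u, v) \<in> ?E\<^sup>*" if u: "u \<in> nodes (C @ [Cup p])" for u
    proof (cases "u \<in> nodes C")
      case False
      then obtain a where a: "u = (Suc ?j, a)" "a < ?w + 2"
        using u nodes_snoc_Cup[OF assms(1,2)] by auto
      consider "a = p" | "a = Suc p" | "a = skip_pair p (drop_pair p a)" "drop_pair p a < ?w"
      proof -
        have "a = p \<or> a = Suc p \<or> a = skip_pair p (drop_pair p a) \<and> drop_pair p a < ?w"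
          using a(2) assms(2) by (auto simp: skip_pair_def drop_pair_def)
        then show ?thesis using that by blast
      qed
      then show ?thesis
      proof cases
        case 2
        then have "(u, (Suc ?j, p)) \<in> ?E" unfolding E se a by auto
        then show ?thesis by blast
      next
        case 3
        then have "((?j, drop_pair p a), (Suc ?j, skip_pair p (drop_pair p a))) \<in> slice_edges ?j ?w (Cup p)"
          unfolding se by blast
        then have "(u, (?j, drop_pair p a)) \<in> ?E" unfolding E a using 3(1) by auto
        then show ?thesis using top[OF 3(2)] by blast
      qed (use a in blast)
    qed blast
    show "(u, v) \<in> ?E\<^sup>*" if "u \<in> insert (Suc ?j, p) (nodes C)" "v \<in> insert (Suc ?j, p) (nodes C)" "lab' u = lab' v" for u v
    proof (cases "u \<in> nodes C \<and> v \<in> nodes C")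
      case True
      then have "(u, v) \<in> (adjacent C)\<^sup>*" using assms(3) that(3) old by (auto simp: comp_labelling_def)
      then show ?thesis using rtrancl_mono[of "adjacent C" ?E] E by blast
    next
      case False
      have zz: "lab' (Suc ?j, p) = z" by (simp add: lab'_def)
      then have "u = v" using that False z old by (metis insert_iff)
      then show ?thesis by simp
    qed
  qed (use that in auto)
  have new: "lab' (Suc ?j, a) = (if a = p \<or> a = Suc p then z else lab (?j, drop_pair p a))" for a
    by (simp add: lab'_def)
  have dp: "drop_pair p a < ?w" if "a < ?w + 2" "a \<noteq> p" "a \<noteq> Suc p" for a
    using that assms(2) by (auto simp: drop_pair_def)
  have img: "lab' ` nodes (C @ [Cup p]) = insert z (lab ` nodes C)"
  proof -
    have "lab' ` ({Suc ?j} \<times> {..<?w + 2}) \<subseteq> insert z (lab ` nodes C)"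
      using new dp top by auto
    moreover have "z \<in> lab' ` ({Suc ?j} \<times> {..<?w + 2})"
      using new[of p] assms(2) by (intro image_eqI[of _ _ "(Suc ?j, p)"]) auto
    moreover have "lab' ` nodes C = lab ` nodes C" using old by (rule image_cong[OF refl])
    ultimately show ?thesis unfolding nodes_snoc_Cup[OF assms(1,2)] image_Un by blast
  qed
  obtain R N where RN: "comp_state C ((=), 0) = (R, N)" by fastforce
  have R: "R a b \<longleftrightarrow> lab (?j, a) = lab (?j, b)" if "a < ?w" "b < ?w" for a b
    using assms(3) that RN by (auto simp: comp_labelling_def)
  have N: "N = int (card (lab ` nodes C))" using assms(3) RN by (auto simp: comp_labelling_def)
  have "comp_labelling (C @ [Cup p]) lab'"
    unfolding comp_labelling_def
  proof (intro conjI ballI allI impI ker)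
    fix a b assume ab: "a < final_width 0 (C @ [Cup p])" "b < final_width 0 (C @ [Cup p])"
    then show "fst (comp_state (C @ [Cup p]) ((=), 0)) a b \<longleftrightarrow> lab' (length (C @ [Cup p]), a) = lab' (length (C @ [Cup p]), b)"
      using R[OF dp dp] z[OF top[OF dp]] by (auto simp: RN new) (metis+)?
  next
    show "snd (comp_state (C @ [Cup p]) ((=), 0)) = int (card (lab' ` nodes (C @ [Cup p])))"
      unfolding img using N z fin by (auto simp: RN card_insert_if)
  qed
  then show ?thesis by blast
qed

lemma comp_labelling_Cap:
  assumes "node_bounds C" "p + 2 \<le> final_width 0 C" "comp_labelling C lab"
  shows "\<exists>lab'. comp_labelling (C @ [Cap p]) lab'"
proof -
  let ?w = "final_width 0 C" and ?j = "length C"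
  let ?E = "adjacent (C @ [Cap p])"
  define x where "x = lab (?j, p)"
  define y where "y = lab (?j, Suc p)"
  \<comment> \<open>The cap joins the components of its two feet, so the label \<open>y\<close> is
    renamed to \<open>x\<close>.\<close>
  define m where "m l = (if l = y then x else l)" for l
  have fin: "finite (nodes C)" and lev: "\<And>u. u \<in> nodes C \<Longrightarrow> fst u \<le> ?j"
    and top: "\<And>q. q < ?w \<Longrightarrow> (?j, q) \<in> nodes C"
    using assms(1) by (auto simp: node_bounds_def)
  define lab' where "lab' u = (if fst u \<le> ?j then m (lab u) else m (lab (?j, skip_pair p (snd u))))" for u :: node
  have E: "?E = adjacent C \<union> slice_edges ?j ?w (Cap p) \<union> (slice_edges ?j ?w (Cap p))\<inverse>"
    by (rule adjacent_snoc)
  note se = slice_edges_Cap[OF assms(2), of ?j]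
  have old: "lab' u = m (lab u)" if "u \<in> nodes C" for u using lev[OF that] by (simp add: lab'_def)
  have pn: "(?j, p) \<in> nodes C" "(?j, Suc p) \<in> nodes C" using top assms(2) by auto
  have sp: "skip_pair p q < ?w" if "q + 2 < ?w" for q using that by (auto simp: skip_pair_def)
  have sub: "(adjacent C)\<^sup>* \<subseteq> ?E\<^sup>*" by (rule rtrancl_mono) (use E in blast)
  have pE: "((?j, p), (?j, Suc p)) \<in> ?E" "((?j, Suc p), (?j, p)) \<in> ?E" unfolding E se by blast+
  have con: "(u, v) \<in> ?E\<^sup>*" if "u \<in> nodes C" "v \<in> nodes C" "lab u = lab v" for u v
    using assms(3) that sub by (auto simp: comp_labelling_def)
  have ker: "lab' u = lab' v \<longleftrightarrow> (u, v) \<in> ?E\<^sup>*" if "u \<in> nodes (C @ [Cap p])" "v \<in> nodes (C @ [Cap p])" for u v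
  proof (rule label_kernel_extend[where K = "nodes C" and U = "nodes (C @ [Cap p])", OF sym_adjacent])
    have e: "lab' u = lab' v" if "(u, v) \<in> slice_edges ?j ?w (Cap p)" for u v
      using that unfolding se by (auto simp: lab'_def m_def x_def y_def)
    show "lab' u = lab' v" if "(u, v) \<in> ?E" for u v
    proof (cases "(u, v) \<in> adjacent C")
      case True
      then have "lab u = lab v" using assms(3) edge_nodes by (auto simp: comp_labelling_def)
      then show ?thesis using old edge_nodes True by metis
    next
      case False
      then show ?thesis using that e unfolding E by (auto dest: e)
    qed
    show "\<exists>v\<in>nodes C. (u, v) \<in> ?E\<^sup>*" if u: "u \<in> nodes (C @ [Cap p])" for u
    proof (cases "u \<in> nodes C")
      case False
      then obtain a where a: "u = (Suc ?j, a)" "a + 2 < ?w"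
        using u nodes_snoc_Cap[OF assms(1,2)] by auto
      then have "((?j, skip_pair p a), u) \<in> slice_edges ?j ?w (Cap p)" unfolding se by blast
      then have "(u, (?j, skip_pair p a)) \<in> ?E" unfolding E by blast
      then show ?thesis using top[OF sp[OF a(2)]] by blast
    qed blast
    show "(u, v) \<in> ?E\<^sup>*" if "u \<in> nodes C" "v \<in> nodes C" "lab' u = lab' v" for u v
    proof -
      have "m (lab u) = m (lab v)" using old that by metis
      then consider "lab u = lab v" | "lab u = x" "lab v = y" | "lab u = y" "lab v = x"
        by (auto simp: m_def split: if_splits)
      then show ?thesis
      proof cases
        case 2
        then have "(u, (?j, p)) \<in> ?E\<^sup>*" "((?j, Suc p), v) \<in> ?E\<^sup>*" using con that pn by (auto simp: x_def y_def)
        then show ?thesis using pE by (meson rtrancl_into_rtrancl rtrancl_trans)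
      next
        case 3
        then have "(u, (?j, Suc p)) \<in> ?E\<^sup>*" "((?j, p), v) \<in> ?E\<^sup>*" using con that pn by (auto simp: x_def y_def)
        then show ?thesis using pE by (meson rtrancl_into_rtrancl rtrancl_trans)
      qed (use con that in blast)
    qed
  qed (use that in auto)
  have new: "lab' (Suc ?j, a) = m (lab (?j, skip_pair p a))" for a
    by (simp add: lab'_def)
  have img: "lab' ` nodes (C @ [Cap p]) = m ` lab ` nodes C"
  proof -
    have "lab' ` ({Suc ?j} \<times> {..<?w - 2}) \<subseteq> m ` lab ` nodes C"
      using new sp top by auto
    moreover have "lab' ` nodes C = m ` lab ` nodes C" unfolding image_image using old by (rule image_cong[OF refl])
    ultimately show ?thesis unfolding nodes_snoc_Cap[OF assms(1,2)] image_Un by blast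
  qed
  obtain R N where RN: "comp_state C ((=), 0) = (R, N)" by fastforce
  have R: "R a b \<longleftrightarrow> lab (?j, a) = lab (?j, b)" if "a < ?w" "b < ?w" for a b
    using assms(3) that RN by (auto simp: comp_labelling_def)
  have N: "N = int (card (lab ` nodes C))" using assms(3) RN by (auto simp: comp_labelling_def)
  have xy: "x \<in> lab ` nodes C" "y \<in> lab ` nodes C" using pn by (auto simp: x_def y_def)
  \<comment> \<open>Renaming loses a label exactly when the cap joins two different
    components.\<close>
  have card: "int (card (m ` lab ` nodes C)) = (if x = y then N else N - 1)"
  proof (cases "x = y")
    case True
    then have "m = id" by (auto simp: m_def fun_eq_iff)
    then show ?thesis using N True by simp
  next
    case False
    then have "m ` lab ` nodes C = lab ` nodes C - {y}" using xy by (auto simp: m_def image_iff)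
    moreover have "card (lab ` nodes C) > 0" using xy fin by (auto simp: card_gt_0_iff)
    ultimately show ?thesis using N False xy fin by (simp add: card_Diff_singleton of_nat_diff Suc_leI)
  qed
  have Rp: "R p (Suc p) \<longleftrightarrow> x = y" using R[of p "Suc p"] assms(2) by (simp add: x_def y_def)
  have meq: "m k = m l \<longleftrightarrow> k = l \<or> k = x \<and> l = y \<or> k = y \<and> l = x" for k l
    by (auto simp: m_def)
  have "comp_labelling (C @ [Cap p]) lab'"
    unfolding comp_labelling_def
  proof (intro conjI ballI allI impI ker)
    fix a b assume "a < final_width 0 (C @ [Cap p])" "b < final_width 0 (C @ [Cap p])"
    then have ab: "skip_pair p a < ?w" "skip_pair p b < ?w" "p < ?w" "Suc p < ?w" using sp[of a] sp[of b] assms(2) by auto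
    show "fst (comp_state (C @ [Cap p]) ((=), 0)) a b \<longleftrightarrow> lab' (length (C @ [Cap p]), a) = lab' (length (C @ [Cap p]), b)"
      using R[OF ab(1,2)] R[OF ab(1,3)] R[OF ab(4,2)] R[OF ab(1,4)] R[OF ab(3,2)]
      by (auto simp: RN new meq x_def y_def)
  next
    show "snd (comp_state (C @ [Cap p]) ((=), 0)) = int (card (lab' ` nodes (C @ [Cap p])))"
      unfolding img card using Rp by (simp add: RN)
  qed
  then show ?thesis by blast
qed

lemma comp_labelling_exists:
  assumes "admissible_word 0 C" "list_all crossless C"
  shows "node_bounds C \<and> (\<exists>lab. comp_labelling C lab)"
  using assms
proof (induction C rule: rev_induct)
  case Nil
  have "nodes [] = {}" by (simp add: nodes_def adjacent_def arcs_def)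
  then show ?case by (auto simp: node_bounds_def comp_labelling_def)
next
  case (snoc s C)
  then have IH: "node_bounds C" "\<exists>lab. comp_labelling C lab" by auto
  then obtain lab where lab: "comp_labelling C lab" by blast
  show ?case
  proof (cases s)
    case (Cup p)
    then have p: "p \<le> final_width 0 C" using snoc.prems by simp
    have "node_bounds (C @ [Cup p])"
      using IH(1) unfolding node_bounds_def nodes_snoc_Cup[OF IH(1) p] by auto
    then show ?thesis using comp_labelling_Cup[OF IH(1) p lab] Cup by simp
  next
    case (Cap p)
    then have p: "p + 2 \<le> final_width 0 C" using snoc.prems by simp
    have "node_bounds (C @ [Cap p])"
      using IH(1) unfolding node_bounds_def nodes_snoc_Cap[OF IH(1) p] by auto
    then show ?thesis using comp_labelling_Cap[OF IH(1) p lab] Cap by simp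
  qed (use snoc.prems in simp)
qed

lemma card_quotient_kernel:
  assumes "\<And>u v. u \<in> U \<Longrightarrow> v \<in> U \<Longrightarrow> lab u = lab v \<longleftrightarrow> (u, v) \<in> r\<^sup>*" "sym r"
  shows "card (U // r\<^sup>*) = card (lab ` U)"
proof -
  have cls: "r\<^sup>* `` {u} = r\<^sup>* `` {v} \<longleftrightarrow> lab u = lab v" if "u \<in> U" "v \<in> U" for u v
  proof -
    have "r\<^sup>* `` {u} = r\<^sup>* `` {v} \<longleftrightarrow> (u, v) \<in> r\<^sup>*"
      using sym_rtrancl[OF assms(2)] by (auto dest: symD intro: rtrancl_trans)
    then show ?thesis using assms(1)[OF that] by simp
  qed
  define k where "k l = r\<^sup>* `` {SOME u. u \<in> U \<and> lab u = l}" for l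
  have "k (lab u) = r\<^sup>* `` {u}" if "u \<in> U" for u
    using someI[of "\<lambda>v. v \<in> U \<and> lab v = lab u" u] that cls by (auto simp: k_def)
  then have "k ` lab ` U = U // r\<^sup>*" "inj_on k (lab ` U)"
    using cls by (auto simp: quotient_def image_iff inj_on_def)
  then show ?thesis by (metis card_image)
qed

lemma num_components_comp_state:
  assumes "closes_from 0 S" "list_all crossless S"
  shows "snd (comp_state S ((=), 0)) = int (num_components S)"
proof -
  obtain lab where "comp_labelling S lab"
    using comp_labelling_exists assms by (auto simp: closes_from_iff)
  then show ?thesis
    using card_quotient_kernel[of "nodes S" lab "adjacent S", OF _ sym_adjacent]
    by (simp add: comp_labelling_def num_components_def)
qed

lemma smoothings_closed:
  "closes_from w D \<Longrightarrow> (m, S) \<in> set (smoothings D) \<Longrightarrow> closes_from w S \<and> list_all crossless S"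
proof (induction D arbitrary: w m S rule: smoothings.induct)
  case (4 b p D)
  then have "p + 2 \<le> w" by simp
  \<comment> \<open>The smoothing by a cap and a cup comes back to the width \<open>w\<close>; the
    truncated subtraction is exact.\<close>
  then have "Suc (Suc (w - 2)) = w" by arith
  then show ?case using 4 by fastforce
qed auto

context path_model begin

lemma word_act_crossless:
  assumes "closes_from 0 S" "list_all crossless S" "\<psi> \<in> space"
  shows "word_act S \<psi> = (\<lambda>h. (- (A powi 2) - A powi (-2)) ^ num_components S * \<psi> h)"
proof -
  obtain k where k: "evaluates S k" using closed_evaluates assms by blast
  have "equivp ((=) :: nat \<Rightarrow> nat \<Rightarrow> bool)" by (rule identity_equivp)
  then have "int (num_components S) = int k"
    using k num_components_comp_state[OF assms(1,2)] by (simp add: evaluates_def)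
  moreover have "- (A powi 2) - A powi (-2) = - of_real (qint 2)" using A_loop by (simp add: algebra_simps)
  ultimately show ?thesis using k assms(3) by (simp add: evaluates_def)
qed

lemma word_act_smoothings:
  "\<psi> \<in> space \<Longrightarrow> word_act D \<psi> h = (\<Sum>(m, S)\<leftarrow>smoothings D. A powi m * word_act S \<psi> h)"
proof (induction D arbitrary: \<psi> rule: smoothings.induct)
  case (2 p D)
  then show ?case by (simp add: o_def case_prod_unfold)
next
  case (3 p D)
  then show ?case by (simp add: o_def case_prod_unfold)
next
  case (4 b p D)
  have "word_act (Crossing b p # D) \<psi> = (\<lambda>h. crs_coeff b * word_act D \<psi> h + crs_coeff (\<not> b) * word_act D (cup p (cap p \<psi>)) h)"
    unfolding word_act_simps slice_act.simps(3) by (rule lin_onD[OF lin_on_word_act]) (use 4 in simp_all)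
  moreover have "crs_coeff b * A powi m = A powi (m + (if b then 1 else - 1))" for m
    by (cases b) (simp_all add: crs_coeff_def power_int_add power_int_diff field_simps)
  moreover have "crs_coeff (\<not> b) * A powi m = A powi (m + (if b then - 1 else 1))" for m
    by (cases b) (simp_all add: crs_coeff_def power_int_add power_int_diff field_simps)
  ultimately show ?case
    using 4 by (simp add: o_def case_prod_unfold sum_list_const_mult[symmetric] mult.assoc[symmetric])
qed simp

theorem word_act_kauffman:
  assumes "closes_from 0 D" "\<psi> \<in> space"
  shows "word_act D \<psi> h = kauffman_bracket A D * \<psi> h"
proof -
  have "word_act D \<psi> h = (\<Sum>(m, S)\<leftarrow>smoothings D. A powi m * (- (A powi 2) - A powi (-2)) ^ num_components S * \<psi> h)"
    by (subst word_act_smoothings[OF assms(2)], intro arg_cong[where f = sum_list] map_cong refl)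
      (use smoothings_closed[OF assms(1)] word_act_crossless assms(2) in \<open>auto split: prod.splits\<close>)
  then show ?thesis
    by (simp add: kauffman_bracket_def case_prod_unfold sum_list_mult_const[symmetric])
qed

end

section \<open>Cablings with coupons\<close>

definition line :: "nat \<Rightarrow> nat \<Rightarrow> node list" where
  "line j w = map (Pair j) [0..<w]"

text \<open>The position of strand \<open>q\<close> inside the cabled line, called \<open>P\<close>
  in \<open>cable_from\<close>.\<close>

definition off :: "(node \<Rightarrow> nat) \<Rightarrow> nat \<Rightarrow> nat \<Rightarrow> nat" where
  "off wd j q = (\<Sum>i<q. wd (j, i))"

text \<open>A labelling carried along the strands of a slice. \<open>R\<close> relates the two legs
  of a turn: it will be equality for widths and components, inequality for orientations, and
  \<open>opposite\<close> for both at once.\<close>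

fun cons_slice :: "('l \<Rightarrow> 'l \<Rightarrow> bool) \<Rightarrow> (node \<Rightarrow> 'l) \<Rightarrow> nat \<Rightarrow> nat \<Rightarrow> slice \<Rightarrow> bool" where
  "cons_slice R f j w (Cup p) \<longleftrightarrow> p \<le> w \<and> (\<forall>q<w. f (Suc j, skip_pair p q) = f (j, q)) \<and>
     R (f (Suc j, p)) (f (Suc j, Suc p))"
| "cons_slice R f j w (Cap p) \<longleftrightarrow> p + 2 \<le> w \<and> (\<forall>q. q + 2 < w \<longrightarrow> f (Suc j, q) = f (j, skip_pair p q)) \<and>
     R (f (j, p)) (f (j, Suc p))"
| "cons_slice R f j w (Crossing b p) \<longleftrightarrow> p + 2 \<le> w \<and> f (Suc j, p) = f (j, Suc p) \<and> f (Suc j, Suc p) = f (j, p) \<and>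
     (\<forall>q<w. q \<noteq> p \<longrightarrow> q \<noteq> Suc p \<longrightarrow> f (Suc j, q) = f (j, q))"

fun cons_word :: "('l \<Rightarrow> 'l \<Rightarrow> bool) \<Rightarrow> (node \<Rightarrow> 'l) \<Rightarrow> nat \<Rightarrow> nat \<Rightarrow> slice list \<Rightarrow> bool" where
  "cons_word R f j w [] \<longleftrightarrow> True"
| "cons_word R f j w (s # D) \<longleftrightarrow> cons_slice R f j w s \<and> cons_word R f (Suc j) (width_above w s) D"

lemma line_split: "p \<le> w \<Longrightarrow> line j w = line j p @ map (Pair j) [p..<w]"
  by (simp add: line_def flip: map_append upt_add_eq_append)
    (metis le_Suc_ex map_append plus_nat.add_0 upt_add_eq_append zero_le)

lemma line_split_2: "p + 2 \<le> w \<Longrightarrow> line j w = line j p @ [(j, p), (j, Suc p)] @ map (Pair j) [p + 2..<w]"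
  using line_split[of p w j] by (simp add: upt_conv_Cons)

lemma sum_list_line: "sum_list (map wd (line j p)) = off wd j p"
  by (simp add: line_def off_def comp_def interv_sum_list_conv_sum_set_nat atLeast0LessThan)

lemma off_Suc [simp]: "off wd j (Suc q) = off wd j q + wd (j, q)"
  by (simp add: off_def)

lemma off_mono: "q \<le> p \<Longrightarrow> off wd j q \<le> off wd j p"
  unfolding off_def by (rule sum_mono2) auto

lemma off_mono_Suc: "q < p \<Longrightarrow> off wd j q + wd (j, q) \<le> off wd j p"
  using off_mono[of "Suc q" p wd j] by simp

lemma off_Cup_left:
  assumes "cons_slice R wd j w (Cup p)" "q \<le> p"
  shows "off wd (Suc j) q = off wd j q"
  unfolding off_def
proof (rule sum.cong[OF refl])
  fix i assume "i \<in> {..<q}"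
  then have "i < w" "skip_pair p i = i" using assms by (auto simp: skip_pair_def)
  then show "wd (Suc j, i) = wd (j, i)" using assms(1) by (metis cons_slice.simps(1))
qed

lemma off_Cup_right:
  assumes "cons_slice (=) wd j w (Cup p)" "p \<le> q" "q \<le> w"
  shows "off wd (Suc j) (q + 2) = off wd j q + 2 * wd (Suc j, p)"
  using assms(2,3)
proof (induction q rule: dec_induct)
  case base
  then show ?case using assms(1) off_Cup_left[OF assms(1), of p] by simp
next
  case (step n)
  have "wd (Suc j, skip_pair p n) = wd (j, n)" using assms(1) step by simp
  then have "wd (Suc j, n + 2) = wd (j, n)" using step by (simp add: skip_pair_def)
  then show ?case using step by simp
qed

lemma off_Cap_left:
  assumes "cons_slice R wd j w (Cap p)" "q \<le> p"
  shows "off wd (Suc j) q = off wd j q"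
  unfolding off_def
proof (rule sum.cong[OF refl])
  fix i assume "i \<in> {..<q}"
  then have "i + 2 < w" "skip_pair p i = i" using assms by (auto simp: skip_pair_def)
  then show "wd (Suc j, i) = wd (j, i)" using assms(1) by (metis cons_slice.simps(2))
qed

lemma off_Cap_right:
  assumes "cons_slice (=) wd j w (Cap p)" "p \<le> q" "q + 2 \<le> w"
  shows "off wd j (q + 2) = off wd (Suc j) q + 2 * wd (j, p)"
  using assms(2,3)
proof (induction q rule: dec_induct)
  case base
  then show ?case using assms(1) off_Cap_left[OF assms(1), of p] by simp
next
  case (step n)
  have "wd (Suc j, n) = wd (j, skip_pair p n)" using assms(1) step by simp
  then have "wd (j, n + 2) = wd (Suc j, n)" using step by (simp add: skip_pair_def)
  then show ?case using step by simp
qed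

lemma off_Crossing_left: "cons_slice R wd j w (Crossing b p) \<Longrightarrow> q \<le> p \<Longrightarrow> off wd (Suc j) q = off wd j q"
  unfolding off_def by (rule sum.cong) auto

lemma off_Crossing_right:
  assumes "cons_slice R wd j w (Crossing b p)" "p + 2 \<le> q" "q \<le> w"
  shows "off wd (Suc j) q = off wd j q"
  using assms(2,3)
proof (induction q rule: dec_induct)
  case base
  then show ?case using assms(1) off_Crossing_left[OF assms(1), of p] by simp
qed (use assms(1) in auto)

definition swap_at :: "nat \<Rightarrow> nat \<Rightarrow> nat" where
  "swap_at p q = (if q = p then Suc p else if q = Suc p then p else q)"

lemma cons_slice_comp: "cons_slice R f j w s \<Longrightarrow> (\<And>x y. R x y \<Longrightarrow> R' (g x) (g y)) \<Longrightarrow> cons_slice R' (\<lambda>u. g (f u)) j w s"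
  by (cases s) auto

context path_model begin

text \<open>The right part acts first. All offsets are thus computed from input widths, even if the
  operators change the number of strands.\<close>

fun lop :: "(nat \<times> family) list \<Rightarrow> family" where
  "lop [] = fam_id"
| "lop (x # xs) = fam_comp (snd x) (fam_at (lop xs) (fst x))"

definition ents :: "('a \<Rightarrow> nat) \<Rightarrow> ('a \<Rightarrow> family) \<Rightarrow> 'a list \<Rightarrow> (nat \<times> family) list" where
  "ents wd X us = map (\<lambda>u. (wd u, X u)) us"

abbreviation lops :: "('a \<Rightarrow> nat) \<Rightarrow> ('a \<Rightarrow> family) \<Rightarrow> 'a list \<Rightarrow> family" where
  "lops wd X us \<equiv> lop (ents wd X us)"

lemma lops_Nil [simp]: "lops wd X [] P \<psi> = \<psi>"
  and lops_Cons [simp]: "lops wd X (u # us) P \<psi> = X u P (lops wd X us (P + wd u) \<psi>)"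
  by (simp_all add: ents_def fam_simps)

lemma lops_append: "lops wd X (us @ vs) P \<psi> = lops wd X us P (lops wd X vs (P + sum_list (map wd us)) \<psi>)"
  by (induction us arbitrary: P) (simp_all add: add.assoc)

lemma mor1_tensor: "mor1 a b f \<Longrightarrow> mor1 c d g \<Longrightarrow> mor1 (a + c) (b + d) (fam_comp f (fam_at g a))"
  unfolding mor1_def by (auto intro: mor_tensor)

lemma mor1_lops:
  "(\<And>u. u \<in> set us \<Longrightarrow> mor1 (wd u) (wd' u) (X u)) \<Longrightarrow>
    mor1 (sum_list (map wd us)) (sum_list (map wd' us)) (lops wd X us)"
proof (induction us)
  case Nil
  then show ?case by (simp add: ents_def mor1_id)
next
  case (Cons u us)
  have "mor1 (wd u + sum_list (map wd us)) (wd' u + sum_list (map wd' us)) (fam_comp (X u) (fam_at (lops wd X us) (wd u)))"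
    by (rule mor1_tensor) (use Cons in auto)
  then show ?case by (simp add: ents_def)
qed

text \<open>Each lower coupon slides past the part of the upper row to its right and meets the upper
  coupon of its own strand.\<close>

lemma lops_comp:
  assumes "\<And>u. u \<in> set us \<Longrightarrow> mor1 (wd u) (wd' u) (X u)" "\<And>u. u \<in> set us \<Longrightarrow> mor1 (wd' u) (wd'' u) (Y u)"
    and \<psi>: "\<psi> \<in> space"
  shows "lops wd' Y us P (lops wd X us P \<psi>) = lops wd (\<lambda>u. fam_comp (Y u) (X u)) us P \<psi>"
  using assms(1,2)
proof (induction us arbitrary: P)
  case (Cons u us)
  let ?\<phi> = "lops wd X us (P + wd u) \<psi>"
  have mX: "mor1 (sum_list (map wd us)) (sum_list (map wd' us)) (lops wd X us)"
    and mY: "mor1 (sum_list (map wd' us)) (sum_list (map wd'' us)) (lops wd' Y us)"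
    by (rule mor1_lops, use Cons.prems in auto)+
  have "X u P (lops wd' Y us (P + wd u) ?\<phi>) = lops wd' Y us (P + wd' u) (X u P ?\<phi>)"
    using interchange1[OF _ mY mor1_space[OF mX \<psi>], of "wd u" "wd' u" "X u" P "P + wd u"] Cons.prems by simp
  moreover have "lops wd' Y us (P + wd u) ?\<phi> = lops wd (\<lambda>u. fam_comp (Y u) (X u)) us (P + wd u) \<psi>"
    using Cons by simp
  moreover have c: "fam_comp (Y u) (X u) P \<phi> = Y u P (X u P \<phi>)" for \<phi>
    by (rule fam_simps(3))
  ultimately show ?case unfolding lops_Cons c by (simp only:)
qed simp

lemma lops_cong:
  assumes "\<And>u. u \<in> set us \<Longrightarrow> fam_eq (X u) (Y u)" "\<And>u. u \<in> set us \<Longrightarrow> mor1 (wd u) (wd' u) (Y u)" "\<psi> \<in> space"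
  shows "lops wd X us P \<psi> = lops wd Y us P \<psi>"
  using assms(1,2)
proof (induction us arbitrary: P)
  case (Cons u us)
  have "mor1 (sum_list (map wd us)) (sum_list (map wd' us)) (lops wd Y us)"
    by (rule mor1_lops) (use Cons.prems in auto)
  from mor1_space[OF this assms(3)] show ?case using Cons by (simp add: fam_eqD)
qed simp

lemma lops_id: "(\<And>u. u \<in> set us \<Longrightarrow> X u = fam_id) \<Longrightarrow> lops wd X us P \<psi> = \<psi>"
  by (induction us arbitrary: P) (auto simp: fam_simps)

definition ln :: "(node \<Rightarrow> nat) \<Rightarrow> (node \<Rightarrow> family) \<Rightarrow> nat \<Rightarrow> nat \<Rightarrow> vec \<Rightarrow> vec" where
  "ln wd X j w = lops wd X (line j w) 0"

fun sop :: "(node \<Rightarrow> nat) \<Rightarrow> nat \<Rightarrow> slice \<Rightarrow> vec \<Rightarrow> vec" where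
  "sop wd j (Cup p) = cups (wd (Suc j, p)) (off wd j p)"
| "sop wd j (Cap p) = caps (wd (j, p)) (off wd j p)"
| "sop wd j (Crossing b p) = cross b (wd (j, p)) (wd (j, Suc p)) (off wd j p)"

text \<open>The state sum of a cabled diagram with the coupon \<open>X u\<close> inserted at every node \<open>u\<close>.\<close>

fun ev :: "(node \<Rightarrow> nat) \<Rightarrow> (node \<Rightarrow> family) \<Rightarrow> nat \<Rightarrow> nat \<Rightarrow> slice list \<Rightarrow> vec \<Rightarrow> vec" where
  "ev wd X j w [] \<psi> = ln wd X j w \<psi>"
| "ev wd X j w (s # D) \<psi> = ev wd X (Suc j) (width_above w s) D (sop wd j s (ln wd X j w \<psi>))"

lemma word_act_cable: "word_act (cable_from j \<mu> D) \<psi> = ev \<mu> (\<lambda>u. fam_id) j w D \<psi>"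
proof (induction D arbitrary: j w \<psi>)
  case Nil
  then show ?case by (simp add: ln_def lops_id)
next
  case (Cons s D)
  then show ?case
    by (cases s) (simp_all add: ln_def lops_id Let_def cups_def caps_def cross_def off_def add.assoc)
qed

lemma ln_space:
  assumes "\<And>u. mor1 (wd u) (wd' u) (X u)" "\<psi> \<in> space"
  shows "ln wd X j w \<psi> \<in> space"
  unfolding ln_def by (rule mor1_space[OF mor1_lops assms(2)]) (rule assms(1))

lemma sop_space [simp]: "\<psi> \<in> space \<Longrightarrow> sop wd j s \<psi> \<in> space"
  by (cases s) auto

lemma fam_comp_id [simp]: "fam_comp f fam_id = f" "fam_comp fam_id f = f"
  by (simp_all add: fam_unfold)

lemma ln_single:
  assumes "q < w"
  shows "ln wd ((\<lambda>u. fam_id)((j, q) := y)) j w \<psi> = y (off wd j q) \<psi>"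
proof -
  have "line j w = line j q @ (j, q) # map (Pair j) [Suc q..<w]"
    using line_split[of q w j] assms by (simp add: upt_conv_Cons)
  moreover have "lops wd ((\<lambda>u. fam_id)((j, q) := y)) (line j q) P \<phi> = \<phi>"
    "lops wd ((\<lambda>u. fam_id)((j, q) := y)) (map (Pair j) [Suc q..<w]) P \<phi> = \<phi>" for P \<phi>
    by (rule lops_id, auto simp: line_def)+
  ultimately show ?thesis
    unfolding ln_def by (simp add: lops_append sum_list_line)
qed

lemma ln_update_in:
  assumes "\<And>u. mor1 (wd u) (wd u) (X u)" "mor1 (wd (j, q)) (wd (j, q)) y" "\<psi> \<in> space" "q < w"
  shows "ln wd (X((j, q) := fam_comp (X (j, q)) y)) j w \<psi> = ln wd X j w (y (off wd j q) \<psi>)"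
proof -
  let ?Y = "(\<lambda>u. fam_id)((j, q) := y)"
  have "ln wd X j w (ln wd ?Y j w \<psi>) = lops wd (\<lambda>u. fam_comp (X u) (?Y u)) (line j w) 0 \<psi>"
    unfolding ln_def by (rule lops_comp[where wd'' = wd]) (use assms in \<open>auto simp: mor1_id\<close>)
  moreover have "(\<lambda>u. fam_comp (X u) (?Y u)) = X((j, q) := fam_comp (X (j, q)) y)" by auto
  ultimately show ?thesis unfolding ln_single[OF assms(4)] by (simp add: ln_def)
qed

lemma ln_update_out:
  assumes "\<And>u. mor1 (wd u) (wd u) (X u)" "mor1 (wd (j, q)) (wd (j, q)) y" "\<psi> \<in> space" "q < w"
  shows "ln wd (X((j, q) := fam_comp y (X (j, q)))) j w \<psi> = y (off wd j q) (ln wd X j w \<psi>)"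
proof -
  let ?Y = "(\<lambda>u. fam_id)((j, q) := y)"
  have "ln wd ?Y j w (ln wd X j w \<psi>) = lops wd (\<lambda>u. fam_comp (?Y u) (X u)) (line j w) 0 \<psi>"
    unfolding ln_def by (rule lops_comp[where wd'' = wd]) (use assms in \<open>auto simp: mor1_id\<close>)
  moreover have "(\<lambda>u. fam_comp (?Y u) (X u)) = X((j, q) := fam_comp y (X (j, q)))" by auto
  ultimately show ?thesis unfolding ln_single[OF assms(4)] by (simp add: ln_def)
qed

lemma ln_cong:
  assumes "\<And>u. fam_eq (X u) (Y u)" "\<And>u. mor1 (wd u) (wd' u) (Y u)" "\<psi> \<in> space"
  shows "ln wd X j w \<psi> = ln wd Y j w \<psi>"
  unfolding ln_def using assms by (intro lops_cong) auto

lemma ln_eq_level: "(\<And>q. X (j, q) = Y (j, q)) \<Longrightarrow> ln wd X j w \<psi> = ln wd Y j w \<psi>"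
proof -
  assume "\<And>q. X (j, q) = Y (j, q)"
  then have "ents wd X (line j w) = ents wd Y (line j w)" by (auto simp: ents_def line_def)
  then show ?thesis by (simp add: ln_def)
qed

lemma ev_eq_level: "(\<And>u. j \<le> fst u \<Longrightarrow> X u = Y u) \<Longrightarrow> ev wd X j w D \<psi> = ev wd Y j w D \<psi>"
proof (induction D arbitrary: j w \<psi>)
  case Nil
  show ?case unfolding ev.simps by (rule ln_eq_level) (simp add: Nil)
next
  case (Cons s D)
  have "ln wd X j w \<psi> = ln wd Y j w \<psi>" using Cons.prems by (intro ln_eq_level) auto
  then show ?case using Cons by simp
qed

lemma ev_head:
  assumes "ln wd X j w \<psi> = ln wd Y j w \<phi>" "\<And>u. j < fst u \<Longrightarrow> X u = Y u"
  shows "ev wd X j w D \<psi> = ev wd Y j w D \<phi>"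
proof (cases D)
  case (Cons s D')
  then show ?thesis using assms ev_eq_level[of "Suc j" X Y] by simp
qed (use assms in simp)

section \<open>Sliding a coupon through one cabled slice\<close>

lemma slide_Cup:
  assumes "cons_slice (=) wd j w (Cup p)" "mor1 (wd (j, q)) (wd (j, q)) y" "q < w" "\<psi> \<in> space"
  shows "sop wd j (Cup p) (y (off wd j q) \<psi>) = y (off wd (Suc j) (skip_pair p q)) (sop wd j (Cup p) \<psi>)"
proof (cases "q < p")
  case True
  then show ?thesis
    using interchange1[OF assms(2) mor1_cups assms(4) off_mono_Suc[OF True, of wd j]] off_mono_Suc[OF True, of wd j]
      off_Cup_left[OF assms(1), of q] by (simp add: skip_pair_def)
next
  case False
  then show ?thesis
    using interchange1[OF mor1_cups assms(2,4), of "off wd j p" "off wd j q" "wd (Suc j, p)"]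
      off_mono[of p q wd j] off_Cup_right[OF assms(1), of q] assms(3) by (simp add: skip_pair_def)
qed

lemma slide_Cap:
  assumes "cons_slice (=) wd j w (Cap p)" "mor1 (wd (Suc j, q)) (wd (Suc j, q)) y" "q + 2 < w" "\<psi> \<in> space"
  shows "sop wd j (Cap p) (y (off wd j (skip_pair p q)) \<psi>) = y (off wd (Suc j) q) (sop wd j (Cap p) \<psi>)"
proof (cases "q < p")
  case True
  then have e: "wd (Suc j, q) = wd (j, q)" using assms by (auto simp: skip_pair_def)
  then show ?thesis
    using interchange1[OF assms(2) mor1_caps assms(4), of "off wd j q" "off wd j p"] off_mono_Suc[OF True, of wd j]
      off_Cap_left[OF assms(1), of q] True by (simp add: skip_pair_def)
next
  case False
  then have "off wd j (q + 2) = off wd (Suc j) q + 2 * wd (j, p)" "off wd j p \<le> off wd (Suc j) q"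
    using off_Cap_right[OF assms(1), of q] off_Cap_left[OF assms(1), of p] off_mono[of p q wd "Suc j"] assms(3) by auto
  then show ?thesis
    using interchange1[OF mor1_caps assms(2,4), of "off wd j p" "wd (j, p)" "off wd j (q + 2)"] False
    by (simp add: skip_pair_def)
qed

lemma slide_Crossing:
  assumes "cons_slice (=) wd j w (Crossing b p)" "mor1 (wd (j, q)) (wd (j, q)) y" "q < w" "\<psi> \<in> space"
  shows "sop wd j (Crossing b p) (y (off wd j q) \<psi>) = y (off wd (Suc j) (swap_at p q)) (sop wd j (Crossing b p) \<psi>)"
proof -
  obtain y' where y': "mor (wd (j, q)) (wd (j, q)) y y'" using assms(2) by (auto simp: mor1_def)
  have pp: "off wd (Suc j) p = off wd j p" "wd (Suc j, p) = wd (j, Suc p)"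
    using off_Crossing_left[OF assms(1), of p] assms(1) by auto
  consider "q < p" | "q = p" | "q = Suc p" | "p + 2 \<le> q" by linarith
  then show ?thesis
  proof cases
    case 1
    then show ?thesis
      using interchange1[OF assms(2) mor1_cross assms(4) off_mono_Suc[OF 1, of wd j]] off_mono_Suc[OF 1, of wd j]
        off_Crossing_left[OF assms(1), of q] by (simp add: swap_at_def)
  next
    case 2
    then show ?thesis
      using cross_left_slide[OF y' assms(4), of b "wd (j, Suc p)" "off wd j p"] pp by (simp add: swap_at_def)
  next
    case 3
    then show ?thesis
      using cross_right_slide[OF y' assms(4), of b "wd (j, p)" "off wd j p"] pp by (simp add: swap_at_def)
  next
    case 4
    then have "off wd j p + (wd (j, p) + wd (j, Suc p)) \<le> off wd j q"
      using off_mono[of "p + 2" q wd j] by simp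
    then show ?thesis
      using interchange1[OF mor1_cross assms(2,4), of "off wd j p" "wd (j, p)" "wd (j, Suc p)" "off wd j q" b]
        off_Crossing_right[OF assms(1) 4] assms(3) 4 by (simp add: swap_at_def)
  qed
qed

lemma slide_Cup_legs:
  assumes "cons_slice (=) wd j w (Cup p)" "mor (wd (Suc j, p)) (wd (Suc j, p)) y y'" "\<psi> \<in> space"
  shows "y (off wd (Suc j) p) (sop wd j (Cup p) \<psi>) = y' (off wd (Suc j) (Suc p)) (sop wd j (Cup p) \<psi>)"
  using cups_slide[OF assms(2,3), of "off wd j p"] off_Cup_left[OF assms(1), of p] by simp

lemma slide_Cap_legs:
  assumes "mor (wd (j, p)) (wd (j, p)) y y'" "\<psi> \<in> space"
  shows "sop wd j (Cap p) (y (off wd j p) \<psi>) = sop wd j (Cap p) (y' (off wd j (Suc p)) \<psi>)"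
  using caps_slide[OF assms, of "off wd j p"] by simp

end

section \<open>Spreading an idempotent along a component\<close>

lemma slice_edges_Crossing:
  assumes "p + 2 \<le> w"
  shows "slice_edges j w (Crossing b p) = {((j, q), (Suc j, swap_at p q)) | q. q < w}"
proof -
  have "slice_edges j w (Crossing b p) = {((j, p), (Suc j, Suc p)), ((j, Suc p), (Suc j, p))} \<union>
      {((j, q), (Suc j, q)) | q. q < w \<and> q \<noteq> p \<and> q \<noteq> Suc p}"
    by (simp add: slice_edges_image image_Un setcompr_eq_image image_image through_arc_def insert_commute)
  also have "\<dots> = (\<lambda>q. ((j, q), (Suc j, swap_at p q))) ` ({p, Suc p} \<union> {q. q < w \<and> q \<noteq> p \<and> q \<noteq> Suc p})"
    unfolding image_Un setcompr_eq_image
    by (intro arg_cong2[where f = "(\<union>)"] image_cong refl) (auto simp: swap_at_def)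
  also have "{p, Suc p} \<union> {q. q < w \<and> q \<noteq> p \<and> q \<noteq> Suc p} = {q. q < w}" using assms by auto
  finally show ?thesis by (simp add: setcompr_eq_image)
qed

lemma slice_edgesI: "(u, m, v) \<in> slice_arcs j w s \<Longrightarrow> (u, v) \<in> slice_edges j w s"
  unfolding slice_edges_def by blast

lemma slice_edges_level: "(u, v) \<in> slice_edges j w s \<Longrightarrow> j \<le> fst u \<and> j \<le> fst v"
  by (cases s) (auto simp: slice_edges_def through_arc_def)

lemma arcs_from_level: "(u, m, v) \<in> arcs_from j w D \<Longrightarrow> j \<le> fst u \<and> j \<le> fst v"
proof (induction D arbitrary: j w)
  case (Cons s D)
  then consider "(u, v) \<in> slice_edges j w s" | "(u, m, v) \<in> arcs_from (Suc j) (width_above w s) D"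
    by (metis UnE arcs_from.simps(2) slice_edgesI)
  then show ?case
  proof cases
    case 2
    then show ?thesis using Cons.IH by fastforce
  qed (rule slice_edges_level)
qed simp

text \<open>The nodes met by \<open>ev\<close>. For a link diagram they are exactly
  \<open>nodes D\<close>, by \<open>lines_subset_nodes\<close> and
  \<open>edges_lines\<close>.\<close>

fun lines :: "nat \<Rightarrow> nat \<Rightarrow> slice list \<Rightarrow> node set" where
  "lines j w [] = set (line j w)"
| "lines j w (s # D) = set (line j w) \<union> lines (Suc j) (width_above w s) D"

lemma in_line [simp]: "u \<in> set (line j w) \<longleftrightarrow> fst u = j \<and> snd u < w"
  by (cases u) (auto simp: line_def)

lemma lines_nodes:
  assumes "closes_from w D" "u \<in> lines j w D"
  shows "\<exists>m v. (u, m, v) \<in> arcs_from j w D \<or> (v, m, u) \<in> arcs_from j w D"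
  using assms
proof (induction D arbitrary: j w)
  case (Cons s D)
  show ?case
  proof (cases "u \<in> lines (Suc j) (width_above w s) D")
    case True
    then have "\<exists>m v. (u, m, v) \<in> arcs_from (Suc j) (width_above w s) D \<or> (v, m, u) \<in> arcs_from (Suc j) (width_above w s) D"
      using Cons.IH[of "width_above w s" "Suc j"] Cons.prems by simp
    then show ?thesis unfolding arcs_from.simps by blast
  next
    case False
    then have "u \<in> set (line j w)" using Cons.prems by simp
    then obtain q where q: "u = (j, q)" "q < w" by (metis in_line prod.collapse)
    have "\<exists>v. (u, v) \<in> slice_edges j w s \<or> (v, u) \<in> slice_edges j w s"
    proof (cases s)
      case (Cup p)
      then have "p \<le> w" using Cons.prems by simp
      then show ?thesis using q Cup slice_edges_Cup[of p w j] by blast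
    next
      case (Cap p)
      then have p: "p + 2 \<le> w" using Cons.prems by simp
      have "q = p \<or> q = Suc p \<or> q = skip_pair p (drop_pair p q) \<and> drop_pair p q + 2 < w"
        using q p by (auto simp: skip_pair_def drop_pair_def)
      then show ?thesis using q Cap slice_edges_Cap[OF p, of j] by blast
    next
      case (Crossing b p)
      then have p: "p + 2 \<le> w" using Cons.prems by simp
      then show ?thesis using q Crossing slice_edges_Crossing[OF p, of j b] by blast
    qed
    then show ?thesis unfolding arcs_from.simps slice_edges_def by blast
  qed
qed simp

lemma lines_subset_nodes: "link_diagram D \<Longrightarrow> lines 0 0 D \<subseteq> nodes D"
  using lines_nodes[of 0 D _ 0] unfolding link_diagram_def nodes_def Field_def adjacent_def arcs_def by blast

lemma edges_lines:
  assumes "closes_from w D" "(u, m, v) \<in> arcs_from j w D"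
  shows "u \<in> lines j w D \<and> v \<in> lines j w D"
  using assms
proof (induction D arbitrary: j w)
  case (Cons s D)
  have top: "set (line (Suc j) (width_above w s)) \<subseteq> lines (Suc j) (width_above w s) D"
    by (cases D) auto
  show ?case
  proof (cases "(u, m, v) \<in> slice_arcs j w s")
    case True
    then have uv: "(u, v) \<in> slice_edges j w s" by (rule slice_edgesI)
    have "u \<in> set (line j w) \<union> set (line (Suc j) (width_above w s)) \<and> v \<in> set (line j w) \<union> set (line (Suc j) (width_above w s))"
    proof (cases s)
      case (Cup p)
      then have p: "p \<le> w" using Cons.prems by simp
      then show ?thesis using uv unfolding Cup slice_edges_Cup[OF p] by (auto simp: skip_pair_def split: if_splits)
    next
      case (Cap p)
      then have p: "p + 2 \<le> w" using Cons.prems by simp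
      then show ?thesis using uv unfolding Cap slice_edges_Cap[OF p] by (auto simp: skip_pair_def split: if_splits)
    next
      case (Crossing b p)
      then have p: "p + 2 \<le> w" using Cons.prems by simp
      then show ?thesis using uv unfolding Crossing slice_edges_Crossing[OF p] by (auto simp: swap_at_def split: if_splits)
    qed
    then show ?thesis using top by auto
  next
    case False
    then show ?thesis using Cons by auto
  qed
qed simp

definition coupons :: "(node \<Rightarrow> 'l) \<Rightarrow> ('l \<Rightarrow> 'a) \<Rightarrow> ('l \<Rightarrow> 'a) \<Rightarrow> node set \<Rightarrow> node \<Rightarrow> 'a" where
  "coupons lab F G S u = (if u \<in> S then G (lab u) else F (lab u))"

context path_model begin

lemma ln_eq_line: "(\<And>u. u \<in> set (line j w) \<Longrightarrow> X u = Y u) \<Longrightarrow> ln wd X j w \<psi> = ln wd Y j w \<psi>"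
proof -
  assume "\<And>u. u \<in> set (line j w) \<Longrightarrow> X u = Y u"
  then have "ents wd X (line j w) = ents wd Y (line j w)" unfolding ents_def by (intro map_cong) auto
  then show ?thesis by (simp add: ln_def)
qed

lemma ev_eq_lines: "(\<And>u. u \<in> lines j w D \<Longrightarrow> X u = Y u) \<Longrightarrow> ev wd X j w D \<psi> = ev wd Y j w D \<psi>"
proof (induction D arbitrary: j w \<psi>)
  case Nil
  show ?case unfolding ev.simps by (rule ln_eq_line) (simp add: Nil)
next
  case (Cons s D)
  have "ln wd X j w \<psi> = ln wd Y j w \<psi>" by (rule ln_eq_line) (simp add: Cons.prems)
  then show ?case using Cons by simp
qed

lemma lin_on_compose: "lin_on T \<Longrightarrow> lin_on U \<Longrightarrow> (\<And>\<psi>. \<psi> \<in> space \<Longrightarrow> T \<psi> \<in> space) \<Longrightarrow> lin_on (\<lambda>\<psi>. U (T \<psi>))"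
  unfolding lin_on_def by simp

lemma lin_on_ln: "(\<And>u. mor1 (wd u) (wd u) (X u)) \<Longrightarrow> lin_on (ln wd X j w)"
  unfolding ln_def by (rule mor1_lin_on[OF mor1_lops]) auto

lemma lin_on_sop: "lin_on (sop wd j s)"
  by (cases s) (auto intro: mor1_lin_on[OF mor1_cups] mor1_lin_on[OF mor1_caps] mor1_lin_on[OF mor1_cross])

lemma lin_on_ev:
  assumes "\<And>u. mor1 (wd u) (wd u) (X u)"
  shows "lin_on (ev wd X j w D)"
proof (induction D arbitrary: j w)
  case Nil
  then show ?case using lin_on_ln[OF assms] by (simp add: lin_on_def)
next
  case (Cons s D)
  have "lin_on (\<lambda>\<psi>. ev wd X (Suc j) (width_above w s) D (sop wd j s (ln wd X j w \<psi>)))"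
  proof (rule lin_on_compose[OF _ Cons])
    show "lin_on (\<lambda>\<psi>. sop wd j s (ln wd X j w \<psi>))"
      by (rule lin_on_compose[OF lin_on_ln[OF assms] lin_on_sop]) (rule ln_space[OF assms])
  qed (use ln_space[OF assms] in simp)
  then show ?case by (simp add: lin_on_def)
qed

text \<open>Only the line through \<open>u0\<close> sees the change; whatever lies above and below
  it is one common linear operator.\<close>

lemma ev_split:
  assumes X: "\<And>u. mor1 (wd u) (wd u) (X u)" and YZ: "\<And>u. mor1 (wd u) (wd u) (Y u)" "\<And>u. mor1 (wd u) (wd u) (Z u)"
    and agree: "\<And>u. u \<noteq> u0 \<Longrightarrow> Y u = X u" "\<And>u. u \<noteq> u0 \<Longrightarrow> Z u = X u"
    and split: "\<And>p \<psi>. \<psi> \<in> space \<Longrightarrow> X u0 p \<psi> = (\<lambda>h. Y u0 p \<psi> h + Z u0 p \<psi> h)"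
    and "u0 \<in> lines j w D" "\<psi> \<in> space"
  shows "ev wd X j w D \<psi> = (\<lambda>h. ev wd Y j w D \<psi> h + ev wd Z j w D \<psi> h)"
proof -
  have lns: "ln wd X j w \<psi> = (\<lambda>h. ln wd Y j w \<psi> h + ln wd Z j w \<psi> h)"
    if "u0 \<in> set (line j w)" "\<psi> \<in> space" for j w \<psi>
  proof -
    obtain q where q: "u0 = (j, q)" "q < w" using \<open>u0 \<in> set (line j w)\<close> by (metis in_line prod.collapse)
    have line: "line j w = line j q @ u0 # map (Pair j) [Suc q..<w]"
      using line_split[of q w j] q by (simp add: upt_conv_Cons)
    define P where "P = sum_list (map wd (line j q))"
    define \<phi> where "\<phi> = lops wd X (map (Pair j) [Suc q..<w]) (P + wd u0) \<psi>"
    have \<phi>: "\<phi> \<in> space" unfolding \<phi>_def by (rule mor1_space[OF mor1_lops that(2)]) (rule X)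
    have form: "ln wd W j w \<psi> = lops wd X (line j q) 0 (W u0 P \<phi>)" if W: "\<And>u. u \<noteq> u0 \<Longrightarrow> W u = X u" for W
    proof -
      have "ents wd W (line j q) = ents wd X (line j q)"
        "ents wd W (map (Pair j) [Suc q..<w]) = ents wd X (map (Pair j) [Suc q..<w])"
        using W q by (auto simp: ents_def line_def)
      then show ?thesis unfolding ln_def line lops_append lops_Cons by (simp add: P_def \<phi>_def)
    qed
    have L: "lin_on (lops wd X (line j q) 0)" by (rule mor1_lin_on[OF mor1_lops]) (rule X)
    have "lops wd X (line j q) 0 (\<lambda>h. 1 * Y u0 P \<phi> h + 1 * Z u0 P \<phi> h) =
        (\<lambda>h. 1 * lops wd X (line j q) 0 (Y u0 P \<phi>) h + 1 * lops wd X (line j q) 0 (Z u0 P \<phi>) h)"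
      by (rule lin_onD[OF L mor1_space[OF YZ(1) \<phi>] mor1_space[OF YZ(2) \<phi>]])
    moreover have "ln wd X j w \<psi> = lops wd X (line j q) 0 (X u0 P \<phi>)" by (rule form) (rule refl)
    moreover have "ln wd Y j w \<psi> = lops wd X (line j q) 0 (Y u0 P \<phi>)" by (rule form) (rule agree)
    moreover have "ln wd Z j w \<psi> = lops wd X (line j q) 0 (Z u0 P \<phi>)" by (rule form) (rule agree)
    ultimately show ?thesis using split[OF \<phi>, of P] by simp
  qed
  show ?thesis
    using assms(7,8)
  proof (induction D arbitrary: j w \<psi>)
    case Nil
    then show ?case using lns by simp
  next
    case (Cons s D)
    show ?case
    proof (cases "u0 \<in> set (line j w)")
      case True
      have sp: "ln wd Y j w \<psi> \<in> space" "ln wd Z j w \<psi> \<in> space" using ln_space YZ Cons.prems by blast+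
      let ?e = "\<lambda>X. ev wd X (Suc j) (width_above w s) D"
      have eq: "?e Y \<phi> = ?e X \<phi>" "?e Z \<phi> = ?e X \<phi>" for \<phi>
      proof -
        have "Y u = X u" "Z u = X u" if "Suc j \<le> fst u" for u
          using agree True that by (metis Suc_n_not_le_n in_line)+
        then show "?e Y \<phi> = ?e X \<phi>" "?e Z \<phi> = ?e X \<phi>"
          by (auto intro: ev_eq_level)
      qed
      have "lin_on (\<lambda>\<phi>. ?e X (sop wd j s \<phi>))"
        by (rule lin_on_compose[OF lin_on_sop lin_on_ev[OF X]]) simp
      then have "?e X (sop wd j s (\<lambda>h. 1 * ln wd Y j w \<psi> h + 1 * ln wd Z j w \<psi> h)) =
          (\<lambda>h. 1 * ?e X (sop wd j s (ln wd Y j w \<psi>)) h + 1 * ?e X (sop wd j s (ln wd Z j w \<psi>)) h)"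
        by (rule lin_onD[OF _ sp])
      then show ?thesis
        unfolding ev.simps lns[OF True Cons.prems(2)] eq by simp
    next
      case False
      have "ln wd Y j w \<psi> = ln wd X j w \<psi>" "ln wd Z j w \<psi> = ln wd X j w \<psi>"
        using False agree by (intro ln_eq_line; metis)+
      moreover have "ln wd X j w \<psi> \<in> space" by (rule ln_space[OF X Cons.prems(2)])
      moreover have "u0 \<in> lines (Suc j) (width_above w s) D" using Cons.prems(1) False by auto
      ultimately show ?thesis using Cons.IH by simp
    qed
  qed
qed

text \<open>\<open>F\<close> is the coupon present from the start and \<open>G\<close> an idempotent
  that absorbs it on both sides. By \<open>dual\<close> the two legs of a turn carry rotated copies
  of \<open>G\<close>, which lets \<open>G\<close> travel around turns.\<close>

context
  fixes lab :: "node \<Rightarrow> 'l" and opp :: "'l \<Rightarrow> 'l \<Rightarrow> bool" and wl :: "'l \<Rightarrow> nat" and F G :: "'l \<Rightarrow> family"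
  assumes opp_width: "\<And>x y. opp x y \<Longrightarrow> wl x = wl y"
    and mF: "\<And>x. mor1 (wl x) (wl x) (F x)" and mG: "\<And>x. mor1 (wl x) (wl x) (G x)"
    and dual: "\<And>x y. opp x y \<Longrightarrow> mor (wl x) (wl x) (G x) (G y)"
    and GG: "\<And>x. fam_eq (fam_comp (G x) (G x)) (G x)"
    and GF: "\<And>x. fam_eq (fam_comp (G x) (F x)) (G x)"
    and FG: "\<And>x. fam_eq (fam_comp (F x) (G x)) (G x)"
begin

abbreviation (input) wdl :: "node \<Rightarrow> nat" where "wdl u \<equiv> wl (lab u)"

abbreviation (input) coup :: "node set \<Rightarrow> node \<Rightarrow> family" where "coup \<equiv> coupons lab F G"

lemma mor1_coup: "mor1 (wdl u) (wdl u) (coup S u)"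
  by (simp add: coupons_def mF mG)

lemma fam_eq_sym: "fam_eq f g \<Longrightarrow> fam_eq g f"
  by (simp add: fam_eq_def)

lemma fam_eq_refl: "fam_eq f f"
  by (simp add: fam_eq_def)

lemma coup_in:
  assumes "\<psi> \<in> space" "q < w"
  shows "ln wdl (coup (insert (j, q) S)) j w \<psi> = ln wdl (coup S) j w (G (lab (j, q)) (off wdl j q) \<psi>)"
proof -
  let ?X = "(coup S)((j, q) := fam_comp (coup S (j, q)) (G (lab (j, q))))"
  have "ln wdl (coup (insert (j, q) S)) j w \<psi> = ln wdl ?X j w \<psi>"
  proof (rule ln_cong[OF _ _ assms(1)])
    show "fam_eq (coup (insert (j, q) S) u) (?X u)" for u
      using GG FG by (auto simp: coupons_def fam_eq_refl intro: fam_eq_sym)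
    show "mor1 (wdl u) (wdl u) (?X u)" for u
      by (cases "u = (j, q)") (simp_all add: mor1_coup mor1_comp[OF mG mor1_coup])
  qed
  then show ?thesis using ln_update_in[of wdl "coup S", OF mor1_coup mG assms] by simp
qed

lemma coup_out:
  assumes "\<psi> \<in> space" "q < w"
  shows "ln wdl (coup (insert (j, q) S)) j w \<psi> = G (lab (j, q)) (off wdl j q) (ln wdl (coup S) j w \<psi>)"
proof -
  let ?X = "(coup S)((j, q) := fam_comp (G (lab (j, q))) (coup S (j, q)))"
  have "ln wdl (coup (insert (j, q) S)) j w \<psi> = ln wdl ?X j w \<psi>"
  proof (rule ln_cong[OF _ _ assms(1)])
    show "fam_eq (coup (insert (j, q) S) u) (?X u)" for u
      using GG GF by (auto simp: coupons_def fam_eq_refl intro: fam_eq_sym)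
    show "mor1 (wdl u) (wdl u) (?X u)" for u
      by (cases "u = (j, q)") (simp_all add: mor1_coup mor1_comp[OF mor1_coup mG])
  qed
  then show ?thesis using ln_update_out[of wdl "coup S", OF mor1_coup mG assms] by simp
qed

lemma coup_space: "\<psi> \<in> space \<Longrightarrow> ln wdl (coup S) j w \<psi> \<in> space"
  by (rule ln_space[OF mor1_coup])

lemma coup_level: "j \<noteq> fst u \<Longrightarrow> ln wdl (coup (insert u S)) j w \<psi> = ln wdl (coup S) j w \<psi>"
  by (rule ln_eq_level) (auto simp: coupons_def)

text \<open>The set \<open>S\<close> of nodes that carry \<open>G\<close> already is arbitrary, so
  that single steps can be chained along a component.\<close>

definition spreads :: "node \<Rightarrow> node \<Rightarrow> nat \<Rightarrow> nat \<Rightarrow> slice list \<Rightarrow> bool" where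
  "spreads u v j w D \<longleftrightarrow> (\<forall>S. \<forall>\<psi>\<in>space. u \<in> S \<longrightarrow> ev wdl (coup (insert v S)) j w D \<psi> = ev wdl (coup S) j w D \<psi>)"

text \<open>The coupon at one end is doubled by idempotence, slid through the slice and absorbed at
  the other end.\<close>

lemma spreads_through:
  assumes "q < w" "q' < width_above w s" "lab (Suc j, q') = lab (j, q)"
    and slide: "\<And>\<phi>. \<phi> \<in> space \<Longrightarrow> sop wdl j s (G (lab (j, q)) (off wdl j q) \<phi>) = G (lab (j, q)) (off wdl (Suc j) q') (sop wdl j s \<phi>)"
  shows "spreads (j, q) (Suc j, q') j w (s # D)" "spreads (Suc j, q') (j, q) j w (s # D)"
proof -
  let ?g = "G (lab (j, q))" and ?w = "width_above w s"
  have agree: "coup (insert (Suc j, q') S) u = coup S u" if "Suc j < fst u" for S u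
    using that by (auto simp: coupons_def)
  show "spreads (j, q) (Suc j, q') j w (s # D)"
    unfolding spreads_def
  proof (intro allI ballI impI)
    fix S \<psi> assume \<psi>: "\<psi> \<in> space" and S: "(j, q) \<in> S"
    let ?\<phi> = "ln wdl (coup S) j w \<psi>"
    have \<phi>: "?\<phi> \<in> space" using coup_space \<psi> .
    have "?\<phi> = ?g (off wdl j q) ?\<phi>" using coup_out[OF \<psi> assms(1), of j S] S by (simp add: insert_absorb)
    then have 1: "sop wdl j s ?\<phi> = ?g (off wdl (Suc j) q') (sop wdl j s ?\<phi>)" using slide[OF \<phi>] by simp
    have "ln wdl (coup (insert (Suc j, q') S)) (Suc j) ?w (sop wdl j s ?\<phi>) = ln wdl (coup S) (Suc j) ?w (sop wdl j s ?\<phi>)"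
      using coup_in[OF sop_space[OF \<phi>] assms(2), of "Suc j" S] 1 assms(3) by simp
    from ev_head[OF this] show "ev wdl (coup (insert (Suc j, q') S)) j w (s # D) \<psi> = ev wdl (coup S) j w (s # D) \<psi>"
      using agree coup_level[of j "(Suc j, q')" S w \<psi>] by simp
  qed
  show "spreads (Suc j, q') (j, q) j w (s # D)"
    unfolding spreads_def
  proof (intro allI ballI impI)
    fix S \<psi> assume \<psi>: "\<psi> \<in> space" and S: "(Suc j, q') \<in> S"
    let ?\<phi> = "ln wdl (coup S) j w \<psi>"
    have \<phi>: "?\<phi> \<in> space" using coup_space \<psi> .
    have "ln wdl (coup (insert (j, q) S)) (Suc j) ?w (?g (off wdl (Suc j) q') (sop wdl j s ?\<phi>)) =
        ln wdl (coup (insert (Suc j, q') S)) (Suc j) ?w (sop wdl j s ?\<phi>)"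
      using coup_in[OF sop_space[OF \<phi>] assms(2), of "Suc j" S] coup_level[of "Suc j" "(j, q)" S] assms(3) by simp
    then have 1: "ln wdl (coup (insert (j, q) S)) (Suc j) ?w (?g (off wdl (Suc j) q') (sop wdl j s ?\<phi>)) =
        ln wdl (coup S) (Suc j) ?w (sop wdl j s ?\<phi>)" using S by (simp add: insert_absorb)
    have "coup (insert (j, q) S) u = coup S u" if "Suc j < fst u" for u
      using that by (auto simp: coupons_def)
    from ev_head[OF 1 this] show "ev wdl (coup (insert (j, q) S)) j w (s # D) \<psi> = ev wdl (coup S) j w (s # D) \<psi>"
      using coup_out[OF \<psi> assms(1), of j S] slide[OF \<phi>] by simp
  qed
qed

lemma spreads_cup:
  assumes "q < width_above w s" "q' < width_above w s"
    and slide: "\<And>\<phi>. \<phi> \<in> space \<Longrightarrow> G (lab (Suc j, q)) (off wdl (Suc j) q) (sop wdl j s \<phi>) = G (lab (Suc j, q')) (off wdl (Suc j) q') (sop wdl j s \<phi>)"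
  shows "spreads (Suc j, q) (Suc j, q') j w (s # D)"
  unfolding spreads_def
proof (intro allI ballI impI)
  fix S \<psi> assume \<psi>: "\<psi> \<in> space" and S: "(Suc j, q) \<in> S"
  let ?\<phi> = "ln wdl (coup S) j w \<psi>"
  have \<phi>: "?\<phi> \<in> space" using coup_space \<psi> .
  have "ln wdl (coup (insert (Suc j, q') S)) (Suc j) (width_above w s) (sop wdl j s ?\<phi>) =
      ln wdl (coup (insert (Suc j, q) S)) (Suc j) (width_above w s) (sop wdl j s ?\<phi>)"
    using coup_in[OF sop_space[OF \<phi>] assms(2), of "Suc j" S] coup_in[OF sop_space[OF \<phi>] assms(1), of "Suc j" S] slide[OF \<phi>] by simp
  then have 1: "ln wdl (coup (insert (Suc j, q') S)) (Suc j) (width_above w s) (sop wdl j s ?\<phi>) =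
      ln wdl (coup S) (Suc j) (width_above w s) (sop wdl j s ?\<phi>)" using S by (simp add: insert_absorb)
  have "coup (insert (Suc j, q') S) u = coup S u" if "Suc j < fst u" for u
    using that by (auto simp: coupons_def)
  from ev_head[OF 1 this] show "ev wdl (coup (insert (Suc j, q') S)) j w (s # D) \<psi> = ev wdl (coup S) j w (s # D) \<psi>"
    using coup_level[of j "(Suc j, q')" S w \<psi>] by simp
qed

lemma spreads_cap:
  assumes "q < w" "q' < w"
    and slide: "\<And>\<phi>. \<phi> \<in> space \<Longrightarrow> sop wdl j s (G (lab (j, q)) (off wdl j q) \<phi>) = sop wdl j s (G (lab (j, q')) (off wdl j q') \<phi>)"
  shows "spreads (j, q) (j, q') j w (s # D)"
  unfolding spreads_def
proof (intro allI ballI impI)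
  fix S \<psi> assume \<psi>: "\<psi> \<in> space" and S: "(j, q) \<in> S"
  let ?\<phi> = "ln wdl (coup S) j w \<psi>"
  have \<phi>: "?\<phi> \<in> space" using coup_space \<psi> .
  have "?\<phi> = G (lab (j, q)) (off wdl j q) ?\<phi>" using coup_out[OF \<psi> assms(1), of j S] S by (simp add: insert_absorb)
  then have "sop wdl j s (ln wdl (coup (insert (j, q') S)) j w \<psi>) = sop wdl j s ?\<phi>"
    using coup_out[OF \<psi> assms(2), of j S] slide[OF \<phi>] by simp
  moreover have "ev wdl (coup (insert (j, q') S)) (Suc j) w' D \<phi> = ev wdl (coup S) (Suc j) w' D \<phi>" for w' \<phi>
    by (rule ev_eq_level) (auto simp: coupons_def)
  ultimately show "ev wdl (coup (insert (j, q') S)) j w (s # D) \<psi> = ev wdl (coup S) j w (s # D) \<psi>" by simp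
qed

lemma spreads_arc:
  assumes "cons_word opp lab j w D" "(u, m, v) \<in> arcs_from j w D"
  shows "spreads u v j w D \<and> spreads v u j w D"
  using assms
proof (induction D arbitrary: j w)
  case (Cons s D)
  have cs: "cons_slice opp lab j w s" using Cons.prems by simp
  then have cw: "cons_slice (=) wdl j w s" by (rule cons_slice_comp) (rule opp_width)
  show ?case
  proof (cases "(u, v) \<in> slice_edges j w s")
    case False
    then have a: "(u, m, v) \<in> arcs_from (Suc j) (width_above w s) D" using Cons.prems by (metis UnE arcs_from.simps(2) slice_edgesI)
    have lev: "j < fst u" "j < fst v" using arcs_from_level[OF a] by auto
    have IH: "spreads u v (Suc j) (width_above w s) D" "spreads v u (Suc j) (width_above w s) D"
      using Cons.IH[OF _ a] Cons.prems by auto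
    have "spreads u' v' j w (s # D)" if "spreads u' v' (Suc j) (width_above w s) D" "j < fst v'" for u' v'
      using that coup_level[of j v'] coup_space by (simp add: spreads_def)
    then show ?thesis using IH lev by blast
  next
    case True
    show ?thesis
    proof (cases s)
      case (Cup p)
      have p: "p \<le> w" using cs Cup by simp
      from True consider "u = (Suc j, p)" "v = (Suc j, Suc p)" | q where "u = (j, q)" "v = (Suc j, skip_pair p q)" "q < w"
        unfolding Cup slice_edges_Cup[OF p] by blast
      then show ?thesis
      proof cases
        case 1
        have opp: "opp (lab (Suc j, p)) (lab (Suc j, Suc p))" using cs Cup by simp
        have "G (lab u) (off wdl (Suc j) p) (sop wdl j s \<phi>) = G (lab v) (off wdl (Suc j) (Suc p)) (sop wdl j s \<phi>)" if "\<phi> \<in> space" for \<phi>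
          using slide_Cup_legs[OF cw[unfolded Cup] dual[OF opp] that] Cup 1 by simp
        then show ?thesis
          unfolding 1 using p Cup by (intro conjI spreads_cup) (auto simp: 1)
      next
        case 2
        have "sop wdl j s (G (lab (j, q)) (off wdl j q) \<phi>) = G (lab (j, q)) (off wdl (Suc j) (skip_pair p q)) (sop wdl j s \<phi>)" if "\<phi> \<in> space" for \<phi>
          using slide_Cup[OF cw[unfolded Cup] mG 2(3) that] Cup by simp
        moreover have "lab (Suc j, skip_pair p q) = lab (j, q)" using cs Cup 2 by simp
        moreover have "skip_pair p q < width_above w s" using 2 Cup by (simp add: skip_pair_def)
        ultimately show ?thesis unfolding 2(1,2) using spreads_through[of q w "skip_pair p q" s j D] 2(3) by blast
      qed
    next
      case (Cap p)
      have p: "p + 2 \<le> w" using cs Cap by simp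
      from True consider "u = (j, p)" "v = (j, Suc p)" | q where "u = (j, skip_pair p q)" "v = (Suc j, q)" "q + 2 < w"
        unfolding Cap slice_edges_Cap[OF p] by blast
      then show ?thesis
      proof cases
        case 1
        have opp: "opp (lab (j, p)) (lab (j, Suc p))" using cs Cap by simp
        have "sop wdl j s (G (lab u) (off wdl j p) \<phi>) = sop wdl j s (G (lab v) (off wdl j (Suc p)) \<phi>)" if "\<phi> \<in> space" for \<phi>
          using slide_Cap_legs[of "\<lambda>u. wl (lab u)" j p, OF dual[OF opp] that] Cap 1 by simp
        then show ?thesis
          unfolding 1 using p Cap by (intro conjI spreads_cap) (auto simp: 1)
      next
        case 2
        have l: "lab (Suc j, q) = lab (j, skip_pair p q)" using cs Cap 2 by simp
        have "sop wdl j s (G (lab (Suc j, q)) (off wdl j (skip_pair p q)) \<phi>) = G (lab (Suc j, q)) (off wdl (Suc j) q) (sop wdl j s \<phi>)" if "\<phi> \<in> space" for \<phi>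
          using slide_Cap[OF cw[unfolded Cap] mG 2(3) that] Cap by simp
        moreover have "skip_pair p q < w" "q < width_above w s" using 2 Cap p by (auto simp: skip_pair_def)
        ultimately show ?thesis unfolding 2(1,2) using spreads_through[of "skip_pair p q" w q s j D] l by simp
      qed
    next
      case (Crossing b p)
      have p: "p + 2 \<le> w" using cs Crossing by simp
      from True obtain q where q: "u = (j, q)" "v = (Suc j, swap_at p q)" "q < w"
        unfolding Crossing slice_edges_Crossing[OF p] by blast
      have "sop wdl j s (G (lab (j, q)) (off wdl j q) \<phi>) = G (lab (j, q)) (off wdl (Suc j) (swap_at p q)) (sop wdl j s \<phi>)" if "\<phi> \<in> space" for \<phi>
        using slide_Crossing[OF cw[unfolded Crossing] mG q(3) that] Crossing by simp
      moreover have "lab (Suc j, swap_at p q) = lab (j, q)" "swap_at p q < width_above w s"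
        using cs Crossing q p by (auto simp: swap_at_def)
      ultimately show ?thesis unfolding q(1,2) using spreads_through[of q w "swap_at p q" s j D] q(3) by blast
    qed
  qed
qed simp

lemma spreads_component:
  assumes "cons_word opp lab 0 0 D" "finite N" "u0 \<in> N" "\<psi> \<in> space"
    and N: "\<And>u. u \<in> N \<Longrightarrow> (u0, u) \<in> (adjacent D)\<^sup>*" "\<And>u v. u \<in> N \<Longrightarrow> (u, v) \<in> adjacent D \<Longrightarrow> v \<in> N"
  shows "ev wdl (coup N) 0 0 D \<psi> = ev wdl (coup {u0}) 0 0 D \<psi>"
proof -
  \<comment> \<open>A maximal set of nodes that can carry \<open>G\<close> without changing the
    value is closed under adjacency, so it is the whole component.\<close>
  define M where "M = {S. u0 \<in> S \<and> S \<subseteq> N \<and> ev wdl (coup S) 0 0 D \<psi> = ev wdl (coup {u0}) 0 0 D \<psi>}"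
  have "finite M" "{u0} \<in> M" using assms(2,3) by (auto simp: M_def)
  then obtain S where S: "S \<in> M" "\<And>T. T \<in> M \<Longrightarrow> S \<subseteq> T \<Longrightarrow> T = S"
    using finite_has_maximal[of M] by (metis empty_iff)
  have "u \<in> S" if "(u0, u) \<in> (adjacent D)\<^sup>*" for u
    using that
  proof (induction rule: rtrancl_induct)
    case base
    then show ?case using S(1) by (simp add: M_def)
  next
    case (step y z)
    then obtain m where "(y, m, z) \<in> arcs_from 0 0 D \<or> (z, m, y) \<in> arcs_from 0 0 D"
      by (auto simp: adjacent_def arcs_def)
    then have "spreads y z 0 0 D" using spreads_arc[OF assms(1)] by blast
    then have "ev wdl (coup (insert z S)) 0 0 D \<psi> = ev wdl (coup S) 0 0 D \<psi>"
      using step.IH assms(4) by (simp add: spreads_def)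
    moreover have "z \<in> N" using N(2)[OF _ step.hyps(2)] step.IH S(1) by (auto simp: M_def)
    ultimately have "insert z S \<in> M" using S(1) by (auto simp: M_def)
    then show ?case using S(2)[of "insert z S"] by blast
  qed
  then have "S = N" using N(1) S(1) by (auto simp: M_def)
  then show ?thesis using S(1) by (simp add: M_def)
qed

end

end

section \<open>Replacing the object of a component\<close>

lemma upt_shift_2: "map f [p + 2..<w + 2] = map (\<lambda>q. f (q + 2)) [p..<w]"
proof -
  have "[p + 2..<w + 2] = map Suc (map Suc [p..<w])" by (simp only: map_Suc_upt add_2_eq_Suc')
  then show ?thesis by (simp add: comp_def del: upt_Suc)
qed

lemma sum_list_lab: "sum_list (map f (map lab (line j p))) = off (\<lambda>u. f (lab u)) j p"
  by (simp add: sum_list_line[symmetric] comp_def)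

text \<open>Reduces a slice to lists of labels, so that the transfer below does not deal with node
  coordinates.\<close>

lemma labels_Cup:
  assumes "cons_slice opp lab j w (Cup p)"
  obtains L R where "map lab (line j w) = L @ R"
    "map lab (line (Suc j) (w + 2)) = L @ [lab (Suc j, p), lab (Suc j, Suc p)] @ R"
    "L = map lab (line j p)"
proof
  have p: "p \<le> w" "\<And>q. q < w \<Longrightarrow> lab (Suc j, skip_pair p q) = lab (j, q)" using assms by auto
  have l: "lab (Suc j, q) = lab (j, q)" if "q < p" for q
    using p(2)[of q] p(1) that by (simp add: skip_pair_def)
  have r: "lab (Suc j, q + 2) = lab (j, q)" if "p \<le> q" "q < w" for q
    using p(2)[of q] that by (simp add: skip_pair_def)
  show "map lab (line j w) = map lab (line j p) @ map lab (map (Pair j) [p..<w])"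
    using line_split[OF p(1), of j] by simp
  have "line (Suc j) (w + 2) = line (Suc j) p @ [(Suc j, p), (Suc j, Suc p)] @ map (Pair (Suc j)) [p + 2..<w + 2]"
    by (rule line_split_2) (use p in simp)
  moreover have "map lab (line (Suc j) p) = map lab (line j p)" using l by (simp add: line_def)
  moreover have "map lab (map (Pair (Suc j)) [p + 2..<w + 2]) = map lab (map (Pair j) [p..<w])"
    unfolding upt_shift_2 using r by simp
  ultimately show "map lab (line (Suc j) (w + 2)) =
      map lab (line j p) @ [lab (Suc j, p), lab (Suc j, Suc p)] @ map lab (map (Pair j) [p..<w])"
    by (simp del: map_map)
qed simp

lemma labels_Cap:
  assumes "cons_slice opp lab j w (Cap p)"
  obtains L R where "map lab (line j w) = L @ [lab (j, p), lab (j, Suc p)] @ R"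
    "map lab (line (Suc j) (w - 2)) = L @ R" "L = map lab (line j p)"
proof
  have p: "p + 2 \<le> w" "\<And>q. q + 2 < w \<Longrightarrow> lab (Suc j, q) = lab (j, skip_pair p q)" using assms by auto
  have l: "lab (Suc j, q) = lab (j, q)" if "q < p" for q
    using p(2)[of q] p(1) that by (simp add: skip_pair_def)
  have r: "lab (Suc j, q) = lab (j, q + 2)" if "p \<le> q" "q < w - 2" for q
    using p(2)[of q] that by (simp add: skip_pair_def)
  show "map lab (line j w) = map lab (line j p) @ [lab (j, p), lab (j, Suc p)] @ map lab (map (Pair j) [p + 2..<w])"
    using line_split_2[OF p(1), of j] by simp
  have "line (Suc j) (w - 2) = line (Suc j) p @ map (Pair (Suc j)) [p..<w - 2]"
    by (rule line_split) (use p in simp)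
  moreover have "map lab (line (Suc j) p) = map lab (line j p)" using l by (simp add: line_def)
  moreover have "map lab (map (Pair (Suc j)) [p..<w - 2]) = map lab (map (Pair j) [p + 2..<w])"
  proof -
    have "map (Pair j) [p + 2..<w] = map (\<lambda>q. (j, q + 2)) [p..<w - 2]"
      using upt_shift_2[of "Pair j" p "w - 2"] p(1) by (simp add: Suc_diff_Suc numeral_2_eq_2)
    then show ?thesis using r by simp
  qed
  ultimately show "map lab (line (Suc j) (w - 2)) = map lab (line j p) @ map lab (map (Pair j) [p + 2..<w])"
    by (simp del: map_map)
qed simp

lemma labels_Crossing:
  assumes "cons_slice opp lab j w (Crossing b p)"
  obtains L R where "map lab (line j w) = L @ [lab (j, p), lab (j, Suc p)] @ R"
    "map lab (line (Suc j) w) = L @ [lab (j, Suc p), lab (j, p)] @ R" "L = map lab (line j p)"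
proof
  have p: "p + 2 \<le> w" "lab (Suc j, p) = lab (j, Suc p)" "lab (Suc j, Suc p) = lab (j, p)"
    "\<And>q. q < w \<Longrightarrow> q \<noteq> p \<Longrightarrow> q \<noteq> Suc p \<Longrightarrow> lab (Suc j, q) = lab (j, q)" using assms by auto
  show "map lab (line j w) = map lab (line j p) @ [lab (j, p), lab (j, Suc p)] @ map lab (map (Pair j) [p + 2..<w])"
    using line_split_2[OF p(1), of j] by simp
  have "map lab (line (Suc j) p) = map lab (line j p)" using p by (simp add: line_def)
  moreover have "map lab (map (Pair (Suc j)) [p + 2..<w]) = map lab (map (Pair j) [p + 2..<w])" using p by simp
  ultimately show "map lab (line (Suc j) w) = map lab (line j p) @ [lab (j, Suc p), lab (j, p)] @ map lab (map (Pair j) [p + 2..<w])"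
    using line_split_2[OF p(1), of "Suc j"] p(2,3) by (simp del: map_map)
qed simp

context path_model begin

lemma lops_map: "lops (\<lambda>u. w (lab u)) (\<lambda>u. X (lab u)) us = lops w X (map lab us)"
  by (simp add: ents_def comp_def)

lemma lops_absorb_in:
  assumes "\<And>x. mor1 (w x) (w x) (X x)" "\<And>x. fam_eq (fam_comp (X x) (X x)) (X x)" "\<psi> \<in> space"
  shows "lops w X (L @ x # R) P (X x (P + sum_list (map w L)) \<psi>) = lops w X (L @ x # R) P \<psi>"
proof -
  let ?Q = "P + sum_list (map w L)"
  have m: "mor1 (sum_list (map w R)) (sum_list (map w R)) (lops w X R)" by (rule mor1_lops) (rule assms(1))
  have "lops w X R (?Q + w x) (X x ?Q \<psi>) = X x ?Q (lops w X R (?Q + w x) \<psi>)"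
    using interchange1[OF assms(1) m assms(3), of ?Q x "?Q + w x"] by simp
  moreover have "X x ?Q (X x ?Q \<phi>) = X x ?Q \<phi>" if "\<phi> \<in> space" for \<phi>
    using fam_eqD[OF assms(2) that, of x ?Q] by (simp add: fam_simps)
  ultimately show ?thesis using mor1_space[OF m assms(3)] by (simp add: lops_append)
qed

lemma lops_absorb_out:
  assumes "\<And>x. mor1 (w x) (w x) (X x)" "\<And>x. fam_eq (fam_comp (X x) (X x)) (X x)" "\<psi> \<in> space"
  shows "X x (P + sum_list (map w L)) (lops w X (L @ x # R) P \<psi>) = lops w X (L @ x # R) P \<psi>"
proof -
  let ?Q = "P + sum_list (map w L)"
  have mR: "mor1 (sum_list (map w R)) (sum_list (map w R)) (lops w X R)" 
    and mL: "mor1 (sum_list (map w L)) (sum_list (map w L)) (lops w X L)" by (rule mor1_lops, rule assms(1))+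
  define \<rho> where "\<rho> = lops w X R (?Q + w x) \<psi>"
  have \<rho>: "\<rho> \<in> space" unfolding \<rho>_def by (rule mor1_space[OF mR assms(3)])
  have "X x ?Q (lops w X L P (X x ?Q \<rho>)) = lops w X L P (X x ?Q (X x ?Q \<rho>))"
    using interchange1[OF mL assms(1) mor1_space[OF assms(1) \<rho>], of P ?Q x x ?Q] by simp
  also have "X x ?Q (X x ?Q \<rho>) = X x ?Q \<rho>"
    using fam_eqD[OF assms(2) \<rho>, of x ?Q] by (simp add: fam_simps)
  finally show ?thesis by (simp add: lops_append \<rho>_def)
qed

text \<open>\<open>V\<close> and \<open>W\<close> are two objects with idempotents, and
  \<open>t\<close> maps \<open>V\<close> to \<open>W\<close> compatibly with them. At turns
  \<open>t\<close> has to disappear only in the presence of the idempotents, as it is meant to be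
  invertible only between their images.\<close>

context
  fixes lab :: "node \<Rightarrow> 'l" and opp :: "'l \<Rightarrow> 'l \<Rightarrow> bool" and wV wW :: "'l \<Rightarrow> nat" and xV xW t :: "'l \<Rightarrow> family"
  assumes opp_V: "\<And>x y. opp x y \<Longrightarrow> wV x = wV y" and opp_W: "\<And>x y. opp x y \<Longrightarrow> wW x = wW y"
    and mV: "\<And>x. mor1 (wV x) (wV x) (xV x)" and mW: "\<And>x. mor1 (wW x) (wW x) (xW x)"
    and mt: "\<And>x. mor1 (wV x) (wW x) (t x)"
    and VV: "\<And>x. fam_eq (fam_comp (xV x) (xV x)) (xV x)"
    and WW: "\<And>x. fam_eq (fam_comp (xW x) (xW x)) (xW x)"
    and inter: "\<And>x. fam_eq (fam_comp (xW x) (t x)) (fam_comp (t x) (xV x))"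
    and tcup: "\<And>x y P \<psi>. opp x y \<Longrightarrow> \<psi> \<in> space \<Longrightarrow>
      xW x P (xW y (P + wW x) (t x P (t y (P + wV x) (cups (wV x) P \<psi>)))) =
      xW x P (xW y (P + wW x) (cups (wW x) P \<psi>))"
    and tcap: "\<And>x y P \<phi>. opp x y \<Longrightarrow> \<phi> \<in> space \<Longrightarrow>
      caps (wW x) P (t x P (t y (P + wV x) (xV x P (xV y (P + wV x) \<phi>)))) =
      caps (wV x) P (xV x P (xV y (P + wV x) \<phi>))"
begin

abbreviation (input) dV :: "node \<Rightarrow> nat" where "dV u \<equiv> wV (lab u)"
abbreviation (input) dW :: "node \<Rightarrow> nat" where "dW u \<equiv> wW (lab u)"
abbreviation (input) cV :: "node \<Rightarrow> family" where "cV u \<equiv> xV (lab u)"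
abbreviation (input) cW :: "node \<Rightarrow> family" where "cW u \<equiv> xW (lab u)"

lemma transfer_line:
  assumes "\<psi> \<in> space"
  shows "lops wW xW ls P (lops wV t ls P \<psi>) = lops wV t ls P (lops wV xV ls P \<psi>)"
proof -
  have "lops wW xW ls P (lops wV t ls P \<psi>) = lops wV (\<lambda>x. fam_comp (xW x) (t x)) ls P \<psi>"
    by (rule lops_comp[OF mt mW assms])
  also have "\<dots> = lops wV (\<lambda>x. fam_comp (t x) (xV x)) ls P \<psi>"
    by (rule lops_cong[OF inter _ assms]) (rule mor1_comp[OF mV mt])
  also have "\<dots> = lops wV t ls P (lops wV xV ls P \<psi>)"
    by (rule lops_comp[OF mV mt assms, symmetric])
  finally show ?thesis .
qed

lemma mor1_lt: "mor1 (sum_list (map wV ls)) (sum_list (map wW ls)) (lops wV t ls)"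
  by (rule mor1_lops) (rule mt)

lemma mor1_lV: "mor1 (sum_list (map wV ls)) (sum_list (map wV ls)) (lops wV xV ls)"
  by (rule mor1_lops) (rule mV)

lemma past_t:
  assumes "mor1 c d g" "\<psi> \<in> space"
  shows "g (sum_list (map wW L)) (lops wV t L 0 \<psi>) = lops wV t L 0 (g (sum_list (map wV L)) \<psi>)"
  using interchange1[OF mor1_lt[of L] assms, of 0 "sum_list (map wV L)"] by simp

lemma transfer_cup:
  assumes "opp x y" "\<phi> \<in> space"
  shows "lops wW xW (L @ [x, y] @ R) 0 (cups (wW x) (sum_list (map wW L)) (lops wV t (L @ R) 0 \<phi>)) =
    lops wW xW (L @ [x, y] @ R) 0 (lops wV t (L @ [x, y] @ R) 0 (cups (wV x) (sum_list (map wV L)) \<phi>))"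
proof -
  note wy = opp_V[OF assms(1), symmetric] opp_W[OF assms(1), symmetric]
  let ?PV = "sum_list (map wV L)" and ?PW = "sum_list (map wW L)"
  let ?A = "lops wV t L 0"
  define \<phi>' where "\<phi>' = lops wV t R ?PV \<phi>"
  have \<phi>': "\<phi>' \<in> space" unfolding \<phi>'_def by (rule mor1_space[OF mor1_lt assms(2)])
  define \<sigma>1 where "\<sigma>1 = cups (wW x) ?PV \<phi>'"
  define \<sigma>2 where "\<sigma>2 = t x ?PV (t y (?PV + wV x) (cups (wV x) ?PV \<phi>'))"
  have \<sigma>: "\<sigma>1 \<in> space" "\<sigma>2 \<in> space"
    unfolding \<sigma>1_def \<sigma>2_def
    by (rule cups_space[OF \<phi>'], rule mor1_space[OF mt mor1_space[OF mt cups_space[OF \<phi>']]])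
  have c1: "cups (wW x) ?PW (lops wV t (L @ R) 0 \<phi>) = ?A \<sigma>1"
    using past_t[OF mor1_cups \<phi>', of "wW x" L] by (simp add: lops_append \<phi>'_def \<sigma>1_def)
  have "lops wV t R (?PV + wV x + wV x) (cups (wV x) ?PV \<phi>) = cups (wV x) ?PV \<phi>'"
    using interchange1[OF mor1_cups[of "wV x"] mor1_lt[of R] assms(2), of ?PV ?PV] by (simp add: \<phi>'_def mult_2 add.assoc)
  then have c2: "lops wV t (L @ [x, y] @ R) 0 (cups (wV x) ?PV \<phi>) = ?A \<sigma>2"
    by (simp add: lops_append \<sigma>2_def wy)
  \<comment> \<open>The idempotents of the next line can be doubled and moved below the row of
    \<open>t\<close> on the left, which gives the expression that \<open>tcup\<close> speaks
    of.\<close>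
  have absorb: "lops wW xW (L @ [x, y] @ R) 0 (?A \<sigma>) = lops wW xW (L @ [x, y] @ R) 0 (?A (xW x ?PV (xW y (?PV + wW x) \<sigma>)))"
    if s: "\<sigma> \<in> space" for \<sigma>
  proof -
    have A: "?A \<sigma> \<in> space" by (rule mor1_space[OF mor1_lt s])
    have "lops wW xW (L @ [x, y] @ R) 0 (xW x ?PW (xW y (?PW + wW x) (?A \<sigma>))) = lops wW xW (L @ [x, y] @ R) 0 (?A \<sigma>)"
      using lops_absorb_in[where w = wW and X = xW and x = x and P = 0 and L = L and R = "y # R", OF mW WW
          mor1_space[OF mW[of y] A, of "?PW + wW x"]]
        lops_absorb_in[where w = wW and X = xW and x = y and P = 0 and L = "L @ [x]" and R = R, OF mW WW A] by simp
    moreover have "xW y (?PW + wW x) (?A \<sigma>) = ?A (xW y (?PV + wW x) \<sigma>)"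
      using interchange1[OF mor1_lt[of L] mW[of y] s, of 0 "?PV + wW x"] by (simp add: add.commute)
    moreover have "xW x ?PW (?A (xW y (?PV + wW x) \<sigma>)) = ?A (xW x ?PV (xW y (?PV + wW x) \<sigma>))"
      by (rule past_t[OF mW mor1_space[OF mW s]])
    ultimately show ?thesis by simp
  qed
  have "xW x ?PV (xW y (?PV + wW x) \<sigma>2) = xW x ?PV (xW y (?PV + wW x) \<sigma>1)"
    unfolding \<sigma>1_def \<sigma>2_def by (rule tcup[OF assms(1) \<phi>'])
  then show ?thesis unfolding c1 c2 using absorb[OF \<sigma>(1)] absorb[OF \<sigma>(2)] by simp
qed

lemma transfer_cap:
  assumes "opp x y" "\<psi> \<in> space" "\<phi> = lops wV xV (L @ [x, y] @ R) 0 \<psi>"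
  shows "caps (wW x) (sum_list (map wW L)) (lops wV t (L @ [x, y] @ R) 0 \<phi>) =
    lops wV t (L @ R) 0 (caps (wV x) (sum_list (map wV L)) \<phi>)"
proof -
  note wy = opp_V[OF assms(1), symmetric] opp_W[OF assms(1), symmetric]
  let ?PV = "sum_list (map wV L)" and ?PW = "sum_list (map wW L)"
  let ?A = "lops wV t L 0"
  have \<phi>: "\<phi> \<in> space" unfolding assms(3) by (rule mor1_space[OF mor1_lV assms(2)])
  define \<rho> where "\<rho> = lops wV t R (?PV + wV x + wV x) \<phi>"
  have \<rho>: "\<rho> \<in> space" unfolding \<rho>_def by (rule mor1_space[OF mor1_lt \<phi>])
  have "xV x ?PV \<phi> = \<phi>" "xV y (?PV + wV x) \<phi> = \<phi>"
    using lops_absorb_out[where w = wV and X = xV and x = x and P = 0 and L = L and R = "y # R", OF mV VV assms(2)]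
      lops_absorb_out[where w = wV and X = xV and x = y and P = 0 and L = "L @ [x]" and R = R, OF mV VV assms(2)]
    unfolding assms(3) by simp_all
  moreover have "xV y (?PV + wV x) (lops wV t R (?PV + wV x + wV x) \<phi>) = lops wV t R (?PV + wV x + wV x) (xV y (?PV + wV x) \<phi>)"
    using interchange1[OF mV[of y] mor1_lt[of R] \<phi>, of "?PV + wV x" "?PV + wV x + wV x"] by (simp add: wy)
  moreover have "xV x ?PV (lops wV t R (?PV + wV x + wV x) \<phi>) = lops wV t R (?PV + wV x + wV x) (xV x ?PV \<phi>)"
    using interchange1[OF mV[of x] mor1_lt[of R] \<phi>, of ?PV "?PV + wV x + wV x"] by simp
  \<comment> \<open>The line below the cap has already applied these idempotents, so inserting them
    for \<open>tcap\<close> changes nothing.\<close>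
  ultimately have fixed: "xV x ?PV (xV y (?PV + wV x) \<rho>) = \<rho>"
    unfolding \<rho>_def by simp
  have "caps (wW x) ?PW (lops wV t (L @ [x, y] @ R) 0 \<phi>) = caps (wW x) ?PW (?A (t x ?PV (t y (?PV + wV x) \<rho>)))"
    by (simp add: lops_append \<rho>_def wy)
  also have "\<dots> = ?A (caps (wW x) ?PV (t x ?PV (t y (?PV + wV x) \<rho>)))"
    by (rule past_t[OF mor1_caps mor1_space[OF mt mor1_space[OF mt \<rho>]]])
  also have "caps (wW x) ?PV (t x ?PV (t y (?PV + wV x) \<rho>)) = caps (wV x) ?PV \<rho>"
    using tcap[OF assms(1) \<rho>, of ?PV] unfolding fixed .
  also have "caps (wV x) ?PV \<rho> = lops wV t R ?PV (caps (wV x) ?PV \<phi>)"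
    using interchange1[OF mor1_caps[of "wV x"] mor1_lt[of R] \<phi>, of ?PV "?PV + wV x + wV x"] by (simp add: \<rho>_def mult_2)
  finally show ?thesis by (simp add: lops_append)
qed

lemma transfer_crossing:
  assumes "\<phi> \<in> space"
  shows "cross b (wW x) (wW y) (sum_list (map wW L)) (lops wV t (L @ [x, y] @ R) 0 \<phi>) =
    lops wV t (L @ [y, x] @ R) 0 (cross b (wV x) (wV y) (sum_list (map wV L)) \<phi>)"
proof -
  let ?PV = "sum_list (map wV L)" and ?PW = "sum_list (map wW L)"
  let ?A = "lops wV t L 0"
  define \<rho> where "\<rho> = lops wV t R (?PV + wV x + wV y) \<phi>"
  have \<rho>: "\<rho> \<in> space" unfolding \<rho>_def by (rule mor1_space[OF mor1_lt assms])
  have cs: "cross b (wV x) (wV y) ?PV \<rho> \<in> space" using \<rho> by simp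
  obtain x' y' where m: "mor (wV x) (wW x) (t x) x'" "mor (wV y) (wW y) (t y) y'" using mt by (meson mor1_def)
  have "cross b (wW x) (wW y) ?PW (lops wV t (L @ [x, y] @ R) 0 \<phi>) =
      cross b (wW x) (wW y) ?PW (?A (t x ?PV (t y (?PV + wV x) \<rho>)))"
    by (simp add: lops_append \<rho>_def)
  also have "\<dots> = ?A (cross b (wW x) (wW y) ?PV (t x ?PV (t y (?PV + wV x) \<rho>)))"
    by (rule past_t[OF mor1_cross mor1_space[OF mt mor1_space[OF mt \<rho>]]])
  also have "cross b (wW x) (wW y) ?PV (t x ?PV (t y (?PV + wV x) \<rho>)) =
      t x (?PV + wW y) (cross b (wV x) (wW y) ?PV (t y (?PV + wV x) \<rho>))"
    by (rule cross_left_slide[OF m(1) mor1_space[OF mt \<rho>]])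
  also have "cross b (wV x) (wW y) ?PV (t y (?PV + wV x) \<rho>) = t y ?PV (cross b (wV x) (wV y) ?PV \<rho>)"
    by (rule cross_right_slide[OF m(2) \<rho>])
  also have "t x (?PV + wW y) (t y ?PV (cross b (wV x) (wV y) ?PV \<rho>)) = t y ?PV (t x (?PV + wV y) (cross b (wV x) (wV y) ?PV \<rho>))"
    using interchange1[OF mt[of y] mt[of x] cs, of ?PV "?PV + wV y"] by simp
  also have "cross b (wV x) (wV y) ?PV \<rho> = lops wV t R (?PV + wV y + wV x) (cross b (wV x) (wV y) ?PV \<phi>)"
    using interchange1[OF mor1_cross[of "wV x" "wV y" b] mor1_lt[of R] assms, of ?PV "?PV + wV x + wV y"]
    by (simp add: \<rho>_def ac_simps)
  finally show ?thesis by (simp add: lops_append)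
qed

text \<open>The row of \<open>t\<close> is swept upwards: below it the diagram carries
  \<open>V\<close>, above it \<open>W\<close>. At the top there are no strands, and the row
  disappears.\<close>

theorem ev_transfer:
  assumes "cons_word opp lab j w D" "final_width w D = 0" "\<psi> \<in> space"
  shows "ev dW cW j w D (lops wV t (map lab (line j w)) 0 \<psi>) = ev dV cV j w D \<psi>"
  using assms
proof (induction D arbitrary: j w \<psi>)
  case Nil
  then show ?case by (simp add: ln_def line_def)
next
  case (Cons s D)
  have ln: "ln dW cW j w = lops wW xW (map lab (line j w)) 0" "ln dV cV j w = lops wV xV (map lab (line j w)) 0" for j w
    unfolding ln_def lops_map by simp_all
  have cs: "cons_slice opp lab j w s" using Cons.prems by simp
  define \<phi> where "\<phi> = ln dV cV j w \<psi>"
  have \<phi>: "\<phi> \<in> space" unfolding \<phi>_def ln by (rule mor1_space[OF mor1_lV Cons.prems(3)])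
  have U\<phi>: "ln dW cW j w (lops wV t (map lab (line j w)) 0 \<psi>) = lops wV t (map lab (line j w)) 0 \<phi>"
    unfolding \<phi>_def ln by (rule transfer_line[OF Cons.prems(3)])
  have key: "ln dW cW (Suc j) (width_above w s) (sop dW j s (lops wV t (map lab (line j w)) 0 \<phi>)) =
      ln dW cW (Suc j) (width_above w s) (lops wV t (map lab (line (Suc j) (width_above w s))) 0 (sop dV j s \<phi>))"
  proof (cases s)
    case (Cup p)
    obtain L R where LR: "map lab (line j w) = L @ R"
      "map lab (line (Suc j) (w + 2)) = L @ [lab (Suc j, p), lab (Suc j, Suc p)] @ R" "L = map lab (line j p)"
      using labels_Cup cs Cup by metis
    have o: "off dW j p = sum_list (map wW L)" "off dV j p = sum_list (map wV L)"
      unfolding LR(3) sum_list_lab by simp_all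
    have "opp (lab (Suc j, p)) (lab (Suc j, Suc p))" using cs Cup by simp
    from transfer_cup[OF this \<phi>, of L R] show ?thesis
      unfolding ln LR(1) Cup width_above.simps LR(2) sop.simps o by simp
  next
    case (Cap p)
    obtain L R where LR: "map lab (line j w) = L @ [lab (j, p), lab (j, Suc p)] @ R"
      "map lab (line (Suc j) (w - 2)) = L @ R" "L = map lab (line j p)"
      using labels_Cap cs Cap by metis
    have o: "off dW j p = sum_list (map wW L)" "off dV j p = sum_list (map wV L)"
      unfolding LR(3) sum_list_lab by simp_all
    have "opp (lab (j, p)) (lab (j, Suc p))" using cs Cap by simp
    from transfer_cap[OF this Cons.prems(3), of \<phi> L R] show ?thesis
      unfolding ln Cap width_above.simps LR(2) sop.simps o using LR(1) by (simp add: \<phi>_def ln)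
  next
    case (Crossing b p)
    obtain L R where LR: "map lab (line j w) = L @ [lab (j, p), lab (j, Suc p)] @ R"
      "map lab (line (Suc j) w) = L @ [lab (j, Suc p), lab (j, p)] @ R" "L = map lab (line j p)"
      using labels_Crossing cs Crossing by metis
    have o: "off dW j p = sum_list (map wW L)" "off dV j p = sum_list (map wV L)"
      unfolding LR(3) sum_list_lab by simp_all
    from transfer_crossing[OF \<phi>, of b "lab (j, p)" "lab (j, Suc p)" L R] show ?thesis
      unfolding ln LR(1) Crossing width_above.simps LR(2) sop.simps o by simp
  qed
  have "ev dW cW (Suc j) (width_above w s) D (sop dW j s (lops wV t (map lab (line j w)) 0 \<phi>)) =
      ev dW cW (Suc j) (width_above w s) D (lops wV t (map lab (line (Suc j) (width_above w s))) 0 (sop dV j s \<phi>))"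
    by (rule ev_head[OF key]) simp
  also have "\<dots> = ev dV cV (Suc j) (width_above w s) D (sop dV j s \<phi>)"
    by (rule Cons.IH) (use Cons.prems \<phi> in auto)
  finally show ?case by (simp add: U\<phi> \<phi>_def[symmetric])
qed

end

end

section \<open>Orientations\<close>

lemma cons_word_append:
  "cons_word R f j w (C @ D) \<longleftrightarrow> cons_word R f j w C \<and> cons_word R f (j + length C) (final_width w C) D"
  by (induction C arbitrary: j w) auto

lemma cons_slice_cong:
  assumes "\<And>u. fst u \<le> Suc j \<Longrightarrow> f u = g u" "cons_slice R f j w s"
  shows "cons_slice R g j w s"
  using assms(2) by (cases s) (simp_all add: assms(1)[symmetric])

lemma cons_word_cong:
  assumes "\<And>u. fst u \<le> j + length D \<Longrightarrow> f u = g u" "cons_word R f j w D"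
  shows "cons_word R g j w D"
  using assms
proof (induction D arbitrary: j w)
  case (Cons s D)
  have "cons_slice R g j w s" by (rule cons_slice_cong[of j f g]) (use Cons.prems in auto)
  moreover have "cons_word R g (Suc j) (width_above w s) D" by (rule Cons.IH) (use Cons.prems in auto)
  ultimately show ?case by simp
qed simp

text \<open>The top strands of a partial diagram are matched up by the arcs below them, and any
  orientation of these strands that is opposite on matched strands extends downwards.\<close>

definition matched :: "slice list \<Rightarrow> (nat \<Rightarrow> nat) \<Rightarrow> bool" where
  "matched C m \<longleftrightarrow> (\<forall>q<final_width 0 C. m q < final_width 0 C \<and> m q \<noteq> q \<and> m (m q) = q) \<and>
     (\<forall>\<sigma>::nat \<Rightarrow> bool. (\<forall>q<final_width 0 C. \<sigma> (m q) \<noteq> \<sigma> q) \<longrightarrow>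
        (\<exists>o'. cons_word (\<noteq>) o' 0 0 C \<and> (\<forall>q<final_width 0 C. o' (length C, q) = \<sigma> q)))"

lemma matched_snoc:
  assumes "matched C m"
    and inv: "\<And>q. q < final_width 0 (C @ [s]) \<Longrightarrow> m' q < final_width 0 (C @ [s]) \<and> m' q \<noteq> q \<and> m' (m' q) = q"
    and down: "\<And>\<sigma>'::nat \<Rightarrow> bool. (\<And>q. q < final_width 0 (C @ [s]) \<Longrightarrow> \<sigma>' (m' q) \<noteq> \<sigma>' q) \<Longrightarrow>
      \<exists>\<sigma>. (\<forall>q<final_width 0 C. \<sigma> (m q) \<noteq> \<sigma> q) \<and>
        (\<forall>f. (\<forall>q<final_width 0 C. f (length C, q) = \<sigma> q) \<longrightarrow> (\<forall>q. f (Suc (length C), q) = \<sigma>' q) \<longrightarrow>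
          cons_slice (\<noteq>) f (length C) (final_width 0 C) s)"
  shows "matched (C @ [s]) m'"
  unfolding matched_def
proof (intro conjI allI impI)
  fix \<sigma>' :: "nat \<Rightarrow> bool"
  assume "\<forall>q<final_width 0 (C @ [s]). \<sigma>' (m' q) \<noteq> \<sigma>' q"
  then have "\<exists>\<sigma>. (\<forall>q<final_width 0 C. \<sigma> (m q) \<noteq> \<sigma> q) \<and>
        (\<forall>f. (\<forall>q<final_width 0 C. f (length C, q) = \<sigma> q) \<longrightarrow> (\<forall>q. f (Suc (length C), q) = \<sigma>' q) \<longrightarrow>
          cons_slice (\<noteq>) f (length C) (final_width 0 C) s)" by (intro down) simp
  then obtain \<sigma> where \<sigma>: "\<forall>q<final_width 0 C. \<sigma> (m q) \<noteq> \<sigma> q"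
    "\<forall>f. (\<forall>q<final_width 0 C. f (length C, q) = \<sigma> q) \<longrightarrow> (\<forall>q. f (Suc (length C), q) = \<sigma>' q) \<longrightarrow>
          cons_slice (\<noteq>) f (length C) (final_width 0 C) s" by (elim exE conjE)
  from \<sigma>(1) obtain g where g: "cons_word (\<noteq>) g 0 0 C" "\<forall>q<final_width 0 C. g (length C, q) = \<sigma> q"
    using assms(1) unfolding matched_def by metis
  define f where "f u = (if fst u \<le> length C then g u else \<sigma>' (snd u))" for u :: node
  have "cons_word (\<noteq>) f 0 0 C" by (rule cons_word_cong[OF _ g(1)]) (simp add: f_def)
  moreover have "cons_slice (\<noteq>) f (length C) (final_width 0 C) s"
    using \<sigma>(2)[rule_format, of f] g(2) by (simp add: f_def)
  ultimately have "cons_word (\<noteq>) f 0 0 (C @ [s])" by (simp add: cons_word_append)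
  then show "\<exists>o'. cons_word (\<noteq>) o' 0 0 (C @ [s]) \<and> (\<forall>q<final_width 0 (C @ [s]). o' (length (C @ [s]), q) = \<sigma>' q)"
    by (intro exI[of _ f]) (simp add: f_def)
qed (use inv in auto)

lemma pair_cancel: "drop_pair p (skip_pair p q) = q" "skip_pair p q \<noteq> p" "skip_pair p q \<noteq> Suc p"
  "q \<noteq> p \<Longrightarrow> q \<noteq> Suc p \<Longrightarrow> skip_pair p (drop_pair p q) = q"
  by (auto simp: skip_pair_def drop_pair_def)

text \<open>A cup adds a matched pair, a crossing permutes the strands, and a cap matches the
  partners of the two strands it joins.\<close>

lemma matching_exists:
  assumes "admissible_word 0 C"
  shows "\<exists>m. matched C m"
  using assms
proof (induction C rule: rev_induct)
  case Nil
  show ?case by (auto simp: matched_def)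
next
  case (snoc s C)
  then obtain m where m: "matched C m" by auto
  let ?w = "final_width 0 C"
  have inv: "m q < ?w" "m q \<noteq> q" "m (m q) = q" if "q < ?w" for q
    using m that by (auto simp: matched_def)
  show ?case
  proof (cases s)
    case (Cup p)
    have p: "p \<le> ?w" using snoc.prems Cup by simp
    have drop: "drop_pair p q < ?w" if "q < ?w + 2" "q \<noteq> p" "q \<noteq> Suc p" for q
      using that p by (auto simp: drop_pair_def)
    have skip: "skip_pair p q < ?w + 2" if "q < ?w" for q using that by (auto simp: skip_pair_def)
    define m' where "m' q = (if q = p then Suc p else if q = Suc p then p else skip_pair p (m (drop_pair p q)))" for q
    have "matched (C @ [s]) m'"
    proof (rule matched_snoc[OF m])
      fix q assume "q < final_width 0 (C @ [s])"
      then have q: "q < ?w + 2" using Cup by simp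
      show "m' q < final_width 0 (C @ [s]) \<and> m' q \<noteq> q \<and> m' (m' q) = q"
      proof (cases "q = p \<or> q = Suc p")
        case True
        then show ?thesis using p Cup by (auto simp: m'_def)
      next
        case False
        then have d: "drop_pair p q < ?w" using drop q by blast
        have "skip_pair p (m (drop_pair p q)) \<noteq> q"
          using inv(2)[OF d] pair_cancel(1)[of p "m (drop_pair p q)"] by metis
        then show ?thesis
          using False Cup skip[OF inv(1)[OF d]] inv(3)[OF d] by (auto simp: m'_def pair_cancel)
      qed
    next
      fix \<sigma>' :: "nat \<Rightarrow> bool" assume s': "\<And>q. q < final_width 0 (C @ [s]) \<Longrightarrow> \<sigma>' (m' q) \<noteq> \<sigma>' q"
      have "\<sigma>' (skip_pair p (m q)) \<noteq> \<sigma>' (skip_pair p q)" if "q < ?w" for q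
        using s'[of "skip_pair p q"] skip[OF that] Cup by (simp add: m'_def pair_cancel)
      moreover have "\<sigma>' (Suc p) \<noteq> \<sigma>' p" using s'[of p] p Cup by (simp add: m'_def)
      ultimately show "\<exists>\<sigma>. (\<forall>q<?w. \<sigma> (m q) \<noteq> \<sigma> q) \<and>
        (\<forall>f. (\<forall>q<?w. f (length C, q) = \<sigma> q) \<longrightarrow> (\<forall>q. f (Suc (length C), q) = \<sigma>' q) \<longrightarrow>
          cons_slice (\<noteq>) f (length C) ?w s)"
        using p Cup by (intro exI[of _ "\<lambda>q. \<sigma>' (skip_pair p q)"]) auto
    qed
    then show ?thesis by blast
  next
    case (Crossing b p)
    have p: "p + 2 \<le> ?w" using snoc.prems Crossing by simp
    have sw: "swap_at p q < ?w" if "q < ?w" for q using that p by (auto simp: swap_at_def)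
    have ss: "swap_at p (swap_at p q) = q" for q by (auto simp: swap_at_def)
    have "matched (C @ [s]) (\<lambda>q. swap_at p (m (swap_at p q)))"
    proof (rule matched_snoc[OF m])
      fix q assume "q < final_width 0 (C @ [s])"
      then have q: "swap_at p q < ?w" using Crossing sw by simp
      show "swap_at p (m (swap_at p q)) < final_width 0 (C @ [s]) \<and> swap_at p (m (swap_at p q)) \<noteq> q \<and>
          swap_at p (m (swap_at p (swap_at p (m (swap_at p q))))) = q"
        using sw[OF inv(1)[OF q]] inv(2,3)[OF q] ss Crossing by (metis (no_types) append_Nil2 final_width_simps width_above.simps(3))
    next
      fix \<sigma>' :: "nat \<Rightarrow> bool" assume s': "\<And>q. q < final_width 0 (C @ [s]) \<Longrightarrow> \<sigma>' (swap_at p (m (swap_at p q))) \<noteq> \<sigma>' q"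
      have "\<sigma>' (swap_at p (m q)) \<noteq> \<sigma>' (swap_at p q)" if "q < ?w" for q
        using s'[of "swap_at p q"] sw[OF that] Crossing by (simp add: ss)
      then show "\<exists>\<sigma>. (\<forall>q<?w. \<sigma> (m q) \<noteq> \<sigma> q) \<and>
        (\<forall>f. (\<forall>q<?w. f (length C, q) = \<sigma> q) \<longrightarrow> (\<forall>q. f (Suc (length C), q) = \<sigma>' q) \<longrightarrow>
          cons_slice (\<noteq>) f (length C) ?w s)"
        using p Crossing by (intro exI[of _ "\<lambda>q. \<sigma>' (swap_at p q)"]) (auto simp: swap_at_def)
    qed
    then show ?thesis by blast
  next
    case (Cap p)
    have p: "p + 2 \<le> ?w" using snoc.prems Cap by simp
    have skip: "skip_pair p q < ?w" if "q < ?w - 2" for q using that by (auto simp: skip_pair_def)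
    have drop: "drop_pair p q < ?w - 2" if "q < ?w" "q \<noteq> p" "q \<noteq> Suc p" for q
      using that p by (auto simp: drop_pair_def)
    define a where "a = m p"
    define b where "b = m (Suc p)"
    have ab: "a < ?w" "b < ?w" "a \<noteq> p" "b \<noteq> Suc p" "m a = p" "m b = Suc p"
      using inv[of p] inv[of "Suc p"] p by (auto simp: a_def b_def)
    \<comment> \<open>The partners of the two joined strands become matched. If these strands are
      partners of each other, a component closes and \<open>n\<close> agrees with \<open>m\<close>
      on the remaining strands.\<close>
    define n where "n q = (if q = a then b else if q = b then a else m q)" for q
    have n: "n q < ?w" "n q \<noteq> p" "n q \<noteq> Suc p" "n q \<noteq> q" "n (n q) = q" if q: "q < ?w" "q \<noteq> p" "q \<noteq> Suc p" for q
    proof -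
      have neq: "a \<noteq> b" using ab(5,6) by (metis n_not_Suc_n)
      have pb: "a \<noteq> Suc p \<Longrightarrow> b \<noteq> p" "b \<noteq> p \<Longrightarrow> a \<noteq> Suc p" using ab(5,6) by (metis a_def b_def)+
      consider "q = a" | "q = b" "q \<noteq> a" | "q \<noteq> a" "q \<noteq> b" by blast
      then have "n q < ?w \<and> n q \<noteq> p \<and> n q \<noteq> Suc p \<and> n q \<noteq> q \<and> n (n q) = q"
      proof cases
        case 1
        then have "n q = b" "n b = q" using neq by (simp_all add: n_def)
        moreover have "b \<noteq> p" using pb(1) q(3) 1 by blast
        moreover have "b \<noteq> q" using neq 1 by blast
        ultimately show ?thesis using ab(2,4) by presburger
      next
        case 2
        then have "n q = a" "n a = q" by (simp_all add: n_def)
        moreover have "a \<noteq> Suc p" using pb(2) q(2) 2 by blast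
        moreover have "a \<noteq> q" using 2 by blast
        ultimately show ?thesis using ab(1,3) by presburger
      next
        case 3
        have "m q \<noteq> a" "m q \<noteq> b" using inv(3)[OF q(1)] q(2,3) ab(5,6) by metis+
        then have "n q = m q" "n (m q) = q" using 3 inv(3)[OF q(1)] by (simp_all add: n_def)
        moreover have "m q \<noteq> p" using 3(1) inv(3)[OF q(1)] by (metis a_def)
        moreover have "m q \<noteq> Suc p" using 3(2) inv(3)[OF q(1)] by (metis b_def)
        ultimately show ?thesis using inv(1,2)[OF q(1)] by presburger
      qed
      then show "n q < ?w" "n q \<noteq> p" "n q \<noteq> Suc p" "n q \<noteq> q" "n (n q) = q" by blast+
    qed
    define m' where "m' q = drop_pair p (n (skip_pair p q))" for q
    have "matched (C @ [s]) m'"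
    proof (rule matched_snoc[OF m])
      fix q assume "q < final_width 0 (C @ [s])"
      then have q: "skip_pair p q < ?w" using skip Cap by simp
      note nn = n[OF q pair_cancel(2,3)]
      have "drop_pair p (n (skip_pair p q)) \<noteq> q" using nn pair_cancel(4) by metis
      then show "m' q < final_width 0 (C @ [s]) \<and> m' q \<noteq> q \<and> m' (m' q) = q"
        using nn drop[OF nn(1-3)] Cap by (simp add: m'_def pair_cancel)
    next
      fix \<sigma>' :: "nat \<Rightarrow> bool" assume s': "\<And>q. q < final_width 0 (C @ [s]) \<Longrightarrow> \<sigma>' (m' q) \<noteq> \<sigma>' q"
      define \<tau> where "\<tau> q = \<sigma>' (drop_pair p q)" for q
      have \<tau>: "\<tau> (n q) \<noteq> \<tau> q" if "q < ?w" "q \<noteq> p" "q \<noteq> Suc p" for q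
        using s'[of "drop_pair p q"] drop[OF that] that Cap by (simp add: m'_def pair_cancel \<tau>_def)
      \<comment> \<open>A component closed by the cap may be oriented either way. Otherwise each
        joined strand is opposite to its partner, and this fits at the cap because
        \<open>\<tau>\<close> separates \<open>a\<close> from \<open>b\<close>.\<close>
      define \<sigma> where "\<sigma> q = (if a = Suc p then (if q = p then True else if q = Suc p then False else \<tau> q)
        else if q = p then \<not> \<tau> a else if q = Suc p then \<not> \<tau> b else \<tau> q)" for q
      have pp: "\<sigma> p \<noteq> \<sigma> (Suc p)"
      proof (cases "a = Suc p")
        case False
        then have "b \<noteq> p" using ab by (metis a_def)
        then have "\<tau> b \<noteq> \<tau> a" using \<tau>[of a] ab False by (simp add: n_def)
        then show ?thesis using False by (simp add: \<sigma>_def)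
      qed (simp add: \<sigma>_def)
      have "\<sigma> (m q) \<noteq> \<sigma> q" if "q < ?w" for q
      proof -
        consider "q = p" | "q = Suc p" | "q \<noteq> p" "q \<noteq> Suc p" "q = a" | "q \<noteq> p" "q \<noteq> Suc p" "q = b"
          | "q \<noteq> p" "q \<noteq> Suc p" "q \<noteq> a" "q \<noteq> b" by blast
        then show ?thesis
        proof cases
          case 1
          then show ?thesis using pp ab(3) unfolding a_def[symmetric] by (cases "a = Suc p") (auto simp: \<sigma>_def a_def[symmetric])
        next
          case 2
          have "a = Suc p \<longleftrightarrow> b = p" using ab by (metis a_def b_def)
          then show ?thesis using 2 pp ab(4) by (cases "b = p") (auto simp: \<sigma>_def b_def[symmetric])
        next
          case 3
          then show ?thesis using ab by (auto simp: \<sigma>_def)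
        next
          case 4
          then show ?thesis using ab by (metis \<sigma>_def b_def a_def n_not_Suc_n)
        next
          case 5
          then have "m q \<noteq> p" "m q \<noteq> Suc p" using inv(3)[OF that] by (metis a_def b_def)+
          then show ?thesis using \<tau>[OF that 5(1,2)] 5 by (simp add: n_def \<sigma>_def)
        qed
      qed
      moreover have "\<sigma> (skip_pair p q) = \<sigma>' q" for q
        by (simp add: \<sigma>_def \<tau>_def pair_cancel)
      ultimately show "\<exists>\<sigma>. (\<forall>q<?w. \<sigma> (m q) \<noteq> \<sigma> q) \<and>
        (\<forall>f. (\<forall>q<?w. f (length C, q) = \<sigma> q) \<longrightarrow> (\<forall>q. f (Suc (length C), q) = \<sigma>' q) \<longrightarrow>
          cons_slice (\<noteq>) f (length C) ?w s)"
        using p Cap pp skip by (intro exI[of _ \<sigma>]) auto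
    qed
    then show ?thesis by blast
  qed
qed

theorem orientation_exists:
  assumes "closes_from 0 D"
  shows "\<exists>f :: node \<Rightarrow> bool. cons_word (\<noteq>) f 0 0 D"
proof -
  obtain m where "matched D m" using matching_exists assms by (auto simp: closes_from_iff)
  then show ?thesis using assms by (auto simp: matched_def closes_from_iff)
qed

lemma cons_word_component:
  assumes "closes_from w D" "\<And>u m v. (u, m, v) \<in> arcs_from j w D \<Longrightarrow> c u = c v"
  shows "cons_word (=) c j w D"
  using assms
proof (induction D arbitrary: j w)
  case (Cons s D)
  have e: "c u = c v" if uv: "(u, v) \<in> slice_edges j w s" for u v
  proof -
    obtain m where "(u, m, v) \<in> slice_arcs j w s" using uv unfolding slice_edges_def by blast
    then have "(u, m, v) \<in> arcs_from j w (s # D)" by simp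
    then show ?thesis by (rule Cons.prems(2))
  qed
  have "cons_slice (=) c j w s"
  proof (cases s)
    case (Cup p)
    then have p: "p \<le> w" using Cons.prems by simp
    have "c (Suc j, p) = c (Suc j, Suc p)" by (rule e) (unfold Cup slice_edges_Cup[OF p], blast)
    moreover have "c (j, q) = c (Suc j, skip_pair p q)" if "q < w" for q
      by (rule e) (unfold Cup slice_edges_Cup[OF p], use that in blast)
    ultimately show ?thesis using Cup p by simp
  next
    case (Cap p)
    then have p: "p + 2 \<le> w" using Cons.prems by simp
    have "c (j, p) = c (j, Suc p)" by (rule e) (unfold Cap slice_edges_Cap[OF p], blast)
    moreover have "c (j, skip_pair p q) = c (Suc j, q)" if "q + 2 < w" for q
      by (rule e) (unfold Cap slice_edges_Cap[OF p], use that in blast)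
    ultimately show ?thesis using Cap p by simp
  next
    case (Crossing b p)
    then have p: "p + 2 \<le> w" using Cons.prems by simp
    have "c (j, q) = c (Suc j, swap_at p q)" if "q < w" for q
      by (rule e) (unfold Crossing slice_edges_Crossing[OF p], use that in blast)
    from this[of p] this[of "Suc p"] this show ?thesis using Crossing p by (simp add: swap_at_def)
  qed
  moreover have "cons_word (=) c (Suc j) (width_above w s) D"
    by (rule Cons.IH) (use Cons.prems(1) in simp, use Cons.prems(2) in \<open>simp, blast\<close>)
  ultimately show ?case by simp
qed simp

lemma cons_slice_pair: "cons_slice R f j w s \<Longrightarrow> cons_slice S g j w s \<Longrightarrow>
    cons_slice (\<lambda>x y. R (fst x) (fst y) \<and> S (snd x) (snd y)) (\<lambda>u. (f u, g u)) j w s"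
  by (cases s) auto

lemma cons_word_pair: "cons_word R f j w D \<Longrightarrow> cons_word S g j w D \<Longrightarrow>
    cons_word (\<lambda>x y. R (fst x) (fst y) \<and> S (snd x) (snd y)) (\<lambda>u. (f u, g u)) j w D"
  by (induction D arbitrary: j w) (auto simp: cons_slice_pair)

section \<open>Norm estimates\<close>

context path_model begin

text \<open>Finitely many paths represent the states on \<open>w\<close> strands: beyond the strands a path
  continues by a fixed rule, which is invariant under removing and inserting pairs of steps.\<close>

definition next_height :: "nat \<Rightarrow> nat" where
  "next_height y = (if y = 1 then 2 else y - 1)"

definition fpaths :: "nat \<Rightarrow> (nat \<Rightarrow> nat) set" where
  "fpaths w = {h \<in> paths. h 0 = 1 \<and> (\<forall>i\<ge>w. h (Suc i) = next_height (h i))}"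

lemma fpaths_pathsD: "h \<in> fpaths w \<Longrightarrow> h \<in> paths"
  by (simp add: fpaths_def)

lemma fpaths_eq:
  assumes "g \<in> fpaths w" "h \<in> fpaths w" "\<And>i. i \<le> w \<Longrightarrow> g i = h i"
  shows "g = h"
proof
  fix i show "g i = h i"
  proof (induction i)
    case (Suc i)
    then show ?case using assms by (cases "w \<le> i") (auto simp: fpaths_def not_le)
  qed (use assms in simp)
qed

lemma finite_fpaths [simp]: "finite (fpaths w)"
proof (rule inj_on_finite)
  show "inj_on (\<lambda>h. map h [0..<Suc w]) (fpaths w)"
  proof (rule inj_onI)
    fix g h assume gh: "g \<in> fpaths w" "h \<in> fpaths w" "map g [0..<Suc w] = map h [0..<Suc w]"
    then have "\<forall>i\<in>set [0..<Suc w]. g i = h i" by (simp only: map_eq_conv)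
    then show "g = h" using gh by (intro fpaths_eq[of g w h]) auto
  qed
  show "(\<lambda>h. map h [0..<Suc w]) ` fpaths w \<subseteq> {xs. set xs \<subseteq> {..<r} \<and> length xs = Suc w}"
    by (auto simp: fpaths_def paths_def simp del: upt_Suc)
  show "finite {xs. set xs \<subseteq> {..<r} \<and> length xs = Suc w}"
    by (rule finite_lists_length_eq) simp
qed

text \<open>This single walk is the reason why a norm bound on no strands is a bound on a
  number.\<close>

lemma fpaths_0: "fpaths 0 = {\<lambda>i. if even i then 1 else 2}"
proof -
  let ?h = "\<lambda>i::nat. if even i then 1 else 2 :: nat"
  have "?h \<in> fpaths 0" using r_ge_3 by (auto simp: fpaths_def paths_def nb_def next_height_def)
  moreover have "g = ?h" if "g \<in> fpaths 0" for g
    using that \<open>?h \<in> fpaths 0\<close> by (intro fpaths_eq[of g 0 ?h]) (auto simp: fpaths_def)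
  ultimately show ?thesis by blast
qed

definition ip :: "nat \<Rightarrow> vec \<Rightarrow> vec \<Rightarrow> complex" where
  "ip w \<phi> \<psi> = (\<Sum>h\<in>fpaths w. cnj (\<phi> h) * \<psi> h)"

definition nsq :: "nat \<Rightarrow> vec \<Rightarrow> real" where
  "nsq w \<psi> = (\<Sum>h\<in>fpaths w. (cmod (\<psi> h))\<^sup>2)"

lemma nsq_nonneg: "0 \<le> nsq w \<psi>"
  by (simp add: nsq_def sum_nonneg)

lemma ip_self: "ip w \<psi> \<psi> = of_real (nsq w \<psi>)"
  unfolding ip_def nsq_def of_real_sum
  by (intro sum.cong refl) (subst complex_norm_square, rule mult.commute)

lemma ip_cnj: "ip w \<psi> \<phi> = cnj (ip w \<phi> \<psi>)"
  by (simp add: ip_def mult.commute)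

lemma ip_right: "ip w \<phi> (\<lambda>h. s * \<psi> h + t * \<rho> h) = s * ip w \<phi> \<psi> + t * ip w \<phi> \<rho>"
  by (simp add: ip_def sum.distrib sum_distrib_left algebra_simps)

lemma ip_left: "ip w (\<lambda>h. s * \<psi> h + t * \<rho> h) \<phi> = cnj s * ip w \<psi> \<phi> + cnj t * ip w \<rho> \<phi>"
  by (simp add: ip_def sum.distrib sum_distrib_left algebra_simps)

lemma ip_scale_left: "ip w (\<lambda>h. s * \<psi> h) \<phi> = cnj s * ip w \<psi> \<phi>"
  using ip_left[of w s \<psi> 0 \<psi> \<phi>] by simp

lemma ip_scale_right: "ip w \<phi> (\<lambda>h. s * \<psi> h) = s * ip w \<phi> \<psi>"
  using ip_right[of w \<phi> s \<psi> 0 \<psi>] by simp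

lemma ip_bound: "(cmod (ip w \<phi> \<psi>))\<^sup>2 \<le> nsq w \<phi> * nsq w \<psi>"
proof -
  have "cmod (ip w \<phi> \<psi>) \<le> (\<Sum>h\<in>fpaths w. cmod (\<phi> h) * cmod (\<psi> h))"
    unfolding ip_def by (rule order_trans[OF norm_sum]) (simp add: norm_mult)
  then have "(cmod (ip w \<phi> \<psi>))\<^sup>2 \<le> (\<Sum>h\<in>fpaths w. cmod (\<phi> h) * cmod (\<psi> h))\<^sup>2"
    by (rule power_mono) simp
  also have "\<dots> \<le> nsq w \<phi> * nsq w \<psi>"
    unfolding nsq_def by (rule Cauchy_Schwarz_ineq_sum)
  finally show ?thesis .
qed

lemma insert_fpaths:
  assumes "h \<in> fpaths w" "p \<le> w" "x \<in> nb (h p)"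
  shows "insert_pair p x h \<in> fpaths (w + 2)"
proof -
  have "insert_pair p x h (Suc i) = next_height (insert_pair p x h i)" if "w + 2 \<le> i" for i
  proof -
    define k where "k = i - 2"
    have k: "i = k + 2" "w \<le> k" using that by (auto simp: k_def)
    then have "h (Suc k) = next_height (h k)" using assms(1) by (simp add: fpaths_def)
    then show ?thesis using assms(2) k by (simp add: insert_pair_def)
  qed
  then show ?thesis using assms insert_paths[of h x p] by (auto simp: fpaths_def insert_pair_def)
qed

lemma remove_fpaths:
  assumes "h \<in> fpaths (w + 2)" "p \<le> w" "h p = h (p + 2)"
  shows "remove_pair p h \<in> fpaths w"
proof -
  have "remove_pair p h (Suc i) = next_height (remove_pair p h i)" if "w \<le> i" for i
  proof -
    have "h (Suc (i + 2)) = next_height (h (i + 2))" using assms(1) that by (simp add: fpaths_def)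
    then show ?thesis using assms(2,3) that by (cases "i = p") (auto simp: remove_pair_def)
  qed
  then show ?thesis using assms remove_paths[of h p] by (auto simp: fpaths_def remove_pair_def)
qed

text \<open>Inserting a detour is a bijection from pairs of a walk and a neighbour of its height at
  \<open>p\<close> onto the walks with a detour there; up to sign the real weights in
  \<open>cup\<close> and \<open>cap\<close> agree.\<close>

lemma ip_cup:
  assumes "p \<le> w"
  shows "ip (w + 2) \<phi> (cup p \<psi>) = - ip w (cap p \<phi>) \<psi>"
proof -
  let ?S = "Sigma (fpaths w) (\<lambda>h. nb (h p))"
  have "- ip w (cap p \<phi>) \<psi> = (\<Sum>h\<in>fpaths w. \<Sum>x\<in>nb (h p). of_real (kap (h p) x) * cnj (\<phi> (insert_pair p x h)) * \<psi> h)"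
    unfolding ip_def sum_negf[symmetric]
    by (intro sum.cong refl) (simp add: cap_def fpaths_def sum_distrib_right sum_negf mult.assoc)
  also have "\<dots> = (\<Sum>(h, x)\<in>?S. of_real (kap (h p) x) * cnj (\<phi> (insert_pair p x h)) * \<psi> h)"
    by (rule sum.Sigma) auto
  also have "\<dots> = (\<Sum>h\<in>{h \<in> fpaths (w + 2). h p = h (p + 2)}. of_real (kap (h p) (h (Suc p))) * cnj (\<phi> h) * \<psi> (remove_pair p h))"
  proof (rule sum.reindex_bij_witness[where i = "\<lambda>h. (remove_pair p h, h (Suc p))" and j = "\<lambda>(h, x). insert_pair p x h"])
    fix a assume "a \<in> ?S"
    then obtain h x where a: "a = (h, x)" "h \<in> fpaths w" "x \<in> nb (h p)" by auto
    have 1: "remove_pair p (insert_pair p x h) = h" by (auto simp: remove_pair_def insert_pair_def fun_eq_iff)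
    have 2: "insert_pair p x h p = h p" "insert_pair p x h (Suc p) = x" "insert_pair p x h (p + 2) = h p"
      by (auto simp: insert_pair_def)
    show "(remove_pair p (case a of (h, x) \<Rightarrow> insert_pair p x h), (case a of (h, x) \<Rightarrow> insert_pair p x h) (Suc p)) = a"
      using a 1 2 by simp
    show "(case a of (h, x) \<Rightarrow> insert_pair p x h) \<in> {h \<in> fpaths (w + 2). h p = h (p + 2)}"
      using a insert_fpaths[OF a(2) assms a(3)] 2 by simp
    show "of_real (kap ((case a of (h, x) \<Rightarrow> insert_pair p x h) p) ((case a of (h, x) \<Rightarrow> insert_pair p x h) (Suc p))) *
        cnj (\<phi> (case a of (h, x) \<Rightarrow> insert_pair p x h)) * \<psi> (remove_pair p (case a of (h, x) \<Rightarrow> insert_pair p x h)) =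
        (case a of (h, x) \<Rightarrow> of_real (kap (h p) x) * cnj (\<phi> (insert_pair p x h)) * \<psi> h)"
      using a 1 2 by simp
  next
    fix h assume h: "h \<in> {h \<in> fpaths (w + 2). h p = h (p + 2)}"
    show "(case (remove_pair p h, h (Suc p)) of (h, x) \<Rightarrow> insert_pair p x h) = h"
    proof
      fix i show "(case (remove_pair p h, h (Suc p)) of (h, x) \<Rightarrow> insert_pair p x h) i = h i"
        using h by (cases i p rule: index_cases) (auto simp: remove_pair_def insert_pair_def)
    qed
    have "h \<in> paths" using h by (simp add: fpaths_def)
    then have "h (Suc p) \<in> nb (h p)" by (rule paths_nb)
    then show "(remove_pair p h, h (Suc p)) \<in> ?S"
      using remove_fpaths[of h w p] h assms by (auto simp: remove_pair_def)
  qed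
  also have "\<dots> = ip (w + 2) \<phi> (cup p \<psi>)"
    unfolding ip_def
    by (rule sum.mono_neutral_cong_left) (auto simp: cup_def dest: fpaths_pathsD)
  finally show ?thesis by simp
qed

lemma ip_cup':
  assumes "p + 2 \<le> w"
  shows "ip w \<phi> (cup p \<psi>) = - ip (w - 2) (cap p \<phi>) \<psi>"
proof -
  define v where "v = w - 2"
  have "w = v + 2" "p \<le> v" using assms by (auto simp: v_def)
  then show ?thesis using ip_cup[of p v \<phi> \<psi>] by simp
qed

lemma ip_E: "p + 2 \<le> w \<Longrightarrow> ip w \<phi> (cup p (cap p \<psi>)) = ip w (cup p (cap p \<phi>)) \<psi>"
  by (subst (2) ip_cnj) (simp add: ip_cup' ip_cnj[of _ "cap p \<phi>" "cap p \<psi>"])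

text \<open>Each correction term is a palindrome in self-adjoint operators, with the real
  coefficient \<open>qratio\<close>.\<close>

lemma ip_jw: "\<phi> \<in> space \<Longrightarrow> \<psi> \<in> space \<Longrightarrow> p + n \<le> w \<Longrightarrow> ip w \<phi> (jw n p \<psi>) = ip w (jw n p \<phi>) \<psi>"
proof (induction n arbitrary: \<phi> \<psi> rule: jw.induct)
  case (3 n)
  have q: "cnj (qratio n) = qratio n" by (simp add: qratio_def)
  let ?e = "\<lambda>\<psi>. cup (p + n) (cap (p + n) (jw (Suc n) p \<psi>))"
  have "ip w \<phi> (jw (Suc n) p (?e \<psi>)) = ip w (jw (Suc n) p \<phi>) (?e \<psi>)" using 3 by simp
  also have "\<dots> = ip w (?e \<phi>) (jw (Suc n) p \<psi>)" using 3 by (intro ip_E) auto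
  also have "\<dots> = ip w (jw (Suc n) p (?e \<phi>)) \<psi>" using 3 by simp
  finally have "ip w \<phi> (jw (Suc n) p (?e \<psi>)) = ip w (jw (Suc n) p (?e \<phi>)) \<psi>" .
  moreover have "ip w \<phi> (jw (Suc n) p \<psi>) = ip w (jw (Suc n) p \<phi>) \<psi>" using 3 by simp
  ultimately show ?case
    using ip_right[of w \<phi> 1 "jw (Suc n) p \<psi>" "qratio n" "jw (Suc n) p (?e \<psi>)"]
      ip_left[of w 1 "jw (Suc n) p \<phi>" "qratio n" "jw (Suc n) p (?e \<phi>)" \<psi>] q
    by (simp add: jw_SS)
qed simp_all

lemma nsq_jw_le:
  assumes "n < r" "\<psi> \<in> space" "p + n \<le> w"
  shows "nsq w (jw n p \<psi>) \<le> nsq w \<psi>"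
proof -
  let ?f = "jw n p \<psi>"
  have a: "ip w \<psi> ?f = ip w ?f ?f"
    using ip_jw[OF assms(2) jw_space[OF assms(2), of n p] assms(3)] jw_absorb_left[OF assms(1) le_refl assms(2), of p] by simp
  then have b: "ip w ?f \<psi> = ip w ?f ?f" by (metis ip_cnj)
  \<comment> \<open>Pythagoras: the vector is the sum of its projection and an orthogonal
    rest.\<close>
  have "of_real (nsq w (\<lambda>h. 1 * \<psi> h + (-1) * ?f h)) = (of_real (nsq w \<psi> - nsq w ?f) :: complex)"
    unfolding ip_self[symmetric] ip_left ip_right of_real_diff using a b by simp
  then have "nsq w (\<lambda>h. 1 * \<psi> h + (-1) * ?f h) = nsq w \<psi> - nsq w ?f" by (simp only: of_real_eq_iff)
  then show ?thesis using nsq_nonneg[of w "\<lambda>h. 1 * \<psi> h + (-1) * ?f h"] by simp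
qed

lemma crs_coeff_cnj: "cnj (crs_coeff b) = crs_coeff (\<not> b)"
proof -
  have "A * cnj A = 1" using complex_norm_square[of A] by simp
  then have "cnj A = inverse A" by (metis inverse_unique)
  then show ?thesis by (auto simp: crs_coeff_def)
qed

text \<open>By \<open>E^2 = - [2] E\<close>, the multiple of \<open>E\<close> in the product of the
  crossing with its adjoint is \<open>A^2 + A^(-2) - [2] = 0\<close>.\<close>

lemma nsq_crs:
  assumes "p + 2 \<le> w" "\<psi> \<in> space"
  shows "nsq w (crs b p \<psi>) = nsq w \<psi>"
proof -
  let ?e = "cup p (cap p \<psi>)" and ?c = "crs_coeff b" and ?d = "crs_coeff (\<not> b)"
  have e: "ip w ?e \<psi> = ip w \<psi> ?e" using ip_E[OF assms(1), of \<psi> \<psi>] by simp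
  have ee: "ip w ?e ?e = - of_real (qint 2) * ip w \<psi> ?e"
  proof -
    have "cup p (cap p ?e) = (\<lambda>h. - of_real (qint 2) * ?e h)"
      unfolding cap_cup_loop[OF cap_space] by (rule cup_scale)
    then show ?thesis
      using ip_E[OF assms(1), of \<psi> ?e] ip_scale_right[of w \<psi> "- of_real (qint 2)" ?e] by simp
  qed
  have "ip w (crs b p \<psi>) (crs b p \<psi>) =
     ?d * (?c * ip w \<psi> \<psi> + ?d * ip w \<psi> ?e) + ?c * (?c * ip w ?e \<psi> + ?d * ip w ?e ?e)"
    unfolding slice_act.simps(3) ip_left ip_right crs_coeff_cnj by simp
  also have "\<dots> = (?c * ?d) * ip w \<psi> \<psi> + (?c * ?c + ?d * ?d - (?c * ?d) * of_real (qint 2)) * ip w \<psi> ?e"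
    unfolding e ee by (simp add: algebra_simps del: crs_coeff_mult)
  finally have "ip w (crs b p \<psi>) (crs b p \<psi>) = ip w \<psi> \<psi>"
    unfolding crs_coeff_mult crs_coeff_loop by simp
  then show ?thesis by (simp add: ip_self)
qed

lemma nsq_row: "\<psi> \<in> space \<Longrightarrow> p + l + 1 \<le> w \<Longrightarrow> nsq w (row b l p \<psi>) = nsq w \<psi>"
  by (induction l) (auto simp: nsq_crs)

lemma nsq_cross: "\<psi> \<in> space \<Longrightarrow> P + m + l \<le> w \<Longrightarrow> nsq w (cross b m l P \<psi>) = nsq w \<psi>"
  by (induction m arbitrary: \<psi>) (auto simp: nsq_row)

lemma ip_cups: "P \<le> w \<Longrightarrow> ip (w + 2 * n) \<phi> (cups n P \<psi>) = (-1) ^ n * ip w (caps n P \<phi>) \<psi>"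
proof (induction n arbitrary: \<phi>)
  case (Suc n)
  then show ?case using ip_cup[of "P + n" "w + 2 * n" \<phi> "cups n P \<psi>"] by (simp add: add.commute)
qed simp

text \<open>Moving the cups to the other side as caps turns the squared norm into the coloured loop
  value of \<open>jw_trace\<close>; the two signs \<open>(-1) ^ n\<close> cancel.\<close>

lemma nsq_jw_cups:
  assumes "n < r" "\<psi> \<in> space" "P \<le> w"
  shows "nsq (w + 2 * n) (jw n P (cups n P \<psi>)) = qint (Suc n) * nsq w \<psi>"
proof -
  let ?f = "jw n P (cups n P \<psi>)"
  have s: "cups n P \<psi> \<in> space" using assms by simp
  have "ip (w + 2 * n) ?f ?f = ip (w + 2 * n) (jw n P ?f) (cups n P \<psi>)"
    using assms by (intro ip_jw) auto
  also have "jw n P ?f = ?f" using jw_absorb_left[OF assms(1) le_refl s] .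
  also have "ip (w + 2 * n) ?f (cups n P \<psi>) = (-1) ^ n * ip w (caps n P ?f) \<psi>"
    by (rule ip_cups[OF assms(3)])
  also have "caps n P ?f = (\<lambda>h. (-1) ^ n * of_real (qint (Suc n)) * \<psi> h)"
    by (rule jw_trace[OF assms(1,2)])
  also have "(-1) ^ n * ip w (\<lambda>h. (-1) ^ n * of_real (qint (Suc n)) * \<psi> h) \<psi> = of_real (qint (Suc n)) * ip w \<psi> \<psi>"
    unfolding ip_scale_left by (simp flip: power_mult_distrib mult.assoc)
  finally have "complex_of_real (nsq (w + 2 * n) ?f) = of_real (qint (Suc n) * nsq w \<psi>)"
    unfolding ip_self by simp
  then show ?thesis by (simp only: of_real_eq_iff)
qed

text \<open>The bound for the adjoint operator: Cauchy-Schwarz against the coloured cup applied to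
  the result, then division by the squared norm of the result.\<close>

lemma nsq_caps_jw:
  assumes "Suc n < r" "\<phi> \<in> space" "P \<le> w"
  shows "nsq w (caps n P (jw n P \<phi>)) \<le> qint (Suc n) * nsq (w + 2 * n) \<phi>"
proof -
  let ?c = "caps n P (jw n P \<phi>)"
  have s: "?c \<in> space" using assms by simp
  have "(-1) ^ n * ip w ?c ?c = ip (w + 2 * n) (jw n P \<phi>) (cups n P ?c)"
    by (rule ip_cups[OF assms(3), symmetric])
  also have "\<dots> = ip (w + 2 * n) \<phi> (jw n P (cups n P ?c))"
    using assms s by (intro ip_jw[symmetric]) auto
  finally have e: "ip (w + 2 * n) \<phi> (jw n P (cups n P ?c)) = (-1) ^ n * ip w ?c ?c" by simp
  have "cmod ((-1) ^ n * ip w ?c ?c) = nsq w ?c"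
    using nsq_nonneg[of w ?c] by (simp add: norm_mult norm_power ip_self)
  then have "(nsq w ?c)\<^sup>2 \<le> nsq (w + 2 * n) \<phi> * (qint (Suc n) * nsq w ?c)"
    using ip_bound[of "w + 2 * n" \<phi> "jw n P (cups n P ?c)"] nsq_jw_cups[OF _ s assms(3), of n] assms(1)
    unfolding e by simp
  then have "nsq w ?c * nsq w ?c \<le> (qint (Suc n) * nsq (w + 2 * n) \<phi>) * nsq w ?c"
    by (simp add: power2_eq_square mult_ac)
  then show ?thesis
  proof (cases "nsq w ?c = 0")
    case True
    then show ?thesis using nsq_nonneg[of "w + 2 * n" \<phi>] qint_pos[of "Suc n"] assms(1) by simp
  next
    case False
    then have "nsq w ?c > 0" using nsq_nonneg[of w ?c] by simp
    then show ?thesis using \<open>nsq w ?c * nsq w ?c \<le> _\<close> by (rule mult_right_le_imp_le[rotated])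
  qed
qed

lemma nsq_lops_jw:
  assumes "\<And>u. n u < r" "\<psi> \<in> space" "P + sum_list (map n us) \<le> w"
  shows "nsq w (lops n (\<lambda>u. jw (n u)) us P \<psi>) \<le> nsq w \<psi>"
  using assms(3)
proof (induction us arbitrary: P)
  case (Cons u us)
  have s: "lops n (\<lambda>u. jw (n u)) us (P + n u) \<psi> \<in> space"
    by (rule mor1_space[OF mor1_lops assms(2)]) (rule mor1_jw)
  have "nsq w (jw (n u) P (lops n (\<lambda>u. jw (n u)) us (P + n u) \<psi>)) \<le> nsq w (lops n (\<lambda>u. jw (n u)) us (P + n u) \<psi>)"
    by (rule nsq_jw_le[OF assms(1) s]) (use Cons.prems in simp)
  also have "\<dots> \<le> nsq w \<psi>" using Cons by simp
  finally show ?case by simp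
qed simp

text \<open>The exponent counts the slices before cabling: a cabled crossing preserves norms, and a
  whole bundle of cups or caps costs one quantum integer.\<close>

theorem nsq_ev_le:
  assumes "cons_word (=) n j w D" "final_width w D = 0" "\<And>u. Suc (n u) < r" "\<psi> \<in> space"
  shows "nsq 0 (ev n (\<lambda>u. jw (n u)) j w D \<psi>) \<le> real r ^ length D * nsq (off n j w) (ln n (\<lambda>u. jw (n u)) j w \<psi>)"
  using assms(1,2,4)
proof (induction D arbitrary: j w \<psi>)
  case Nil
  then show ?case by (simp add: off_def)
next
  case (Cons s D)
  let ?X = "\<lambda>u. jw (n u)"
  let ?w = "width_above w s"
  have nr: "n u < r" for u using assms(3)[of u] by simp
  have idem: "fam_eq (fam_comp (?X u) (?X u)) (?X u)" for u
    using jw_absorb_left[OF nr le_refl] by (intro fam_eqI) (simp add: fam_simps)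
  have m: "mor1 (n u) (n u) (?X u)" for u by (rule mor1_jw)
  have qr: "qint (Suc (n u)) \<le> real r" for u
    using qint_le[of "Suc (n u)"] assms(3)[of u] by simp
  define \<phi> where "\<phi> = ln n ?X j w \<psi>"
  have \<phi>: "\<phi> \<in> space" unfolding \<phi>_def ln_def by (rule mor1_space[OF mor1_lops[OF m] Cons.prems(3)])
  have cs: "cons_slice (=) n j w s" using Cons.prems by simp
  have contr: "nsq (off n (Suc j) v) (ln n ?X (Suc j) v \<phi>') \<le> nsq (off n (Suc j) v) \<phi>'" if "\<phi>' \<in> space" for v \<phi>'
    unfolding ln_def by (rule nsq_lops_jw[OF nr that]) (simp add: sum_list_line)
  have key: "nsq (off n (Suc j) ?w) (ln n ?X (Suc j) ?w (sop n j s \<phi>)) \<le> real r * nsq (off n j w) \<phi>"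
  proof (cases s)
    case (Cup p)
    have p: "p \<le> w" using cs Cup by simp
    let ?P = "off n j p" and ?m = "n (Suc j, p)"
    have o: "off n (Suc j) (w + 2) = off n j w + 2 * ?m" "off n (Suc j) p = ?P"
      using off_Cup_right[OF cs[unfolded Cup], of w] off_Cup_left[OF cs[unfolded Cup], of p] p by auto
    have l: "line (Suc j) (w + 2) = line (Suc j) p @ (Suc j, p) # (Suc j, Suc p) # map (Pair (Suc j)) [p + 2..<w + 2]"
      using line_split_2[of p "w + 2" "Suc j"] p by simp
    have c: "cups ?m ?P \<phi> \<in> space" using \<phi> by simp
    \<comment> \<open>The coupon on the left leg of the new bundle may act at once, which exposes
      the coloured cup of \<open>nsq_jw_cups\<close>.\<close>
    have "ln n ?X (Suc j) (w + 2) (cups ?m ?P \<phi>) = ln n ?X (Suc j) (w + 2) (jw ?m ?P (cups ?m ?P \<phi>))"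
      unfolding ln_def l
      using lops_absorb_in[where w = n and X = ?X and x = "(Suc j, p)" and P = 0 and L = "line (Suc j) p"
          and R = "(Suc j, Suc p) # map (Pair (Suc j)) [p + 2..<w + 2]", OF m idem c]
      by (simp add: sum_list_line o)
    then have "nsq (off n (Suc j) (w + 2)) (ln n ?X (Suc j) (w + 2) (cups ?m ?P \<phi>))
        \<le> nsq (off n j w + 2 * ?m) (jw ?m ?P (cups ?m ?P \<phi>))"
      using contr[of "jw ?m ?P (cups ?m ?P \<phi>)" "w + 2"] c unfolding o(1) by simp
    also have "\<dots> = qint (Suc ?m) * nsq (off n j w) \<phi>"
      by (rule nsq_jw_cups[OF nr \<phi> off_mono[OF p]])
    also have "\<dots> \<le> real r * nsq (off n j w) \<phi>"
      by (rule mult_right_mono[OF qr nsq_nonneg])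
    finally show ?thesis unfolding Cup by simp
  next
    case (Cap p)
    have p: "p + 2 \<le> w" using cs Cap by simp
    let ?P = "off n j p" and ?m = "n (j, p)"
    have e: "w - 2 + 2 = w" using p by simp
    have o: "off n j w = off n (Suc j) (w - 2) + 2 * ?m" "off n (Suc j) p = ?P"
      using off_Cap_right[OF cs[unfolded Cap], of "w - 2", unfolded e] off_Cap_left[OF cs[unfolded Cap], of p] p by auto
    have l: "line j w = line j p @ (j, p) # (j, Suc p) # map (Pair j) [p + 2..<w]"
      using line_split_2[OF p, of j] by simp
    \<comment> \<open>The line below the cap has applied this idempotent already, so the cap is a
      coloured one.\<close>
    have "jw ?m ?P \<phi> = \<phi>"
      unfolding \<phi>_def ln_def l
      using lops_absorb_out[where w = n and X = ?X and x = "(j, p)" and P = 0 and L = "line j p"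
          and R = "(j, Suc p) # map (Pair j) [p + 2..<w]", OF m idem Cons.prems(3)]
      by (simp add: sum_list_line)
    moreover have "?P \<le> off n (Suc j) (w - 2)" using off_mono[of p "w - 2" n "Suc j"] p o(2) by simp
    ultimately have "nsq (off n (Suc j) (w - 2)) (caps ?m ?P \<phi>) \<le> qint (Suc ?m) * nsq (off n j w) \<phi>"
      using nsq_caps_jw[OF assms(3) \<phi>, of ?P "off n (Suc j) (w - 2)" "(j, p)"] o(1) by simp
    also have "\<dots> \<le> real r * nsq (off n j w) \<phi>"
      by (rule mult_right_mono[OF qr nsq_nonneg])
    finally show ?thesis
      using contr[of "caps ?m ?P \<phi>" "w - 2"] \<phi> unfolding Cap by simp
  next
    case (Crossing b p)
    have p: "p + 2 \<le> w" using cs Crossing by simp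
    have o: "off n (Suc j) w = off n j w" using off_Crossing_right[OF cs[unfolded Crossing] p] by simp
    have "off n j p + n (j, p) + n (j, Suc p) \<le> off n j w" using off_mono[OF p, of n j] by simp
    then have "nsq (off n j w) (sop n j s \<phi>) = nsq (off n j w) \<phi>"
      using nsq_cross[OF \<phi>] Crossing by simp
    moreover have "nsq (off n j w) \<phi> \<le> real r * nsq (off n j w) \<phi>"
      using nsq_nonneg[of "off n j w" \<phi>] r_ge_3 by (simp add: mult_le_cancel_right1)
    ultimately show ?thesis
      using contr[of "sop n j s \<phi>" w] \<phi> o Crossing by simp
  qed
  have "nsq 0 (ev n ?X j w (s # D) \<psi>) \<le> real r ^ length D * nsq (off n (Suc j) ?w) (ln n ?X (Suc j) ?w (sop n j s \<phi>))"
    unfolding ev.simps \<phi>_def[symmetric] by (rule Cons.IH) (use Cons.prems \<phi> in auto)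
  also have "\<dots> \<le> real r ^ length D * (real r * nsq (off n j w) \<phi>)"
    by (rule mult_left_mono[OF key]) simp
  finally show ?case by (simp add: \<phi>_def mult_ac)
qed

end

section \<open>Fusion along a component\<close>

definition opposite :: "nat \<times> bool \<Rightarrow> nat \<times> bool \<Rightarrow> bool" where
  "opposite x y \<longleftrightarrow> fst x = fst y \<and> snd x \<noteq> snd y"

context path_model begin

text \<open>Rotation reverses composites and respects equality of operators, by
  \<open>mor_dual_unique\<close>.\<close>

lemma dual_comp_eq:
  assumes "mor a b g g'" "mor b c f f'" "mor a c h h'" "fam_eq (fam_comp f g) h"
  shows "fam_eq (fam_comp g' f') h'"
  by (rule fam_eqI) (rule mor_dual_unique[OF mor.fam_comp[OF assms(1,2)] assms(3) fam_eqD[OF assms(4)]])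

text \<open>Component \<open>k\<close> carries \<open>jv k\<close> strands under an idempotent and
  \<open>bv k\<close> plain ones, that is \<open>e_poly (jv k)\<close> times
  \<open>z ^ bv k\<close>. On strands running down the picture is turned round, and the plain
  strands come first.\<close>

definition colour :: "(nat \<Rightarrow> nat) \<Rightarrow> (nat \<Rightarrow> nat) \<Rightarrow> nat \<times> bool \<Rightarrow> family" where
  "colour jv bv x = (if snd x then jw (jv (fst x)) else fam_at (jw (jv (fst x))) (bv (fst x)))"

definition width :: "(nat \<Rightarrow> nat) \<Rightarrow> (nat \<Rightarrow> nat) \<Rightarrow> nat \<times> bool \<Rightarrow> nat" where
  "width jv bv x = jv (fst x) + bv (fst x)"

lemma mor_jw_pad: "j < r \<Longrightarrow> mor (j + b) (j + b) (jw j) (fam_at (jw j) b)"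
  using mor_embed[OF mor_jw, of j 0 b] by (simp add: fam_at_simps)

lemma jw_idem: "j < r \<Longrightarrow> fam_eq (fam_comp (jw j) (jw j)) (jw j)"
  using jw_absorb_left[of j j] by (intro fam_eqI) (simp add: fam_simps)

lemma jw_idem_at: "j < r \<Longrightarrow> fam_eq (fam_comp (fam_at (jw j) b) (fam_at (jw j) b)) (fam_at (jw j) b)"
  using jw_absorb_left[of j j] by (intro fam_eqI) (simp add: fam_simps)

context
  fixes jv bv :: "nat \<Rightarrow> nat" and k0 :: nat
  assumes jv: "\<And>k. jv k < r"
begin

definition wk :: "nat \<Rightarrow> nat \<times> bool \<Rightarrow> nat" where
  "wk W x = (if fst x = k0 then W else width jv bv x)"

text \<open>Isolates component \<open>k0\<close>, whose coupon and its rotation vary while all other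
  components keep their colours.\<close>

definition fk :: "family \<Rightarrow> family \<Rightarrow> nat \<times> bool \<Rightarrow> family" where
  "fk f f' x = (if fst x = k0 then if snd x then f else f' else colour jv bv x)"

lemma mor_fk:
  assumes "mor W W f f'" "opposite x y"
  shows "mor (wk W x) (wk W x) (fk f f' x) (fk f f' y)"
  using assms(2) assms(1) mor_sym[OF assms(1)] mor_jw_pad[OF jv[of "fst y"], of "bv (fst y)"]
    mor_sym[OF mor_jw_pad[OF jv[of "fst y"], of "bv (fst y)"]]
  by (auto simp: opposite_def wk_def fk_def colour_def width_def)

lemma mor1_fk: "mor W W f f' \<Longrightarrow> mor1 (wk W x) (wk W x) (fk f f' x)"
  using mor_fk[of W f f' x "(fst x, \<not> snd x)"] by (auto simp: opposite_def intro: mor1I)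

lemma wk_opposite: "opposite x y \<Longrightarrow> wk W x = wk W y"
  by (simp add: opposite_def wk_def width_def)

lemma fk_comp:
  assumes "fam_eq (fam_comp f g) h" "fam_eq (fam_comp f' g') h'"
  shows "fam_eq (fam_comp (fk f f' x) (fk g g' x)) (fk h h' x)"
  using assms jw_idem[OF jv] jw_idem_at[OF jv] by (simp add: fk_def colour_def)

lemma split_component:
  assumes D: "link_diagram D" "cons_word opposite lab 0 0 D"
    and conn: "\<And>u v. u \<in> nodes D \<Longrightarrow> v \<in> nodes D \<Longrightarrow> fst (lab u) = fst (lab v) \<longleftrightarrow> (u, v) \<in> (adjacent D)\<^sup>*"
    and k0: "\<exists>u\<in>nodes D. fst (lab u) = k0"
    and m: "mor W W f f'" "mor W W p p'" "mor W W q q'"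
    and alg: "fam_eq (fam_comp p p) p" "fam_eq (fam_comp q q) q"
      "fam_eq (fam_comp p f) p" "fam_eq (fam_comp f p) p" "fam_eq (fam_comp q f) q" "fam_eq (fam_comp f q) q"
    and sum: "fam_eq f (fam_lin 1 p 1 q)"
    and \<psi>: "\<psi> \<in> space"
  shows "ev (\<lambda>u. wk W (lab u)) (\<lambda>u. fk f f' (lab u)) 0 0 D \<psi> =
    (\<lambda>h. ev (\<lambda>u. wk W (lab u)) (\<lambda>u. fk p p' (lab u)) 0 0 D \<psi> h +
         ev (\<lambda>u. wk W (lab u)) (\<lambda>u. fk q q' (lab u)) 0 0 D \<psi> h)"
proof -
  let ?w = "\<lambda>u. wk W (lab u)"
  obtain u0 where u0: "u0 \<in> nodes D" "fst (lab u0) = k0" using k0 by blast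
  define N where "N = {u \<in> nodes D. fst (lab u) = k0}"
  have lines: "u \<in> lines 0 0 D \<Longrightarrow> u \<in> nodes D" for u using lines_subset_nodes[OF D(1)] by blast
  have nodes: "nodes D \<subseteq> lines 0 0 D"
  proof
    fix u assume "u \<in> nodes D"
    then obtain m v where "(u, m, v) \<in> arcs_from 0 0 D \<or> (v, m, u) \<in> arcs_from 0 0 D"
      unfolding nodes_def Field_def adjacent_def arcs_def by blast
    then show "u \<in> lines 0 0 D" using edges_lines[of 0 D] D(1) unfolding link_diagram_def by blast
  qed
  have finl: "finite (lines j w E)" for j w E by (induction E arbitrary: j w) auto
  then have finN: "finite N" using finite_subset[OF nodes] by (simp add: N_def)
  have conN: "\<And>u. u \<in> N \<Longrightarrow> (u0, u) \<in> (adjacent D)\<^sup>*" using conn[OF u0(1)] u0(2) unfolding N_def by blast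
  have stepN: "v \<in> N" if "u \<in> N" "(u, v) \<in> adjacent D" for u v
  proof -
    have "v \<in> nodes D" using that(2) by (rule edge_nodes)
    then show ?thesis using that conn[of u v] by (auto simp: N_def)
  qed
  have spread: "ev ?w (\<lambda>u. fk g g' (lab u)) 0 0 D \<psi> = ev ?w (coupons lab (fk f f') (fk g g') {u0}) 0 0 D \<psi>"
    if g: "mor W W g g'" "fam_eq (fam_comp g g) g" "fam_eq (fam_comp g f) g" "fam_eq (fam_comp f g) g" for g g'
  proof -
    \<comment> \<open>The strands of the component that run down carry the rotations, which obey the
      same identities in reverse order.\<close>
    have d: "fam_eq (fam_comp g' g') g'" "fam_eq (fam_comp f' g') g'" "fam_eq (fam_comp g' f') g'"
      using dual_comp_eq[OF g(1) g(1) g(1) g(2)] dual_comp_eq[OF g(1) m(1) g(1) g(4)] dual_comp_eq[OF m(1) g(1) g(1) g(3)]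
      by auto
    have "ev ?w (coupons lab (fk f f') (fk g g') N) 0 0 D \<psi> = ev ?w (coupons lab (fk f f') (fk g g') {u0}) 0 0 D \<psi>"
    proof (rule spreads_component[where opp = opposite and wl = "wk W" and F = "fk f f'" and G = "fk g g'"])
      show "cons_word opposite lab 0 0 D" by (rule D(2))
      show "finite N" "u0 \<in> N" "\<psi> \<in> space" using finN u0 \<psi> by (simp_all add: N_def)
      show "(u0, u) \<in> (adjacent D)\<^sup>*" if "u \<in> N" for u using conN that by blast
      show "v \<in> N" if "u \<in> N" "(u, v) \<in> adjacent D" for u v using stepN that by blast
      show "wk W x = wk W y" if "opposite x y" for x y using wk_opposite that by blast
      show "mor1 (wk W x) (wk W x) (fk f f' x)" "mor1 (wk W x) (wk W x) (fk g g' x)" for x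
        by (rule mor1_fk[OF m(1)], rule mor1_fk[OF g(1)])
      show "mor (wk W x) (wk W x) (fk g g' x) (fk g g' y)" if "opposite x y" for x y by (rule mor_fk[OF g(1) that])
      show "fam_eq (fam_comp (fk g g' x) (fk g g' x)) (fk g g' x)" for x by (rule fk_comp[OF g(2) d(1)])
      show "fam_eq (fam_comp (fk f f' x) (fk g g' x)) (fk g g' x)" for x by (rule fk_comp[OF g(4) d(2)])
      show "fam_eq (fam_comp (fk g g' x) (fk f f' x)) (fk g g' x)" for x by (rule fk_comp[OF g(3) d(3)])
    qed
    moreover have "ev ?w (coupons lab (fk f f') (fk g g') N) 0 0 D \<psi> = ev ?w (\<lambda>u. fk g g' (lab u)) 0 0 D \<psi>"
      by (rule ev_eq_lines) (simp add: coupons_def N_def fk_def lines)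
    ultimately show ?thesis by simp
  qed
  \<comment> \<open>The node \<open>u0\<close> may lie on a strand running down, where the rotated
    sum is needed.\<close>
  have dsum: "fam_eq f' (fam_lin 1 p' 1 q')"
    by (rule fam_eqI) (rule mor_dual_unique[OF m(1) mor.fam_lin[OF m(2,3)] fam_eqD[OF sum]])
  have "ev ?w (\<lambda>u. fk f f' (lab u)) 0 0 D \<psi> =
    (\<lambda>h. ev ?w (coupons lab (fk f f') (fk p p') {u0}) 0 0 D \<psi> h + ev ?w (coupons lab (fk f f') (fk q q') {u0}) 0 0 D \<psi> h)"
  proof (rule ev_split[where ?u0.0 = u0])
    show "u0 \<in> lines 0 0 D" using u0 nodes by blast
    fix P \<phi> assume "\<phi> \<in> space"
    then show "fk f f' (lab u0) P \<phi> = (\<lambda>h. coupons lab (fk f f') (fk p p') {u0} u0 P \<phi> h + coupons lab (fk f f') (fk q q') {u0} u0 P \<phi> h)"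
      using fam_eqD[OF sum, of \<phi> P] fam_eqD[OF dsum, of \<phi> P] u0 by (simp add: fk_def coupons_def fam_simps)
  qed (auto simp: coupons_def mor1_fk[OF m(1)] mor1_fk[OF m(2)] mor1_fk[OF m(3)] \<psi>)
  then show ?thesis using spread[OF m(2) alg(1,3,4)] spread[OF m(3) alg(2,5,6)] by simp
qed

definition tk :: "family \<Rightarrow> family \<Rightarrow> nat \<times> bool \<Rightarrow> family" where
  "tk f f' x = (if fst x = k0 then if snd x then f else f' else fam_id)"

text \<open>Factoring an idempotent through a smaller object replaces that object for the whole component.\<close>

lemma transfer_component:
  assumes D: "link_diagram D" "cons_word opposite lab 0 0 D"
    and U: "mor a c U U'" and V: "mor c a V V'" and g: "mor a a g g'"
    and VU: "fam_eq (fam_comp V U) g" and gg: "fam_eq (fam_comp g g) g" and gV: "fam_eq (fam_comp g V) V"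
    and \<psi>: "\<psi> \<in> space"
  shows "ev (\<lambda>u. wk c (lab u)) (\<lambda>u. fk (fam_comp U V) (fam_comp V' U') (lab u)) 0 0 D \<psi> =
    ev (\<lambda>u. wk a (lab u)) (\<lambda>u. fk g g' (lab u)) 0 0 D \<psi>"
proof -
  define q where "q = fam_comp U V"
  define q' where "q' = fam_comp V' U'"
  have q: "mor c c q q'" unfolding q_def q'_def by (rule mor.fam_comp[OF V U])
  have m1: "mor1 a c U" "mor1 c a V" "mor1 a a g" "mor1 c c q" using U V g q by (auto intro: mor1I)
  have m1': "mor1 c a U'" "mor1 a c V'" "mor1 a a g'" "mor1 c c q'"
    using mor_sym[OF U] mor_sym[OF V] mor_sym[OF g] mor_sym[OF q] by (auto intro: mor1I)
  have UV: "q P \<phi> = U P (V P \<phi>)" "q' P \<phi> = V' P (U' P \<phi>)" for P \<phi> by (simp_all add: q_def q'_def fam_simps)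
  have VUe: "V P (U P \<phi>) = g P \<phi>" if "\<phi> \<in> space" for P \<phi> using fam_eqD[OF VU that, of P] by (simp add: fam_simps)
  have gVe: "g P (V P \<phi>) = V P \<phi>" if "\<phi> \<in> space" for P \<phi> using fam_eqD[OF gV that, of P] by (simp add: fam_simps)
  have gge: "g P (g P \<phi>) = g P \<phi>" if "\<phi> \<in> space" for P \<phi> using fam_eqD[OF gg that, of P] by (simp add: fam_simps)
  have qq: "fam_eq (fam_comp q q) q"
    using VUe gVe mor1_space[OF m1(2)] by (intro fam_eqI) (simp add: fam_simps UV)
  have qqe: "q P (q P \<phi>) = q P \<phi>" if "\<phi> \<in> space" for P \<phi> using fam_eqD[OF qq that, of P] by (simp add: fam_simps)
  have i: "fam_eq (fam_comp q U) (fam_comp U g)"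
    using VUe by (intro fam_eqI) (simp add: fam_simps UV)
  \<comment> \<open>Strands running down use the rotation of \<open>V\<close> where upward strands
    use \<open>U\<close>, so here the intertwining law of \<open>V\<close> gets rotated.\<close>
  have "fam_eq (fam_comp V q) (fam_comp g V)"
    using VUe mor1_space[OF m1(2)] by (intro fam_eqI) (simp add: fam_simps UV)
  from dual_comp_eq[OF q V mor.fam_comp[OF V g] this]
  have i': "fam_eq (fam_comp q' V') (fam_comp V' g')" .
  have UV': "fam_eq (fam_comp U' V') g'" by (rule dual_comp_eq[OF U V g VU])
  have UVe': "U' P (V' P \<phi>) = g' P \<phi>" if "\<phi> \<in> space" for P \<phi> using fam_eqD[OF UV' that, of P] by (simp add: fam_simps)
  have gg': "fam_eq (fam_comp g' g') g'" by (rule dual_comp_eq[OF g g g gg])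
  have gge': "g' P (g' P \<phi>) = g' P \<phi>" if "\<phi> \<in> space" for P \<phi> using fam_eqD[OF gg' that, of P] by (simp add: fam_simps)
  have qq': "fam_eq (fam_comp q' q') q'" by (rule dual_comp_eq[OF q q q qq])
  have "ev (\<lambda>u. wk c (lab u)) (\<lambda>u. fk q q' (lab u)) 0 0 D
      (lops (wk a) (tk U V') (map lab (line 0 0)) 0 \<psi>) = ev (\<lambda>u. wk a (lab u)) (\<lambda>u. fk g g' (lab u)) 0 0 D \<psi>"
  proof (rule ev_transfer[where opp = opposite])
    show "cons_word opposite lab 0 0 D" by (rule D(2))
    show "final_width 0 D = 0" using D(1) by (simp add: link_diagram_def closes_from_iff)
    show "\<psi> \<in> space" by (rule \<psi>)
    show "wk a x = wk a y" "wk c x = wk c y" if "opposite x y" for x y using wk_opposite that by blast+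
    show "mor1 (wk a x) (wk a x) (fk g g' x)" "mor1 (wk c x) (wk c x) (fk q q' x)" for x
      by (rule mor1_fk[OF g], rule mor1_fk[OF q])
    show "mor1 (wk a x) (wk c x) (tk U V' x)" for x
      using m1(1) m1'(2) mor1_id by (simp add: wk_def tk_def)
    show "fam_eq (fam_comp (fk g g' x) (fk g g' x)) (fk g g' x)" for x by (rule fk_comp[OF gg gg'])
    show "fam_eq (fam_comp (fk q q' x) (fk q q' x)) (fk q q' x)" for x by (rule fk_comp[OF qq qq'])
    show "fam_eq (fam_comp (fk q q' x) (tk U V' x)) (fam_comp (tk U V' x) (fk g g' x))" for x
      using i i' by (simp add: fk_def tk_def fam_eq_def)
  next
    fix x y P \<phi> assume o: "opposite x y" and \<phi>: "\<phi> \<in> space"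
    consider (other) "fst x \<noteq> k0" "fst y \<noteq> k0" | (up) "fst x = k0" "fst y = k0" "snd x" "\<not> snd y"
      | (down) "fst x = k0" "fst y = k0" "\<not> snd x" "snd y" using o by (auto simp: opposite_def)
    then show "fk q q' x P (fk q q' y (P + wk c x) (tk U V' x P (tk U V' y (P + wk a x) (cups (wk a x) P \<phi>)))) =
       fk q q' x P (fk q q' y (P + wk c x) (cups (wk c x) P \<phi>))"
    proof cases
      case other
      then show ?thesis by (simp add: tk_def wk_def fam_simps)
    next
      case up
      \<comment> \<open>\<open>V'\<close> slides over the cups and becomes \<open>V\<close> on the
        left leg, where \<open>U\<close> after \<open>V\<close> is the idempotent
        \<open>q\<close>.\<close>
      have "U P (V' (P + a) (cups a P \<phi>)) = q P (cups c P \<phi>)"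
        using cups_slide[OF V \<phi>, of P] by (simp add: UV)
      moreover have ic: "q P (q' (P + c) (cups c P \<phi>)) = q' (P + c) (q P (cups c P \<phi>))"
        using interchange1[OF m1(4) m1'(4) cups_space[OF \<phi>], of P "P + c" c P] by simp
      moreover from qqe[OF mor1_space[OF m1'(4) cups_space[OF \<phi>]]]
      have "q P (q' (P + c) (q P (cups c P \<phi>))) = q P (q' (P + c) (cups c P \<phi>))"
        by (subst ic[symmetric])
      ultimately show ?thesis using up by (simp add: fk_def tk_def wk_def)
    next
      case down
      have s: "cups a P \<phi> \<in> space" "cups c P \<phi> \<in> space" using \<phi> by simp_all
      have "V' P (U (P + a) (cups a P \<phi>)) = U (P + c) (V' P (cups a P \<phi>))"
        using interchange1[OF m1'(2) m1(1) s(1), of P "P + a"] by simp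
      also have "\<dots> = q (P + c) (cups c P \<phi>)"
        using cups_slide[OF mor_sym[OF V] \<phi>, of P] by (simp add: UV)
      finally have "q (P + c) (V' P (U (P + a) (cups a P \<phi>))) = q (P + c) (cups c P \<phi>)"
        using qqe[OF s(2)] by simp
      then show ?thesis using down by (simp add: fk_def tk_def wk_def)
    qed
  next
    fix x y P \<phi> assume o: "opposite x y" and \<phi>: "\<phi> \<in> space"
    consider (other) "fst x \<noteq> k0" "fst y \<noteq> k0" | (up) "fst x = k0" "fst y = k0" "snd x" "\<not> snd y"
      | (down) "fst x = k0" "fst y = k0" "\<not> snd x" "snd y" using o by (auto simp: opposite_def)
    then show "caps (wk c x) P (tk U V' x P (tk U V' y (P + wk a x) (fk g g' x P (fk g g' y (P + wk a x) \<phi>)))) =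
       caps (wk a x) P (fk g g' x P (fk g g' y (P + wk a x) \<phi>))"
    proof cases
      case other
      then show ?thesis by (simp add: tk_def wk_def fam_simps)
    next
      case up
      let ?\<rho> = "g P (g' (P + a) \<phi>)"
      have s: "g' (P + a) \<phi> \<in> space" "?\<rho> \<in> space" "V' (P + a) ?\<rho> \<in> space"
        using mor1_space[OF m1'(3) \<phi>] mor1_space[OF m1(3)] mor1_space[OF m1'(2)] by auto
      \<comment> \<open>\<open>U\<close> slides over the caps and meets \<open>V'\<close> on the
        right leg; together they give \<open>g'\<close>, which the idempotent already present
        absorbs.\<close>
      have "caps c P (U P (V' (P + a) ?\<rho>)) = caps a P (g' (P + a) ?\<rho>)"
        using caps_slide[OF U s(3), of P] UVe'[OF s(2)] by simp
      also have "g' (P + a) ?\<rho> = g P (g' (P + a) (g' (P + a) \<phi>))"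
        using interchange1[OF m1(3) m1'(3) s(1), of P "P + a"] by simp
      also have "\<dots> = ?\<rho>" using gge'[OF \<phi>] by simp
      finally show ?thesis using up by (simp add: fk_def tk_def wk_def)
    next
      case down
      let ?\<rho> = "g' P (g (P + a) \<phi>)"
      have s: "g (P + a) \<phi> \<in> space" "?\<rho> \<in> space" "U (P + a) ?\<rho> \<in> space"
        using mor1_space[OF m1(3) \<phi>] mor1_space[OF m1'(3)] mor1_space[OF m1(1)] by auto
      have "caps c P (V' P (U (P + a) ?\<rho>)) = caps a P (g (P + a) ?\<rho>)"
        using caps_slide[OF mor_sym[OF V] s(3), of P] VUe[OF s(2)] by simp
      also have "g (P + a) ?\<rho> = g' P (g (P + a) (g (P + a) \<phi>))"
        using interchange1[OF m1'(3) m1(3) s(1), of P "P + a"] by simp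
      also have "\<dots> = ?\<rho>" using gge[OF \<phi>] by simp
      finally show ?thesis using down by (simp add: fk_def tk_def wk_def)
    qed
  qed
  then show ?thesis by (simp add: line_def q_def q'_def)
qed

end

end

section \<open>The bound\<close>

lemma closes_cups:
  "P \<le> w \<Longrightarrow> closes_from w (map (\<lambda>s. Cup (P + s)) [0..<m] @ D) \<longleftrightarrow> closes_from (w + 2 * m) D"
  by (induction m arbitrary: D) simp_all

lemma closes_caps:
  "P + 2 * m \<le> w \<Longrightarrow> closes_from w (map (\<lambda>s. Cap (P + s)) (rev [0..<m]) @ D) \<longleftrightarrow> closes_from (w - 2 * m) D"
proof (induction m arbitrary: w)
  case (Suc m)
  then show ?case using Suc.IH[of "w - 2"] by (simp add: diff_diff_eq)
qed simp

lemma closes_crossings: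
  "(\<And>s. s \<in> set C \<Longrightarrow> \<exists>b p. s = Crossing b p \<and> p + 2 \<le> w) \<Longrightarrow> closes_from w (C @ D) \<longleftrightarrow> closes_from w D"
proof (induction C)
  case (Cons s C)
  then obtain b p where "s = Crossing b p" "p + 2 \<le> w" by (meson list.set_intros(1))
  then show ?case using Cons by simp
qed simp

lemma closes_cable:
  "cons_word (=) \<mu> j w D \<Longrightarrow> final_width w D = 0 \<Longrightarrow> closes_from (off \<mu> j w) (cable_from j \<mu> D)"
proof (induction D arbitrary: j w)
  case Nil
  then show ?case by (simp add: off_def)
next
  case (Cons s D)
  have IH: "closes_from (off \<mu> (Suc j) (width_above w s)) (cable_from (Suc j) \<mu> D)"
    using Cons by simp
  show ?case
  proof (cases s)
    case (Cup p)
    then have c: "cons_slice (=) \<mu> j w (Cup p)" "p \<le> w" using Cons.prems by simp_all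
    then show ?thesis
      using IH Cup closes_cups[OF off_mono[OF c(2), of \<mu> j]] off_Cup_right[OF c(1,2) order_refl]
      by (simp add: Let_def off_def[symmetric])
  next
    case (Cap p)
    then have c: "cons_slice (=) \<mu> j w (Cap p)" "p + 2 \<le> w" using Cons.prems by simp_all
    have "p \<le> w - 2" "w - 2 + 2 \<le> w" "w - 2 + 2 = w" using c(2) by simp_all
    then have o: "off \<mu> j w = off \<mu> (Suc j) (w - 2) + 2 * \<mu> (j, p)" using off_Cap_right[OF c(1), of "w - 2"] by simp
    have "off \<mu> j p \<le> off \<mu> (Suc j) (w - 2)"
      using off_mono[OF \<open>p \<le> w - 2\<close>, of \<mu> "Suc j"] off_Cap_left[OF c(1) order_refl] by simp
    then have "off \<mu> j p + 2 * \<mu> (j, p) \<le> off \<mu> j w" using o by simp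
    from closes_caps[OF this] show ?thesis
      using IH Cap o by (simp add: Let_def off_def[symmetric])
  next
    case (Crossing b p)
    then have c: "cons_slice (=) \<mu> j w (Crossing b p)" "p + 2 \<le> w" using Cons.prems by simp_all
    have "off \<mu> j p + \<mu> (j, p) + \<mu> (j, Suc p) \<le> off \<mu> j w" using off_mono[OF c(2), of \<mu> j] by simp
    then have "closes_from (off \<mu> j w) (concat (map (\<lambda>s. map (\<lambda>t. Crossing b (off \<mu> j p + s + t)) [0..<\<mu> (j, Suc p)])
        (rev [0..<\<mu> (j, p)])) @ cable_from (Suc j) \<mu> D) \<longleftrightarrow> closes_from (off \<mu> j w) (cable_from (Suc j) \<mu> D)"
      by (intro closes_crossings) auto
    then show ?thesis
      using IH Crossing off_Crossing_right[OF c order_refl] by (simp add: Let_def off_def[symmetric])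
  qed
qed

lemma cons_word_map: "cons_word (=) f j w D \<Longrightarrow> cons_word (=) (\<lambda>u. g (f u)) j w D"
proof (induction D arbitrary: j w)
  case (Cons s D)
  then show ?case by (cases s) auto
qed simp

text \<open>The linear functional that sends \<open>z ^ a\<close> to \<open>F a\<close>.\<close>

definition polysum :: "(nat \<Rightarrow> complex) \<Rightarrow> int poly \<Rightarrow> complex" where
  "polysum F p = (\<Sum>a\<le>degree p. of_int (coeff p a) * F a)"

lemma polysum_eq: "degree p \<le> N \<Longrightarrow> polysum F p = (\<Sum>a\<le>N. of_int (coeff p a) * F a)"
  unfolding polysum_def by (rule sum.mono_neutral_left) (auto simp: coeff_eq_0)

lemma polysum_diff: "polysum F (p - q) = polysum F p - polysum F q"
proof -
  let ?N = "max (degree p) (degree q)"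
  have "polysum F (p - q) = (\<Sum>a\<le>?N. of_int (coeff (p - q) a) * F a)"
    by (rule polysum_eq[OF degree_diff_le_max])
  also have "\<dots> = polysum F p - polysum F q"
    using polysum_eq[of p ?N F] polysum_eq[of q ?N F] by (simp add: left_diff_distrib sum_subtractf)
  finally show ?thesis .
qed

lemma polysum_shift: "polysum F ([:0, 1:] * p) = polysum (\<lambda>a. F (Suc a)) p"
proof -
  have "polysum F (pCons 0 p) = (\<Sum>a\<le>Suc (degree p). of_int (coeff (pCons 0 p) a) * F a)"
    by (rule polysum_eq[OF degree_pCons_le])
  then show ?thesis unfolding sum.atMost_Suc_shift by (simp add: polysum_def)
qed

text \<open>\<open>G j b\<close> stands for the value of \<open>e_poly j * z ^ b\<close> on one
  component. The second assumption is then the recursion of \<open>e_poly\<close>, which is unwound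
  down to colour 0.\<close>

lemma polysum_e_poly:
  assumes "\<And>b. G 0 (Suc b) = G 1 b"
    and "\<And>n b. Suc (Suc n) < r \<Longrightarrow> G (Suc n) (Suc b) = G (Suc (Suc n)) b + G n b"
  shows "j < r \<Longrightarrow> G j b = polysum (\<lambda>a. G 0 (a + b)) (e_poly j)"
proof (induction j arbitrary: b rule: e_poly.induct)
  case 1
  then show ?case by (simp add: polysum_def)
next
  case 2
  then show ?case using assms(1) by (simp add: polysum_def)
next
  case (3 j)
  have "G (Suc (Suc j)) b = G (Suc j) (Suc b) - G j b" using assms(2)[OF "3.prems", of b] by simp
  then show ?case unfolding e_poly.simps polysum_diff polysum_shift using 3 by simp
qed

context path_model begin

lemma ln_cong_line:
  assumes "\<And>u. u \<in> set (line j w) \<Longrightarrow> wd u = wd' u \<and> X u = X' u"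
  shows "ln wd X j w = ln wd' X' j w"
proof -
  have "ents wd X (line j w) = ents wd' X' (line j w)" unfolding ents_def using assms by (intro map_cong) auto
  then show ?thesis unfolding ln_def by simp
qed

lemma ev_cong:
  assumes "closes_from w D" "\<And>u. u \<in> lines j w D \<Longrightarrow> wd u = wd' u \<and> X u = X' u"
  shows "ev wd X j w D \<psi> = ev wd' X' j w D \<psi>"
  using assms
proof (induction D arbitrary: j w \<psi>)
  case Nil
  have "ln wd X j w = ln wd' X' j w" by (rule ln_cong_line, rule Nil.prems(2)) simp
  then show ?case by simp
next
  case (Cons s D)
  have top: "set (line (Suc j) (width_above w s)) \<subseteq> lines (Suc j) (width_above w s) D"
    by (cases D) auto
  have here: "wd (j, q) = wd' (j, q)" if "q < w" for q using Cons.prems(2)[of "(j, q)"] that by simp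
  have off: "off wd j p = off wd' j p" if "p \<le> w" for p
    unfolding off_def using here that by (intro sum.cong) auto
  have "sop wd j s = sop wd' j s"
  proof (cases s)
    case (Cup p)
    then have "(Suc j, p) \<in> lines (Suc j) (width_above w s) D" using top Cons.prems(1) by auto
    then have "wd (Suc j, p) = wd' (Suc j, p)" using Cons.prems(2) by simp
    then show ?thesis using Cup off Cons.prems(1) by simp
  next
    case (Cap p)
    then show ?thesis using here off Cons.prems(1) by simp
  next
    case (Crossing b p)
    then show ?thesis using here off Cons.prems(1) by simp
  qed
  moreover have "ln wd X j w = ln wd' X' j w" by (rule ln_cong_line, rule Cons.prems(2)) simp
  moreover have "ev wd X (Suc j) (width_above w s) D \<phi> = ev wd' X' (Suc j) (width_above w s) D \<phi>" for \<phi>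
    by (rule Cons.IH) (use Cons.prems in simp_all)
  ultimately show ?case by simp
qed

context
  fixes D :: "slice list" and lab :: "node \<Rightarrow> nat \<times> bool" and \<psi> :: vec and n :: nat
  assumes D: "link_diagram D" "cons_word opposite lab 0 0 D"
    and conn: "\<And>u v. u \<in> nodes D \<Longrightarrow> v \<in> nodes D \<Longrightarrow> fst (lab u) = fst (lab v) \<longleftrightarrow> (u, v) \<in> (adjacent D)\<^sup>*"
    and comps: "\<And>k. k < n \<Longrightarrow> \<exists>u\<in>nodes D. fst (lab u) = k"
    and \<psi>: "\<psi> \<in> space"
begin

definition coloured :: "(nat \<Rightarrow> nat) \<Rightarrow> (nat \<Rightarrow> nat) \<Rightarrow> vec" where
  "coloured jv bv = ev (\<lambda>u. width jv bv (lab u)) (\<lambda>u. colour jv bv (lab u)) 0 0 D \<psi>"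

lemma coloured_update:
  assumes "\<And>k. jv k < r"
  shows "coloured (jv(k0 := j)) (bv(k0 := b)) =
    ev (\<lambda>u. wk jv bv k0 (j + b) (lab u)) (\<lambda>u. fk jv bv k0 (jw j) (fam_at (jw j) b) (lab u)) 0 0 D \<psi>"
proof -
  have "width (jv(k0 := j)) (bv(k0 := b)) x = wk jv bv k0 (j + b) x" for x
    by (simp add: width_def wk_def[OF assms])
  moreover have "colour (jv(k0 := j)) (bv(k0 := b)) x = fk jv bv k0 (jw j) (fam_at (jw j) b) x" for x
    by (simp add: colour_def fk_def[OF assms])
  ultimately show ?thesis by (simp add: coloured_def)
qed

text \<open>A single strand is its own Jones-Wenzl idempotent.\<close>

lemma coloured_zero:
  assumes "\<And>k. jv k < r"
  shows "coloured (jv(k0 := 0)) (bv(k0 := Suc b)) = coloured (jv(k0 := 1)) (bv(k0 := b))"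
  unfolding coloured_update[OF assms] by (simp add: jw.simps fam_at_simps)

text \<open>One of the \<open>Suc b\<close> plain strands takes part in the fusion. The summand that
  factors through \<open>fuse_down\<close> is then carried over to the object with
  \<open>m + b\<close> strands.\<close>

lemma coloured_fusion:
  assumes jv: "\<And>k. jv k < r" and "k0 < n" and m: "Suc (Suc m) < r"
  shows "coloured (jv(k0 := Suc m)) (bv(k0 := Suc b)) =
    (\<lambda>h. coloured (jv(k0 := Suc (Suc m))) (bv(k0 := b)) h + coloured (jv(k0 := m)) (bv(k0 := b)) h)"
proof -
  obtain u' v' where uv: "mor m (m + 2) (fuse_up m) u'" "mor (m + 2) m (fuse_down m) v'"
    using mor1_fuse_up[of m] mor1_fuse_down[of m] unfolding mor1_def by blast
  define W where "W = m + 2 + b"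
  have U: "mor (m + b) W (fuse_up m) (fam_at u' b)" and V: "mor W (m + b) (fuse_down m) (fam_at v' b)"
    using mor_embed[OF uv(1), of 0 b] mor_embed[OF uv(2), of 0 b] by (simp_all add: fam_at_simps W_def)
  have f: "mor W W (jw (Suc m)) (fam_at (jw (Suc m)) (Suc b))" and p: "mor W W (jw (Suc (Suc m))) (fam_at (jw (Suc (Suc m))) b)"
    using mor_jw_pad[of "Suc m" "Suc b"] mor_jw_pad[of "Suc (Suc m)" b] m by (simp_all add: W_def)
  have g: "mor (m + b) (m + b) (jw m) (fam_at (jw m) b)" using mor_jw_pad[of m b] m by simp
  note q = mor.fam_comp[OF V U]
  have s: "fuse_up m P \<phi> \<in> space" "fuse_down m P \<phi> \<in> space" if "\<phi> \<in> space" for P \<phi>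
    using mor1_space[OF mor1_fuse_up that] mor1_space[OF mor1_fuse_down that] by auto
  let ?q = "fam_comp (fuse_up m) (fuse_down m)"
  have "coloured (jv(k0 := Suc m)) (bv(k0 := Suc b)) =
    ev (\<lambda>u. wk jv bv k0 W (lab u)) (\<lambda>u. fk jv bv k0 (jw (Suc m)) (fam_at (jw (Suc m)) (Suc b)) (lab u)) 0 0 D \<psi>"
    unfolding coloured_update[OF jv] by (simp add: W_def)
  also have "\<dots> = (\<lambda>h. ev (\<lambda>u. wk jv bv k0 W (lab u)) (\<lambda>u. fk jv bv k0 (jw (Suc (Suc m))) (fam_at (jw (Suc (Suc m))) b) (lab u)) 0 0 D \<psi> h
     + ev (\<lambda>u. wk jv bv k0 W (lab u)) (\<lambda>u. fk jv bv k0 ?q (fam_comp (fam_at v' b) (fam_at u' b)) (lab u)) 0 0 D \<psi> h)"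
  proof (rule split_component[OF jv D conn comps[OF \<open>k0 < n\<close>] f p q _ _ _ _ _ _ _ \<psi>])
    show "fam_eq (fam_comp (jw (Suc (Suc m))) (jw (Suc (Suc m)))) (jw (Suc (Suc m)))" by (rule jw_idem[OF m])
    show "fam_eq (fam_comp ?q ?q) ?q"
      by (rule fam_eqI) (simp add: fam_simps fuse_down_up[OF m] jw_fuse_down[OF m] s)
    show "fam_eq (fam_comp (jw (Suc (Suc m))) (jw (Suc m))) (jw (Suc (Suc m)))"
      by (rule fam_eqI) (use m in \<open>simp add: fam_simps jw_absorb_right\<close>)
    show "fam_eq (fam_comp (jw (Suc m)) (jw (Suc (Suc m)))) (jw (Suc (Suc m)))"
      by (rule fam_eqI) (use m in \<open>simp add: fam_simps jw_absorb_left\<close>)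
    show "fam_eq (fam_comp ?q (jw (Suc m))) ?q"
      by (rule fam_eqI) (use m in \<open>simp add: fam_simps fuse_down_apply jw_absorb_left\<close>)
    show "fam_eq (fam_comp (jw (Suc m)) ?q) ?q"
      by (rule fam_eqI) (use m s in \<open>simp add: fam_simps fuse_up_apply jw_absorb_left\<close>)
    show "fam_eq (jw (Suc m)) (fam_lin 1 (jw (Suc (Suc m))) 1 ?q)"
      by (rule fam_eqI) (simp add: fam_simps fusion[OF m])
  qed
  also have "ev (\<lambda>u. wk jv bv k0 W (lab u)) (\<lambda>u. fk jv bv k0 ?q (fam_comp (fam_at v' b) (fam_at u' b)) (lab u)) 0 0 D \<psi> =
      ev (\<lambda>u. wk jv bv k0 (m + b) (lab u)) (\<lambda>u. fk jv bv k0 (jw m) (fam_at (jw m) b) (lab u)) 0 0 D \<psi>"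
  proof (rule transfer_component[OF jv D U V g _ _ _ \<psi>])
    show "fam_eq (fam_comp (fuse_down m) (fuse_up m)) (jw m)"
      by (rule fam_eqI) (simp add: fam_simps fuse_down_up[OF m])
    show "fam_eq (fam_comp (jw m) (jw m)) (jw m)" using m by (intro jw_idem) simp
    show "fam_eq (fam_comp (jw m) (fuse_down m)) (fuse_down m)"
      by (rule fam_eqI) (simp add: fam_simps jw_fuse_down[OF m])
  qed
  finally show ?thesis unfolding coloured_update[OF jv] by (simp add: W_def)
qed

text \<open>The components are expanded one after another; those below \<open>m\<close> are plain
  cables already.\<close>

lemma coloured_expand:
  assumes jv: "\<And>k. jv k < r" and bv: "\<And>k. k < n \<Longrightarrow> bv k = 0" and "m \<le> n"
  shows "coloured jv bv h = (\<Sum>a\<in>PiE {..<m} (\<lambda>k. {..degree (e_poly (jv k))}).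
    (\<Prod>k<m. of_int (coeff (e_poly (jv k)) (a k))) *
      coloured (\<lambda>k. if k < m then 0 else jv k) (\<lambda>k. if k < m then a k else bv k) h)"
  using \<open>m \<le> n\<close>
proof (induction m)
  case (Suc m)
  let ?T = "\<lambda>k. {..degree (e_poly (jv k))}"
  let ?c = "\<lambda>a k. of_int (coeff (e_poly (jv k)) (a k)) :: complex"
  let ?X = "\<lambda>m k. if k < m then 0 else jv k"
  let ?Y = "\<lambda>m a k. if k < m then a k else bv k"
  have X: "?X m k < r" for k using jv[of k] r_ge_3 by simp
  have step: "coloured (?X m) (?Y m g) h =
      (\<Sum>y\<in>?T m. of_int (coeff (e_poly (jv m)) y) * coloured (?X (Suc m)) (?Y (Suc m) (g(m := y))) h)" for g
  proof -
    \<comment> \<open>With all components except \<open>m\<close> frozen, the recursion of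
      \<open>polysum_e_poly\<close> in one variable applies.\<close>
    define G where "G j b = coloured ((?X m)(m := j)) ((?Y m g)(m := b)) h" for j b
    have "G (jv m) 0 = polysum (\<lambda>a. G 0 (a + 0)) (e_poly (jv m))"
    proof (rule polysum_e_poly[OF _ _ jv])
      show "G 0 (Suc b) = G 1 b" for b unfolding G_def coloured_zero[OF X] ..
      show "G (Suc i) (Suc b) = G (Suc (Suc i)) b + G i b" if "Suc (Suc i) < r" for i b
        unfolding G_def using coloured_fusion[OF X _ that, where ?k0.0 = m and bv = "?Y m g" and b = b] Suc.prems by simp
    qed
    moreover have "(?X m)(m := jv m) = ?X m" "(?Y m g)(m := 0) = ?Y m g" using bv Suc.prems by (auto simp: fun_eq_iff)
    moreover have "(?X m)(m := 0) = ?X (Suc m)" "(?Y m g)(m := y) = ?Y (Suc m) (g(m := y))" for y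
      by (auto simp: fun_eq_iff less_Suc_eq)
    ultimately show ?thesis unfolding G_def polysum_def by simp
  qed
  have "(\<Sum>a\<in>PiE {..<Suc m} ?T. (\<Prod>k<Suc m. ?c a k) * coloured (?X (Suc m)) (?Y (Suc m) a) h) =
     (\<Sum>(y, g)\<in>?T m \<times> PiE {..<m} ?T. (\<Prod>k<Suc m. ?c (g(m := y)) k) * coloured (?X (Suc m)) (?Y (Suc m) (g(m := y))) h)"
    unfolding lessThan_Suc PiE_insert_eq
    by (subst sum.reindex[OF inj_combinator]) (simp_all add: case_prod_unfold)
  also have "\<dots> = (\<Sum>y\<in>?T m. \<Sum>g\<in>PiE {..<m} ?T. (\<Prod>k<Suc m. ?c (g(m := y)) k) * coloured (?X (Suc m)) (?Y (Suc m) (g(m := y))) h)"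
    by (rule sum.cartesian_product[symmetric])
  also have "\<dots> = (\<Sum>g\<in>PiE {..<m} ?T. \<Sum>y\<in>?T m. (\<Prod>k<Suc m. ?c (g(m := y)) k) * coloured (?X (Suc m)) (?Y (Suc m) (g(m := y))) h)"
    by (rule sum.swap)
  also have "\<dots> = (\<Sum>g\<in>PiE {..<m} ?T. (\<Prod>k<m. ?c g k) * coloured (?X m) (?Y m g) h)"
  proof (rule sum.cong[OF refl])
    fix g
    have "(\<Prod>k<Suc m. ?c (g(m := y)) k) = (\<Prod>k<m. ?c g k) * of_int (coeff (e_poly (jv m)) y)" for y by simp
    then show "(\<Sum>y\<in>?T m. (\<Prod>k<Suc m. ?c (g(m := y)) k) * coloured (?X (Suc m)) (?Y (Suc m) (g(m := y))) h) =
        (\<Prod>k<m. ?c g k) * coloured (?X m) (?Y m g) h"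
      unfolding step by (simp add: sum_distrib_left mult.assoc)
  qed
  finally show ?case using Suc by simp
qed simp

end

theorem poly_bracket_bound:
  assumes D: "labelled_diagram n D c" and i: "\<And>k. k < n \<Longrightarrow> 1 \<le> i k \<and> i k \<le> r - 1"
  shows "cmod (poly_bracket A n D c (\<lambda>k. e_poly (i k - 1))) \<le> real r ^ length D"
proof -
  have L: "link_diagram D" "c ` nodes D = {..<n}"
    and conn: "\<And>u v. u \<in> nodes D \<Longrightarrow> v \<in> nodes D \<Longrightarrow> c u = c v \<longleftrightarrow> (u, v) \<in> (adjacent D)\<^sup>*"
    using D unfolding labelled_diagram_def by auto
  have closes: "closes_from 0 D" "final_width 0 D = 0" using L(1) by (simp_all add: link_diagram_def closes_from_iff)
  have c: "cons_word (=) c 0 0 D"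
  proof (rule cons_word_component[OF closes(1)])
    fix u m v assume "(u, m, v) \<in> arcs_from 0 0 D"
    then have "(u, v) \<in> adjacent D" unfolding adjacent_def arcs_def by blast
    moreover from this have "u \<in> nodes D" "v \<in> nodes D" by (auto simp: nodes_def Field_def)
    ultimately show "c u = c v" using conn by blast
  qed
  obtain f :: "node \<Rightarrow> bool" where f: "cons_word (\<noteq>) f 0 0 D" using orientation_exists[OF closes(1)] by blast
  define lab where "lab u = (c u, f u)" for u
  have lab: "cons_word opposite lab 0 0 D"
  proof -
    have "opposite = (\<lambda>x y. fst x = fst y \<and> snd x \<noteq> snd y)" by (simp add: opposite_def fun_eq_iff)
    then show ?thesis using cons_word_pair[OF c f] unfolding lab_def by simp
  qed
  have comps: "\<exists>u\<in>nodes D. fst (lab u) = k" if "k < n" for k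
  proof -
    have "k \<in> c ` nodes D" using L(2) that by blast
    then show ?thesis by (auto simp: lab_def)
  qed
  have conn': "fst (lab u) = fst (lab v) \<longleftrightarrow> (u, v) \<in> (adjacent D)\<^sup>*" if "u \<in> nodes D" "v \<in> nodes D" for u v
    using conn that by (simp add: lab_def)
  define h0 :: "nat \<Rightarrow> nat" where "h0 i = (if even i then 1 else 2)" for i
  have fp: "fpaths 0 = {h0}" unfolding fpaths_0 h0_def ..
  then have "h0 \<in> paths" using fpaths_pathsD by blast
  \<comment> \<open>The unit vector at the only walk on no strands; evaluating at \<open>h0\<close>
    reads off the scalar.\<close>
  define \<psi> :: vec where "\<psi> h = (if h = h0 then 1 else 0)" for h
  have \<psi>: "\<psi> \<in> space" using \<open>h0 \<in> paths\<close> by (auto simp: space_def \<psi>_def)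
  note col = coloured_expand[OF L(1) lab conn' comps \<psi>] coloured_def[OF L(1) lab conn' comps \<psi>]
  define jv where "jv k = (if k < n then i k - 1 else 0)" for k
  \<comment> \<open>The value \<open>undefined\<close> makes the exponents agree with the
    extensional functions in \<open>PiE\<close>.\<close>
  define bv :: "nat \<Rightarrow> nat" where "bv k = (if k < n then 0 else undefined)" for k
  have jv: "Suc (jv k) < r" for k using i[of k] r_ge_3 by (auto simp: jv_def)
  have cable: "ev (\<lambda>u. width (\<lambda>_. 0) a (lab u)) (\<lambda>u. colour (\<lambda>_. 0) a (lab u)) 0 0 D \<psi> h0 = cabled_bracket A D c a" for a
  proof -
    have "colour (\<lambda>_. 0) a x = fam_id" for x by (simp add: colour_def jw.simps fam_at_simps)
    then have "ev (\<lambda>u. width (\<lambda>_. 0) a (lab u)) (\<lambda>u. colour (\<lambda>_. 0) a (lab u)) 0 0 D \<psi> = ev (a \<circ> c) (\<lambda>u. fam_id) 0 0 D \<psi>"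
      by (simp add: width_def lab_def comp_def)
    also have "\<dots> = word_act (cable_from 0 (a \<circ> c) D) \<psi>" by (rule word_act_cable[symmetric])
    finally show ?thesis
      using word_act_kauffman[OF _ \<psi>, of "cable_from 0 (a \<circ> c) D" h0] closes_cable[OF cons_word_map[OF c, of a] closes(2)]
      by (simp add: cabled_bracket_def \<psi>_def off_def comp_def)
  qed
  have "poly_bracket A n D c (\<lambda>k. e_poly (i k - 1)) =
      (\<Sum>a\<in>PiE {..<n} (\<lambda>k. {..degree (e_poly (jv k))}). (\<Prod>k<n. of_int (coeff (e_poly (jv k)) (a k))) *
         ev (\<lambda>u. width (\<lambda>_. 0) a (lab u)) (\<lambda>u. colour (\<lambda>_. 0) a (lab u)) 0 0 D \<psi> h0)"
    unfolding poly_bracket_def cable by (intro sum.cong PiE_cong prod.cong arg_cong2[where f = "(*)"]) (auto simp: jv_def)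
  also have "\<dots> = (\<Sum>a\<in>PiE {..<n} (\<lambda>k. {..degree (e_poly (jv k))}). (\<Prod>k<n. of_int (coeff (e_poly (jv k)) (a k))) *
         coloured D lab \<psi> (\<lambda>k. if k < n then 0 else jv k) (\<lambda>k. if k < n then a k else bv k) h0)"
  proof (rule sum.cong[OF refl])
    fix a assume "a \<in> PiE {..<n} (\<lambda>k. {..degree (e_poly (jv k))})"
    then have "(\<lambda>k. if k < n then a k else bv k) = a" by (auto simp: fun_eq_iff bv_def PiE_def extensional_def)
    moreover have "(\<lambda>k. if k < n then 0 else jv k) = (\<lambda>_. 0)" by (simp add: fun_eq_iff jv_def)
    ultimately show "(\<Prod>k<n. of_int (coeff (e_poly (jv k)) (a k))) *
         ev (\<lambda>u. width (\<lambda>_. 0) a (lab u)) (\<lambda>u. colour (\<lambda>_. 0) a (lab u)) 0 0 D \<psi> h0 =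
       (\<Prod>k<n. of_int (coeff (e_poly (jv k)) (a k))) *
         coloured D lab \<psi> (\<lambda>k. if k < n then 0 else jv k) (\<lambda>k. if k < n then a k else bv k) h0"
      using col(2) by simp
  qed
  also have "\<dots> = coloured D lab \<psi> jv bv h0"
    by (rule col(1)[symmetric]) (use jv in \<open>auto simp: bv_def Suc_lessD\<close>)
  \<comment> \<open>Without plain strands the rotated coupon is \<open>jw\<close> itself, so the
    orientations drop out.\<close>
  also have "coloured D lab \<psi> jv bv = ev (\<lambda>u. jv (c u)) (\<lambda>u. jw (jv (c u))) 0 0 D \<psi>"
  proof -
    have "ev (\<lambda>u. width jv bv (lab u)) (\<lambda>u. colour jv bv (lab u)) 0 0 D \<psi> = ev (\<lambda>u. jv (c u)) (\<lambda>u. jw (jv (c u))) 0 0 D \<psi>"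
    proof (rule ev_cong[OF closes(1)])
      fix u assume "u \<in> lines 0 0 D"
      then have "c u < n" using lines_subset_nodes[OF L(1)] L(2) by auto
      then show "width jv bv (lab u) = jv (c u) \<and> colour jv bv (lab u) = jw (jv (c u))"
        by (simp add: width_def colour_def lab_def bv_def fam_at_simps)
    qed
    then show ?thesis using col(2) by simp
  qed
  finally have Z: "poly_bracket A n D c (\<lambda>k. e_poly (i k - 1)) = ev (\<lambda>u. jv (c u)) (\<lambda>u. jw (jv (c u))) 0 0 D \<psi> h0" .
  have "nsq 0 (ev (\<lambda>u. jv (c u)) (\<lambda>u. jw (jv (c u))) 0 0 D \<psi>) \<le> real r ^ length D *
      nsq (off (\<lambda>u. jv (c u)) 0 0) (ln (\<lambda>u. jv (c u)) (\<lambda>u. jw (jv (c u))) 0 0 \<psi>)"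
    by (rule nsq_ev_le[OF cons_word_map[OF c] closes(2) jv \<psi>])
  then have sq: "(cmod (poly_bracket A n D c (\<lambda>k. e_poly (i k - 1))))\<^sup>2 \<le> real r ^ length D"
    unfolding Z by (simp add: nsq_def fp off_def ln_def line_def \<psi>_def)
  show ?thesis
  proof (rule power2_le_imp_le)
    \<comment> \<open>A number that is at least 1 is at most its own square, so the bound on the
      squared modulus also bounds the modulus.\<close>
    have "real r ^ length D \<ge> 1" using r_ge_3 by (intro one_le_power) simp
    then have "real r ^ length D \<le> (real r ^ length D)\<^sup>2" by (intro self_le_power) simp_all
    with sq show "(cmod (poly_bracket A n D c (\<lambda>k. e_poly (i k - 1))))\<^sup>2 \<le> (real r ^ length D)\<^sup>2" by linarith
  qed simp
qed

end

theorem corollary1p5: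
  fixes n :: nat and L :: "nat \<Rightarrow> space4 set"
  assumes "is_link n L"
  shows "\<exists>C>0. \<exists>N::nat. \<forall>r::nat. \<forall>i::nat \<Rightarrow> nat.
           r \<ge> 3 \<longrightarrow> (\<forall>k<n. 1 \<le> i k \<and> i k \<le> r - 1) \<longrightarrow>
           colored_jones_modulus n L i (exp (of_real pi * \<i> / (2 * of_nat r))) \<le> C * real r ^ N"
proof -
  \<comment> \<open>The definition selects some diagram; \<open>is_link\<close> ensures that one
    exists, so the selected pair is a diagram of the link.\<close>
  obtain D c where Dc: "(SOME (D, c). diagram_of n L D c) = (D, c)" by (metis prod.exhaust)
  have "\<exists>x. case x of (D, c) \<Rightarrow> diagram_of n L D c" using assms by (auto simp: is_link_def)
  then have "case (SOME (D, c). diagram_of n L D c) of (D, c) \<Rightarrow> diagram_of n L D c" by (rule someI_ex)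
  then have D: "labelled_diagram n D c" unfolding Dc by (simp add: diagram_of_def)
  have "colored_jones_modulus n L i (exp (of_real pi * \<i> / (2 * of_nat r))) \<le> 1 * real r ^ length D"
    if "r \<ge> 3" "\<forall>k<n. 1 \<le> i k \<and> i k \<le> r - 1" for r i
  proof -
    interpret path_model r by unfold_locales (rule that(1))
    show ?thesis using poly_bracket_bound[OF D, of i] that(2)
      unfolding colored_jones_modulus_def Dc A_def by simp
  qed
  \<comment> \<open>Both constants come from the selected diagram alone and thus serve all
    \<open>r\<close> and all colours.\<close>
  then show ?thesis by (intro exI[of _ "1::real"] conjI exI[of _ "length D"]) auto
qed

end
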